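(* Let $n\ge 2$, let $W\in C^2(\mathbb{R}^n;\mathbb{R})$ with $W\ge 0$, and let $u\in W^{1,2}_{\mathrm{loc}}(\mathbb{R}^n;\mathbb{R}^n)\cap L^\infty_{\mathrm{loc}}(\mathbb{R}^n;\mathbb{R}^n)$ be a solution of the system $$\Delta u-W_u(u)=0\quad\text{in }\mathbb{R}^n.$$ If $$\int_{\mathbb{R}^n}\left(\frac12|\nabla u|^2+W(u)\right)dx<\infty,$$ then $u$ is constant.
   Context: $W_u=(\partial W/\partial u_1,\dots,\partial W/\partial u_n)^\top$ is the gradient of $W$; $\nabla u$ is the $n\times n$ matrix $(\partial u_i/\partial x_j)$ and $|\nabla u|$ is its Euclidean norm, $|\nabla u|^2=\sum_{i,j}(\partial u_i/\partial x_j)^2$. Solutions are understood in the weak (distributional) sense, and functions are identified when they agree almost everywhere. *)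

theory Defs
  imports "HOL-Analysis.Analysis"
begin

text \<open>\<open>frechet_derivative\<close> is arbitrary at points of non-differentiability, so
  \<open>partial\<close> is only meaningful for differentiable functions.\<close>

definition partial :: "'n \<Rightarrow> (real ^ 'n \<Rightarrow> real) \<Rightarrow> real ^ 'n::finite \<Rightarrow> real" where
  "partial j f x = frechet_derivative f (at x) (axis j 1)"

definition gradient :: "(real ^ 'n \<Rightarrow> real) \<Rightarrow> real ^ 'n::finite \<Rightarrow> real ^ 'n" where
  "gradient f x = (\<chi> j. partial j f x)"

definition laplacian :: "(real ^ 'n \<Rightarrow> real) \<Rightarrow> real ^ 'n::finite \<Rightarrow> real" where
  "laplacian f x = (\<Sum>j\<in>UNIV. partial j (partial j f) x)"

primrec C_k :: "nat \<Rightarrow> (real ^ 'n::finite \<Rightarrow> real) \<Rightarrow> bool" where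
  "C_k 0 f \<longleftrightarrow> continuous_on UNIV f"
| "C_k (Suc k) f \<longleftrightarrow> (\<forall>x. f differentiable (at x)) \<and> (\<forall>j. C_k k (partial j f))"

definition test_function :: "(real ^ 'n::finite \<Rightarrow> real) \<Rightarrow> bool" where
  "test_function \<phi> \<longleftrightarrow> (\<forall>k. C_k k \<phi>) \<and> compact (closure {x. \<phi> x \<noteq> 0})"

definition Lp_loc :: "nat \<Rightarrow> ('a::euclidean_space \<Rightarrow> 'b::euclidean_space) set" where
  "Lp_loc p = {f \<in> borel_measurable lebesgue.
     \<forall>K. compact K \<longrightarrow> set_integrable lebesgue K (\<lambda>x. norm (f x) ^ p)}"

definition Linf_loc :: "('a::euclidean_space \<Rightarrow> 'b::euclidean_space) set" where
  "Linf_loc = {f \<in> borel_measurable lebesgue.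
     \<forall>K. compact K \<longrightarrow> (\<exists>C. AE x in lebesgue. x \<in> K \<longrightarrow> norm (f x) \<le> C)}"

text \<open>Distributional derivatives represented by locally integrable functions. Local
  integrability is required explicitly, so that every Bochner integral below is a
  genuine one rather than the default value 0.\<close>

definition has_weak_partial ::
    "'n \<Rightarrow> (real ^ 'n::finite \<Rightarrow> real) \<Rightarrow> (real ^ 'n \<Rightarrow> real) \<Rightarrow> bool" where
  "has_weak_partial j f g \<longleftrightarrow> f \<in> Lp_loc 1 \<and> g \<in> Lp_loc 1 \<and>
     (\<forall>\<phi>. test_function \<phi> \<longrightarrow>
        (LINT x|lebesgue. f x * partial j \<phi> x) = - (LINT x|lebesgue. g x * \<phi> x))"

definition has_weak_laplacian ::
    "(real ^ 'n::finite \<Rightarrow> real) \<Rightarrow> (real ^ 'n \<Rightarrow> real) \<Rightarrow> bool" where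
  "has_weak_laplacian f g \<longleftrightarrow> f \<in> Lp_loc 1 \<and> g \<in> Lp_loc 1 \<and>
     (\<forall>\<phi>. test_function \<phi> \<longrightarrow>
        (LINT x|lebesgue. f x * laplacian \<phi> x) = (LINT x|lebesgue. g x * \<phi> x))"

text \<open>\<open>Du x $ i $ j\<close> is the derivative of the \<open>i\<close>-th component in direction \<open>j\<close>. The weak
  Jacobian is a relation: it determines \<open>Du\<close> up to a null set. The norm of the type
  \<open>real ^ 'n ^ 'm\<close> is the Euclidean norm of the matrix entries.\<close>

definition has_weak_jacobian ::
    "(real ^ 'n::finite \<Rightarrow> real ^ 'm::finite) \<Rightarrow> (real ^ 'n \<Rightarrow> real ^ 'n ^ 'm) \<Rightarrow> bool" where
  "has_weak_jacobian u Du \<longleftrightarrow>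
     (\<forall>i j. has_weak_partial j (\<lambda>x. u x $ i) (\<lambda>x. Du x $ i $ j))"

definition W12_loc :: "(real ^ 'n::finite \<Rightarrow> real ^ 'm::finite) set" where
  "W12_loc = {u \<in> Lp_loc 2. \<exists>Du \<in> Lp_loc 2. has_weak_jacobian u Du}"

text \<open>Distributional solutions of \<open>\<Delta>u - W\<^sub>u(u) = 0\<close> on the whole space. For
  \<open>u \<in> Linf_loc\<close> and \<open>W\<close> of class \<open>C\<^sup>1\<close>, the composition of \<open>gradient W\<close> with \<open>u\<close> is
  locally bounded, so the local integrability in \<open>has_weak_laplacian\<close> is automatic.\<close>

definition weak_solution ::
    "(real ^ 'm::finite \<Rightarrow> real) \<Rightarrow> (real ^ 'n::finite \<Rightarrow> real ^ 'm) \<Rightarrow> bool" where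
  "weak_solution W u \<longleftrightarrow>
     (\<forall>i. has_weak_laplacian (\<lambda>x. u x $ i) (\<lambda>x. gradient W (u x) $ i))"

end

theory Submission
  imports Defs
begin

text \<open>
The proof is a Pohozaev argument. Formally, testing the system with \<open>X\<^sub>i \<partial>\<^sub>i u\<close> for a compactly
supported vector field \<open>X\<close> says that the stress-energy tensor
\<open>\<partial>\<^sub>i u \<cdot> \<partial>\<^sub>j u - \<delta>\<^sub>i\<^sub>j (\<bar>\<nabla>u\<bar>\<^sup>2 / 2 + W(u))\<close> is divergence free. No regularity theory is needed to justify
this: the mollifications of \<open>u\<close> satisfy the identity with the mollified right-hand side, all terms
that are quadratic in \<open>\<nabla>u\<close> converge by strong \<open>L\<^sup>2\<close> convergence, and the nonlinear term is handled by
mollifying \<open>u\<close> inside \<open>W\<close>, whose gradient is Lipschitz on bounded sets. Taking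
\<open>X(x) = \<eta>(x / R) x\<close> and letting \<open>R\<close> tend to infinity gives
\<open>(1 - n / 2) \<integral>\<bar>\<nabla>u\<bar>\<^sup>2 = n \<integral>W(u)\<close>, so \<open>W(u) = 0\<close> almost everywhere because \<open>n \<ge> 2\<close> and \<open>W \<ge> 0\<close>.
Then \<open>u\<close> takes values in the minima of \<open>W\<close>, where \<open>W\<^sub>u\<close> vanishes, and is therefore harmonic. The
derivatives of its mollifications are harmonic and in \<open>L\<^sup>2\<close>, hence zero by Caccioppoli's inequality.
This last step also covers \<open>n = 2\<close>, where the Pohozaev identity carries no information on \<open>\<nabla>u\<close>.
\<close>

subsection \<open>Calculus of \<open>C_k\<close> functions\<close>

text \<open>The obstacle is the nonlinear right-hand side: mollifying the system yields the
  mollification of W_u(u), not W_u at the mollified u, so the smooth identity cannot be closed in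
  one go. The work is therefore split. Each component of u solves a scalar equation with a given
  locally square-integrable right-hand side, and its identity passes to the limit with W_u(u) times
  the weak derivative on the right. A separate weak chain rule then recognises the sum of these
  products over the components as the derivative of W(u). The field x generates dilations. After the
  cutoff its Jacobian at scale R is a fixed bounded matrix function evaluated at x / R, so finite
  energy and dominated convergence suffice and no sequence of good radii has to be selected.
  Integration by parts rests only on translation invariance of Lebesgue measure and uniform
  differentiability. In the last step u itself need not be square integrable over the whole space,
  which is why the Liouville theorem is applied to derivatives.\<close>

lemma partial_eqI:
  assumes "(f has_derivative f') (at x)"
  shows "partial j f x = f' (axis j 1)"
  unfolding partial_def using frechet_derivative_at[OF assms] by simp

lemma has_derivative_partial:
  fixes f :: "real ^ 'n::finite \<Rightarrow> real"
  assumes "f differentiable (at x)"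
  shows "(f has_derivative (\<lambda>h. \<Sum>j\<in>UNIV. h $ j * partial j f x)) (at x)"
proof -
  have d: "(f has_derivative frechet_derivative f (at x)) (at x)"
    using assms by (simp add: frechet_derivative_works[symmetric])
  interpret bounded_linear "frechet_derivative f (at x)"
    using d by (rule has_derivative_bounded_linear)
  have "frechet_derivative f (at x) h = (\<Sum>j\<in>UNIV. h $ j * partial j f x)" for h
  proof -
    have "h = (\<Sum>j\<in>UNIV. h $ j *\<^sub>R axis j 1)"
      using basis_expansion[of h] by (simp add: scalar_mult_eq_scaleR)
    then have "frechet_derivative f (at x) h = frechet_derivative f (at x) (\<Sum>j\<in>UNIV. h $ j *\<^sub>R axis j 1)"
      by simp
    also have "\<dots> = (\<Sum>j\<in>UNIV. h $ j * partial j f x)"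
      by (simp only: sum scaleR partial_def real_scaleR_def)
    finally show ?thesis .
  qed
  then have "frechet_derivative f (at x) = (\<lambda>h. \<Sum>j\<in>UNIV. h $ j * partial j f x)" ..
  with d show ?thesis by simp
qed

lemma has_real_derivative_along_axis:
  fixes f :: "real ^ 'n::finite \<Rightarrow> real"
  assumes "f differentiable (at (y + s *\<^sub>R axis i 1))"
  shows "((\<lambda>s. f (y + s *\<^sub>R axis i 1)) has_real_derivative partial i f (y + s *\<^sub>R axis i 1)) (at s)"
proof -
  have "((\<lambda>s. f (y + s *\<^sub>R axis i 1)) has_derivative
      (\<lambda>h. \<Sum>j\<in>UNIV. (h *\<^sub>R axis i 1) $ j * partial j f (y + s *\<^sub>R axis i 1))) (at s)"
    by (rule has_derivative_compose[where f = "\<lambda>s. y + s *\<^sub>R axis i 1", OF _ has_derivative_partial[OF assms]])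
       (auto intro!: derivative_eq_intros)
  moreover have "(\<lambda>h. \<Sum>j\<in>UNIV. (h *\<^sub>R axis i 1) $ j * partial j f (y + s *\<^sub>R axis i 1))
      = (\<lambda>h. h * partial i f (y + s *\<^sub>R axis i 1))"
  proof
    fix h :: real
    have "(\<Sum>j\<in>UNIV. (h *\<^sub>R axis i 1) $ j * partial j f (y + s *\<^sub>R axis i 1))
       = (\<Sum>j\<in>UNIV. if j = i then h * partial i f (y + s *\<^sub>R axis i 1) else 0)"
      by (intro sum.cong) (auto simp: axis_def)
    also have "\<dots> = h * partial i f (y + s *\<^sub>R axis i 1)" by simp
    finally show "(\<Sum>j\<in>UNIV. (h *\<^sub>R axis i 1) $ j * partial j f (y + s *\<^sub>R axis i 1))
      = h * partial i f (y + s *\<^sub>R axis i 1)" .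
  qed
  ultimately show ?thesis
    by (simp add: has_field_derivative_def mult_commute_abs)
qed

lemma C_k_Suc_imp: "C_k (Suc k) f \<Longrightarrow> C_k k f"
proof (induction k arbitrary: f)
  case 0
  then have "\<forall>x. f differentiable (at x)" by simp
  then show ?case
    by (simp add: continuous_at_imp_continuous_on differentiable_imp_continuous_within)
next
  case (Suc k)
  then show ?case by (metis C_k.simps(2))
qed

lemma C_k_mono: "C_k m f \<Longrightarrow> k \<le> m \<Longrightarrow> C_k k f"
  by (induction m) (auto simp: le_Suc_eq simp del: C_k.simps intro: C_k_Suc_imp)

lemma C_k_imp_continuous: "C_k k f \<Longrightarrow> continuous_on UNIV f"
  using C_k_mono[of k f 0] by simp

lemma partial_const [simp]: "partial j (\<lambda>x. c) = (\<lambda>x. 0)"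
  by (rule ext, subst partial_eqI[OF has_derivative_const]) simp

lemma partial_component: "partial j (\<lambda>x. x $ i) = (\<lambda>x. if i = j then 1 else 0)"
proof
  fix x :: "real ^ 'a"
  have "((\<lambda>x. x $ i) has_derivative (\<lambda>x. x $ i)) (at x)"
    by (rule bounded_linear_imp_has_derivative[OF bounded_linear_vec_nth])
  then show "partial j (\<lambda>x. x $ i) x = (if i = j then 1 else 0)"
    by (simp add: partial_eqI axis_def)
qed

lemma C_k_const [simp]: "C_k k (\<lambda>x. c)"
  by (induction k arbitrary: c) auto

lemma C_k_component [simp]: "C_k k (\<lambda>x. x $ i)"
  by (cases k) (auto simp: partial_component intro: continuous_intros
      bounded_linear_imp_differentiable[OF bounded_linear_vec_nth])

lemma partial_add:
  fixes f g :: "real ^ 'n::finite \<Rightarrow> real"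
  assumes "\<forall>x. f differentiable (at x)" "\<forall>x. g differentiable (at x)"
  shows "partial j (\<lambda>x. f x + g x) = (\<lambda>x. partial j f x + partial j g x)"
proof
  fix x
  from assms have "f differentiable (at x)" "g differentiable (at x)" by auto
  from has_derivative_add[OF this[unfolded frechet_derivative_works]]
  show "partial j (\<lambda>x. f x + g x) x = partial j f x + partial j g x"
    by (subst partial_eqI) (assumption, simp add: partial_def)
qed

lemma partial_mult:
  fixes f g :: "real ^ 'n::finite \<Rightarrow> real"
  assumes "\<forall>x. f differentiable (at x)" "\<forall>x. g differentiable (at x)"
  shows "partial j (\<lambda>x. f x * g x) = (\<lambda>x. partial j f x * g x + f x * partial j g x)"
proof
  fix x
  from assms have "f differentiable (at x)" "g differentiable (at x)" by auto
  from has_derivative_mult[OF this[unfolded frechet_derivative_works]]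
  show "partial j (\<lambda>x. f x * g x) x = partial j f x * g x + f x * partial j g x"
    by (subst partial_eqI) (assumption, simp add: partial_def)
qed

lemma C_k_add: "C_k k f \<Longrightarrow> C_k k g \<Longrightarrow> C_k k (\<lambda>x. f x + g x)"
proof (induction k arbitrary: f g)
  case 0
  then show ?case by (auto intro: continuous_intros)
next
  case (Suc k)
  then show ?case by (auto simp: partial_add)
qed

lemma C_k_mult: "C_k k f \<Longrightarrow> C_k k g \<Longrightarrow> C_k k (\<lambda>x. f x * g x)"
proof (induction k arbitrary: f g)
  case 0
  then show ?case by (auto intro: continuous_intros)
next
  case (Suc k)
  then have "C_k k f" "C_k k g" by (auto intro: C_k_Suc_imp simp del: C_k.simps)
  with Suc show ?case by (auto simp: partial_mult intro!: C_k_add differentiable_mult)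
qed

lemma C_k_cmult: "C_k k f \<Longrightarrow> C_k k (\<lambda>x. c * f x)"
  using C_k_mult[OF C_k_const] .

lemma C_k_uminus: "C_k k f \<Longrightarrow> C_k k (\<lambda>x. - f x)"
  using C_k_cmult[of k f "-1"] by simp

lemma C_k_diff: "C_k k f \<Longrightarrow> C_k k g \<Longrightarrow> C_k k (\<lambda>x. f x - g x)"
  using C_k_add[of k f "\<lambda>x. - g x"] C_k_uminus[of k g] by simp

lemma C_k_sum: "(\<And>i. i \<in> I \<Longrightarrow> C_k k (f i)) \<Longrightarrow> C_k k (\<lambda>x. \<Sum>i\<in>I. f i x)"
  by (induction I rule: infinite_finite_induct) (auto simp del: C_k.simps intro!: C_k_add)

lemma C_1_differentiable: "C_k 1 f \<Longrightarrow> \<forall>x. f differentiable (at x)"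
  by simp

lemma partial_cmult:
  "\<forall>x. f differentiable (at x) \<Longrightarrow> partial j (\<lambda>x. c * f x) = (\<lambda>x. c * partial j f x)"
  by (subst partial_mult) auto

lemma partial_uminus:
  "\<forall>x. f differentiable (at x) \<Longrightarrow> partial j (\<lambda>x. - f x) = (\<lambda>x. - partial j f x)"
  using partial_cmult[of f j "-1"] by simp

lemma partial_diff:
  assumes "\<forall>x. f differentiable (at x)" "\<forall>x. g differentiable (at x)"
  shows "partial j (\<lambda>x. f x - g x) = (\<lambda>x. partial j f x - partial j g x)"
  using partial_add[of f "\<lambda>x. - g x" j] assms by (simp add: partial_uminus)

lemma partial_sum:
  assumes "\<And>i. i \<in> I \<Longrightarrow> C_k 1 (f i)"
  shows "partial j (\<lambda>x. \<Sum>i\<in>I. f i x) = (\<lambda>x. \<Sum>i\<in>I. partial j (f i) x)"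
  using assms
proof (induction I rule: infinite_finite_induct)
  case (insert i I)
  then have "C_k 1 (\<lambda>x. \<Sum>i\<in>I. f i x)" by (auto simp del: C_k.simps One_nat_def intro!: C_k_sum)
  with insert show ?case by (simp add: partial_add)
qed auto

text \<open>One rule for two uses: c = -1 gives the reflections inside convolutions, and c = 1 / (m
  + 1) gives the dilated cutoffs and vector fields.\<close>

lemma partial_affine:
  fixes f :: "real ^ 'n::finite \<Rightarrow> real"
  assumes "\<forall>x. f differentiable (at x)"
  shows "partial j (\<lambda>x. f (c *\<^sub>R x + a)) = (\<lambda>x. c * partial j f (c *\<^sub>R x + a))"
    and "\<forall>x. (\<lambda>x. f (c *\<^sub>R x + a)) differentiable (at x)"
proof -
  have d: "((\<lambda>x. f (c *\<^sub>R x + a)) has_derivative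
      (\<lambda>h. \<Sum>j\<in>UNIV. (c *\<^sub>R h) $ j * partial j f (c *\<^sub>R x + a))) (at x)" for x
    by (rule has_derivative_compose[where f = "\<lambda>x. c *\<^sub>R x + a", OF _ has_derivative_partial[OF assms[rule_format]]])
       (auto intro!: derivative_eq_intros)
  show "partial j (\<lambda>x. f (c *\<^sub>R x + a)) = (\<lambda>x. c * partial j f (c *\<^sub>R x + a))"
  proof
    fix x
    have "partial j (\<lambda>x. f (c *\<^sub>R x + a)) x
       = (\<Sum>i\<in>UNIV. if i = j then c * partial j f (c *\<^sub>R x + a) else 0)"
      by (subst partial_eqI[OF d], intro sum.cong) (auto simp: axis_def)
    then show "partial j (\<lambda>x. f (c *\<^sub>R x + a)) x = c * partial j f (c *\<^sub>R x + a)" by simp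
  qed
  show "\<forall>x. (\<lambda>x. f (c *\<^sub>R x + a)) differentiable (at x)"
    using d unfolding differentiable_def by blast
qed

lemma C_k_affine: "C_k k f \<Longrightarrow> C_k k (\<lambda>x. f (c *\<^sub>R x + a))"
proof (induction k arbitrary: f)
  case 0
  then show ?case by (auto intro!: continuous_intros continuous_on_compose2[of UNIV f])
next
  case (Suc k)
  then show ?case
    by (auto simp: partial_affine intro!: C_k_cmult)
qed

text \<open>Mean value theorem twice: first along axis i, applied to the increment of
  \<open>f\<close> across the step in direction j, then along axis j, applied to
  \<open>partial i f\<close>. The second difference itself is symmetric in i and j, so exchanging
  the indices compares the two mixed derivatives.\<close>

lemma second_difference:
  fixes f :: "real ^ 'n::finite \<Rightarrow> real"
  assumes f: "C_k 2 f" and t: "0 < t"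
  shows "\<exists>p. dist p x \<le> 2 * t \<and>
     f (x + t *\<^sub>R axis i 1 + t *\<^sub>R axis j 1) - f (x + t *\<^sub>R axis i 1) - f (x + t *\<^sub>R axis j 1) + f x
       = t * (t * partial j (partial i f) p)"
proof -
  have df: "\<And>x. f differentiable (at x)" "\<And>x. partial i f differentiable (at x)"
    using f by (auto simp: numeral_2_eq_2)
  let ?a = "axis i 1 :: real ^ 'n" and ?b = "axis j 1 :: real ^ 'n"
  define g where "g s = f ((x + t *\<^sub>R ?b) + s *\<^sub>R ?a) - f (x + s *\<^sub>R ?a)" for s
  have "\<exists>s>0. s < t \<and> g t - g 0 = (t - 0) * (partial i f ((x + t *\<^sub>R ?b) + s *\<^sub>R ?a) - partial i f (x + s *\<^sub>R ?a))"
    unfolding g_def using t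
    by (intro MVT2) (auto intro!: derivative_eq_intros has_real_derivative_along_axis df)
  then obtain s where s: "0 < s" "s < t"
    "g t - g 0 = t * (partial i f ((x + t *\<^sub>R ?b) + s *\<^sub>R ?a) - partial i f (x + s *\<^sub>R ?a))" by auto
  have "\<exists>r>0. r < t \<and> partial i f ((x + s *\<^sub>R ?a) + t *\<^sub>R ?b) - partial i f ((x + s *\<^sub>R ?a) + 0 *\<^sub>R ?b)
      = (t - 0) * partial j (partial i f) ((x + s *\<^sub>R ?a) + r *\<^sub>R ?b)"
    using t by (intro MVT2) (auto intro!: derivative_eq_intros has_real_derivative_along_axis df)
  then obtain r where r: "0 < r" "r < t" "partial i f ((x + s *\<^sub>R ?a) + t *\<^sub>R ?b) - partial i f (x + s *\<^sub>R ?a)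
      = t * partial j (partial i f) ((x + s *\<^sub>R ?a) + r *\<^sub>R ?b)" by auto
  have "dist ((x + s *\<^sub>R ?a) + r *\<^sub>R ?b) x \<le> norm (s *\<^sub>R ?a) + norm (r *\<^sub>R ?b)"
    using norm_triangle_ineq[of "s *\<^sub>R ?a" "r *\<^sub>R ?b"] by (simp add: dist_norm algebra_simps)
  also have "\<dots> \<le> 2 * t" using s r by simp
  finally show ?thesis
    using s(3) r(3) unfolding g_def by (intro exI[of _ "(x + s *\<^sub>R ?a) + r *\<^sub>R ?b"]) (simp add: ac_simps)
qed

text \<open>Second differences with step 1 / (n + 1), read in both orders, give points near
  \<open>x\<close> at which the two mixed derivatives agree; continuity carries the equality to
  \<open>x\<close>.\<close>

lemma partial_commute:
  fixes f :: "real ^ 'n::finite \<Rightarrow> real"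
  assumes f: "C_k 2 f"
  shows "partial i (partial j f) x = partial j (partial i f) x"
proof -
  have "\<exists>p q. dist p x \<le> 2 * inverse (Suc n) \<and> dist q x \<le> 2 * inverse (Suc n) \<and>
     partial i (partial j f) p = partial j (partial i f) q" for n :: nat
  proof -
    define t :: real where "t = inverse (Suc n)"
    have t: "t > 0" by (simp add: t_def)
    from second_difference[OF f t, of x i j] second_difference[OF f t, of x j i] t
    show ?thesis unfolding t_def[symmetric] by (fastforce simp: algebra_simps)
  qed
  then obtain p q where pq: "\<And>n. dist (p n) x \<le> 2 * inverse (Suc n)" "\<And>n. dist (q n) x \<le> 2 * inverse (Suc n)"
     "\<And>n. partial i (partial j f) (p n) = partial j (partial i f) (q n)" by metis
  have z: "(\<lambda>n. 2 * inverse (real (Suc n))) \<longlonglongrightarrow> 0"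
    using tendsto_mult[OF tendsto_const[of 2] LIMSEQ_inverse_real_of_nat] by simp
  have p: "p \<longlonglongrightarrow> x" using pq(1)
    by (subst tendsto_dist_iff) (rule tendsto_sandwich[OF _ _ tendsto_const z], auto)
  have q: "q \<longlonglongrightarrow> x" using pq(2)
    by (subst tendsto_dist_iff) (rule tendsto_sandwich[OF _ _ tendsto_const z], auto)
  have "continuous_on UNIV (partial i (partial j f))" "continuous_on UNIV (partial j (partial i f))"
    using f by (auto simp: numeral_2_eq_2)
  then have "(\<lambda>n. partial i (partial j f) (p n)) \<longlonglongrightarrow> partial i (partial j f) x"
    "(\<lambda>n. partial j (partial i f) (q n)) \<longlonglongrightarrow> partial j (partial i f) x"
    using p q by (auto simp: continuous_on_eq_continuous_at isCont_tendsto_compose)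
  then show ?thesis using pq(3) LIMSEQ_unique by auto
qed

subsection \<open>Test functions\<close>

definition smooth :: "(real ^ 'n::finite \<Rightarrow> real) \<Rightarrow> bool" where
  "smooth f \<longleftrightarrow> (\<forall>k. C_k k f)"

lemma smooth_C_k: "smooth f \<Longrightarrow> C_k k f"
  by (simp add: smooth_def)

lemma smooth_differentiable: "smooth f \<Longrightarrow> \<forall>x. f differentiable (at x)"
  using smooth_C_k[of f 1] by simp

lemma smooth_continuous: "smooth f \<Longrightarrow> continuous_on UNIV f"
  using smooth_C_k[of f 0] by simp

lemma smooth_partial: "smooth f \<Longrightarrow> smooth (partial j f)"
  unfolding smooth_def by (metis C_k.simps(2))

lemma smooth_intros:
  "smooth (\<lambda>x. c)" "smooth (\<lambda>x. x $ i)"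
  "smooth f \<Longrightarrow> smooth g \<Longrightarrow> smooth (\<lambda>x. f x + g x)"
  "smooth f \<Longrightarrow> smooth g \<Longrightarrow> smooth (\<lambda>x. f x - g x)"
  "smooth f \<Longrightarrow> smooth g \<Longrightarrow> smooth (\<lambda>x. f x * g x)"
  "(\<And>i. i \<in> I \<Longrightarrow> smooth (h i)) \<Longrightarrow> smooth (\<lambda>x. \<Sum>i\<in>I. h i x)"
  "smooth f \<Longrightarrow> smooth (\<lambda>x. f (a *\<^sub>R x + b))"
  by (auto simp: smooth_def intro: C_k_add C_k_diff C_k_mult C_k_sum C_k_affine)

text \<open>In finite dimension this is the same as compactness of the closed support
  (\<open>test_function_iff\<close>), but it passes through products, sums and affine substitutions
  by elementary estimates with radii.\<close>

definition bounded_support :: "('a::real_normed_vector \<Rightarrow> real) \<Rightarrow> bool" where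
  "bounded_support f \<longleftrightarrow> (\<exists>R. \<forall>x. R < norm x \<longrightarrow> f x = 0)"

lemma test_function_iff: "test_function \<phi> \<longleftrightarrow> smooth \<phi> \<and> bounded_support \<phi>"
proof -
  have "compact (closure {x. \<phi> x \<noteq> 0}) \<longleftrightarrow> bounded_support \<phi>"
    unfolding compact_closure bounded_iff bounded_support_def by (auto simp: not_le[symmetric])
  then show ?thesis by (simp add: test_function_def smooth_def)
qed

lemma partial_eq_0:
  fixes f :: "real ^ 'n::finite \<Rightarrow> real"
  assumes "open S" "x \<in> S" "\<And>y. y \<in> S \<Longrightarrow> f y = 0"
  shows "partial j f x = 0"
proof -
  have "(f has_derivative (\<lambda>h. 0)) (at x)"
    by (rule has_derivative_transform_within_open[OF has_derivative_const[of 0] assms(1,2)]) (simp add: assms(3))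
  then show ?thesis by (simp add: partial_eqI)
qed

lemma partial_zero_outside:
  fixes f :: "real ^ 'n::finite \<Rightarrow> real"
  assumes "\<And>x. R < norm x \<Longrightarrow> f x = 0" "R < norm x"
  shows "partial j f x = 0"
  by (rule partial_eq_0[of "{x. R < norm x}"]) (auto simp: assms open_Collect_less continuous_intros)

lemma bounded_support_partial: "bounded_support f \<Longrightarrow> bounded_support (partial j f)"
  unfolding bounded_support_def by (metis partial_zero_outside)

lemma bounded_support_mult1: "bounded_support f \<Longrightarrow> bounded_support (\<lambda>x. f x * g x)"
  and bounded_support_mult2: "bounded_support f \<Longrightarrow> bounded_support (\<lambda>x. g x * f x)"
  by (auto simp: bounded_support_def)

lemma bounded_support_add:
  assumes "bounded_support f" "bounded_support g" shows "bounded_support (\<lambda>x. f x + g x)"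
proof -
  obtain R S where "\<forall>x. R < norm x \<longrightarrow> f x = 0" "\<forall>x. S < norm x \<longrightarrow> g x = 0"
    using assms unfolding bounded_support_def by auto
  then show ?thesis unfolding bounded_support_def by (intro exI[of _ "max R S"]) auto
qed

lemma bounded_support_zero: "bounded_support (\<lambda>x. 0)"
  by (simp add: bounded_support_def)

lemma bounded_support_sum:
  "(\<And>i. i \<in> I \<Longrightarrow> bounded_support (h i)) \<Longrightarrow> bounded_support (\<lambda>x. \<Sum>i\<in>I. h i x)"
  by (induction I rule: infinite_finite_induct) (auto intro: bounded_support_add bounded_support_zero)

lemma bounded_support_affine:
  assumes "bounded_support f" "a \<noteq> 0" shows "bounded_support (\<lambda>x. f (a *\<^sub>R x + b))"
proof -
  obtain R where R: "\<forall>x. R < norm x \<longrightarrow> f x = 0" using assms unfolding bounded_support_def by auto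
  have "f (a *\<^sub>R x + b) = 0" if "(R + norm b) / \<bar>a\<bar> < norm x" for x
  proof -
    have "R + norm b < \<bar>a\<bar> * norm x" using that assms(2) by (simp add: field_simps)
    also have "\<dots> = norm ((a *\<^sub>R x + b) - b)" by simp
    also have "\<dots> \<le> norm (a *\<^sub>R x + b) + norm b" by (rule norm_triangle_ineq4)
    finally show ?thesis using R by simp
  qed
  then show ?thesis unfolding bounded_support_def by blast
qed

lemma test_function_partial: "test_function \<phi> \<Longrightarrow> test_function (partial j \<phi>)"
  by (simp add: test_function_iff smooth_partial bounded_support_partial)

lemma test_function_affine: "test_function \<phi> \<Longrightarrow> a \<noteq> 0 \<Longrightarrow> test_function (\<lambda>x. \<phi> (a *\<^sub>R x + b))"
  by (simp add: test_function_iff smooth_intros bounded_support_affine)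

lemma test_function_mult1: "test_function \<phi> \<Longrightarrow> smooth f \<Longrightarrow> test_function (\<lambda>x. \<phi> x * f x)"
  and test_function_mult2: "test_function \<phi> \<Longrightarrow> smooth f \<Longrightarrow> test_function (\<lambda>x. f x * \<phi> x)"
  by (simp_all add: test_function_iff smooth_intros bounded_support_mult1 bounded_support_mult2)

lemma test_function_smooth: "test_function \<phi> \<Longrightarrow> smooth \<phi>"
  by (simp add: test_function_iff)

lemma test_function_sum:
  "(\<And>i. i \<in> I \<Longrightarrow> test_function (h i)) \<Longrightarrow> test_function (\<lambda>x. \<Sum>i\<in>I. h i x)"
  by (simp add: test_function_iff smooth_intros bounded_support_sum)

text \<open>Schwarz's theorem is used twice, to move j outward past each of the two derivatives in
  direction i. It makes derivatives of harmonic functions harmonic.\<close>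

lemma laplacian_commute:
  fixes \<phi> :: "real ^ 'n::finite \<Rightarrow> real"
  assumes "smooth \<phi>"
  shows "laplacian (partial j \<phi>) = partial j (laplacian \<phi>)"
proof -
  have e: "partial i (partial j \<phi>) = partial j (partial i \<phi>)" for i
    by (intro ext partial_commute smooth_C_k assms)
  have "partial i (partial i (partial j \<phi>)) = partial j (partial i (partial i \<phi>))" for i
    unfolding e by (intro ext partial_commute smooth_C_k assms smooth_partial)
  then have "laplacian (partial j \<phi>) = (\<lambda>x. \<Sum>i\<in>UNIV. partial j (partial i (partial i \<phi>)) x)"
    by (simp add: laplacian_def fun_eq_iff)
  also have "\<dots> = partial j (\<lambda>x. \<Sum>i\<in>UNIV. partial i (partial i \<phi>) x)"
    by (subst partial_sum) (auto intro!: smooth_C_k smooth_partial assms simp del: C_k.simps One_nat_def)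
  also have "(\<lambda>x. \<Sum>i\<in>UNIV. partial i (partial i \<phi>) x) = laplacian \<phi>"
    by (simp add: laplacian_def fun_eq_iff)
  finally show ?thesis .
qed

subsection \<open>A bump function\<close>

text \<open>The polynomial factor makes this family closed under differentiation.\<close>

definition flat :: "real poly \<Rightarrow> real \<Rightarrow> real" where
  "flat p t = (if 0 < t then poly p (1 / t) * exp (- (1 / t)) else 0)"

lemma poly_exp_decay: "((\<lambda>s. poly p s * exp (- s)) \<longlongrightarrow> 0) (at_top :: real filter)"
proof -
  have "((\<lambda>s. \<Sum>i\<le>degree p. coeff p i * (s ^ i / exp s)) \<longlongrightarrow> (\<Sum>i\<le>degree p. coeff p i * 0)) (at_top :: real filter)"
    by (intro tendsto_intros tendsto_power_div_exp_0)
  then show ?thesis by (simp add: poly_altdef exp_minus sum_distrib_right divide_inverse mult.assoc)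
qed

text \<open>With s = 1 / t, differentiating p(s) exp(-s) in t gives s^2 (p(s) - p'(s)) exp(-s),
  whence the new polynomial. At t = 0 the one-sided difference quotients are treated separately; the
  right one tends to 0 because the exponential beats every polynomial.\<close>

lemma flat_has_derivative:
  "(flat p has_real_derivative flat (monom 1 2 * (p - pderiv p)) t) (at t)"
proof -
  consider "t < 0" | "t > 0" | "t = 0" by linarith
  then show ?thesis
  proof cases
    case 1
    have "((\<lambda>t. 0) has_real_derivative 0) (at t)" by simp
    then have "(flat p has_real_derivative 0) (at t)"
      by (rule has_field_derivative_transform_within_open[of _ _ _ "{..<0}"]) (use 1 in \<open>auto simp: flat_def\<close>)
    with 1 show ?thesis by (simp add: flat_def)
  next
    case 2
    have "((\<lambda>t. poly p (1 / t) * exp (- (1 / t))) has_real_derivative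
       poly (monom 1 2 * (p - pderiv p)) (1 / t) * exp (- (1 / t))) (at t)"
      using 2 by (auto intro!: derivative_eq_intros DERIV_chain'[OF _ poly_DERIV]
          simp: field_simps power2_eq_square poly_monom)
    then have "(flat p has_real_derivative poly (monom 1 2 * (p - pderiv p)) (1 / t) * exp (- (1 / t))) (at t)"
      by (rule has_field_derivative_transform_within_open[of _ _ _ "{0<..}"]) (use 2 in \<open>auto simp: flat_def\<close>)
    with 2 show ?thesis by (simp add: flat_def)
  next
    case 3
    have "((\<lambda>h. flat p h / h) \<longlongrightarrow> 0) (at_left 0)"
      by (rule tendsto_eventually) (auto simp: eventually_at_filter flat_def)
    moreover have "((\<lambda>h. flat p h / h) \<longlongrightarrow> 0) (at_right 0)"
    proof -
      \<comment> \<open>Dividing by h is multiplication by s = 1 / h, which \<open>pCons 0 p\<close>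
        absorbs into the polynomial.\<close>
      have "((\<lambda>h. poly (pCons 0 p) (inverse h) * exp (- (inverse h))) \<longlongrightarrow> 0) (at_right (0::real))"
        by (rule filterlim_compose[OF poly_exp_decay filterlim_inverse_at_top_right])
      then show ?thesis
        by (rule Lim_transform_eventually)
           (auto simp: eventually_at_filter flat_def divide_inverse)
    qed
    ultimately have "((\<lambda>h. flat p h / h) \<longlongrightarrow> 0) (at 0)"
      by (simp add: filterlim_split_at)
    then show ?thesis using 3
      by (simp add: DERIV_def flat_def)
  qed
qed

text \<open>The induction generalises over \<open>p\<close>, since each derivative changes the
  polynomial and contributes a factor -2 x_j. The squared norm keeps the inner function polynomial,
  hence smooth at the origin too.\<close>

lemma smooth_flat_ball:
  fixes r :: real
  shows "smooth (\<lambda>x :: real ^ 'n::finite. flat p (r - (norm x)\<^sup>2))"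
proof -
  have "C_k k (\<lambda>x :: real ^ 'n. flat p (r - (norm x)\<^sup>2))" for k
  proof (induction k arbitrary: p)
    case 0
    have "continuous_on UNIV (flat p)"
      by (meson DERIV_isCont continuous_at_imp_continuous_on flat_has_derivative)
    then show ?case by (auto intro!: continuous_intros continuous_on_compose2[of UNIV "flat p"])
  next
    case (Suc k)
    let ?q = "monom 1 2 * (p - pderiv p)"
    have d: "((\<lambda>x :: real ^ 'n. flat p (r - (norm x)\<^sup>2)) has_derivative
        (\<lambda>h. - (2 * (x \<bullet> h)) * flat ?q (r - (norm x)\<^sup>2))) (at x)" for x
      unfolding power2_norm_eq_inner
      by (rule has_derivative_compose[OF _ flat_has_derivative[unfolded has_field_derivative_def],
            THEN has_derivative_eq_rhs])
         (auto intro!: derivative_eq_intros simp: inner_commute fun_eq_iff)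
    have "partial j (\<lambda>x :: real ^ 'n. flat p (r - (norm x)\<^sup>2)) = (\<lambda>x. - 2 * x $ j * flat ?q (r - (norm x)\<^sup>2))" for j
      by (rule ext, subst partial_eqI[OF d]) (simp add: inner_axis)
    moreover have "C_k k (\<lambda>x :: real ^ 'n. - 2 * x $ j * flat ?q (r - (norm x)\<^sup>2))" for j
      by (intro C_k_mult C_k_const C_k_component Suc)
    ultimately show ?case using d by (auto simp: differentiable_def)
  qed
  then show ?thesis by (simp add: smooth_def)
qed

text \<open>The standard bump exp(1 - 1 / (1 - |x|^2)) on the unit ball. The factor
  \<open>exp 1\<close> gives it the value 1 at the origin, so that x times the bump has the identity
  as its Jacobian there.\<close>

definition bump :: "real ^ 'n::finite \<Rightarrow> real" where
  "bump x = exp 1 * flat 1 (1 - (norm x)\<^sup>2)"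

lemma bump_0: "bump 0 = 1"
  by (simp add: bump_def flat_def exp_minus)

lemma bump_nonneg: "0 \<le> bump x"
  by (simp add: bump_def flat_def)

lemma bump_pos_iff: "0 < bump x \<longleftrightarrow> norm x < 1"
proof -
  have "(norm x)\<^sup>2 < 1 \<longleftrightarrow> norm x < 1"
    using abs_square_less_1[of "norm x"] by simp
  then show ?thesis by (auto simp: bump_def flat_def)
qed

lemma bump_eq_0: "1 \<le> norm x \<Longrightarrow> bump x = 0"
  using bump_pos_iff[of x] bump_nonneg[of x] by linarith

lemma test_function_bump: "test_function bump"
proof -
  have "smooth bump" unfolding bump_def
    by (intro smooth_intros smooth_flat_ball)
  moreover have "bounded_support bump"
    unfolding bounded_support_def by (intro exI[of _ 1]) (auto simp: bump_eq_0)
  ultimately show ?thesis by (simp add: test_function_iff)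
qed

subsection \<open>Integration against functions of bounded support\<close>

lemma continuous_bounded_support_bounded:
  fixes k :: "'a::euclidean_space \<Rightarrow> real"
  assumes "continuous_on UNIV k" "bounded_support k"
  obtains C where "0 < C" "\<And>x. \<bar>k x\<bar> \<le> C"
proof -
  obtain R where R: "\<And>x. R < norm x \<Longrightarrow> k x = 0" using assms(2) unfolding bounded_support_def by auto
  have "compact (k ` cball 0 R)"
    by (intro compact_continuous_image continuous_on_subset[OF assms(1)]) auto
  then have "bounded (k ` cball 0 R)" by (rule compact_imp_bounded)
  then obtain B where B: "0 < B" "\<And>x. x \<in> cball 0 R \<Longrightarrow> \<bar>k x\<bar> \<le> B" unfolding bounded_pos by auto
  have "\<bar>k x\<bar> \<le> B" for x using R[of x] B by (cases "norm x \<le> R") auto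
  with B(1) show ?thesis using that by blast
qed

lemma continuous_bounded_support_uniformly_continuous:
  fixes k :: "'a::euclidean_space \<Rightarrow> real"
  assumes "continuous_on UNIV k" "bounded_support k" "0 < e"
  obtains d where "0 < d" "\<And>x y. dist x y < d \<Longrightarrow> \<bar>k x - k y\<bar> < e"
proof -
  obtain R where R: "\<And>x. R < norm x \<Longrightarrow> k x = 0" using assms(2) unfolding bounded_support_def by auto
  have "uniformly_continuous_on (cball 0 (R + 1)) k"
    by (intro compact_uniformly_continuous continuous_on_subset[OF assms(1)]) auto
  then obtain d where d: "0 < d"
    "\<And>x y. x \<in> cball 0 (R + 1) \<Longrightarrow> y \<in> cball 0 (R + 1) \<Longrightarrow> dist x y < d \<Longrightarrow> dist (k x) (k y) < e"
    unfolding uniformly_continuous_on_def using assms(3) by (metis dist_commute)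
  show ?thesis
  proof (rule that[of "min d 1"])
    fix x y :: 'a assume xy: "dist x y < min d 1"
    have "\<bar>norm x - norm y\<bar> < 1"
      using norm_triangle_ineq3[of x y] xy by (simp add: dist_norm)
    \<comment> \<open>Points less than 1 apart either both lie in the ball of radius R + 1, where
      compactness applies, or both lie outside the ball of radius R, where \<open>k\<close>
      vanishes.\<close>
    then consider "x \<in> cball 0 (R + 1)" "y \<in> cball 0 (R + 1)" | "R < norm x" "R < norm y" by fastforce
    then show "\<bar>k x - k y\<bar> < e"
    proof cases
      case 1
      then show ?thesis using d(2)[OF 1] xy by (simp add: dist_real_def)
    next
      case 2
      then show ?thesis using R assms(3) by simp
    qed
  qed (use d in auto)
qed

text \<open>Borel rather than Lebesgue measurability: translations, reflections and product measures
  can then be used directly with \<open>lborel\<close>. The transfer from the Lebesgue setting is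
  made once, at the end.\<close>

definition locally_integrable :: "('a::euclidean_space \<Rightarrow> real) \<Rightarrow> bool" where
  "locally_integrable f \<longleftrightarrow> f \<in> borel_measurable borel \<and>
     (\<forall>R. integrable lborel (\<lambda>x. indicator (cball 0 R) x * f x))"

lemma locally_integrable_measurable: "locally_integrable f \<Longrightarrow> f \<in> borel_measurable borel"
  by (simp add: locally_integrable_def)

lemma integrable_indicator_cball: "integrable lborel (indicator (cball a R) :: 'a::euclidean_space \<Rightarrow> real)"
  using emeasure_bounded_finite[OF bounded_cball, of a R] by (intro integrable_real_indicator) auto

lemma locally_integrable_const: "locally_integrable (\<lambda>x. c)"
  unfolding locally_integrable_def using integrable_indicator_cball by auto

lemma integrable_locally_integrable_mult:
  assumes f: "locally_integrable f" and k: "continuous_on UNIV k" "bounded_support k"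
  shows "integrable lborel (\<lambda>x. f x * k x)"
proof -
  obtain R where R: "\<And>x. R < norm x \<Longrightarrow> k x = 0" using k(2) unfolding bounded_support_def by auto
  obtain C where C: "0 < C" "\<And>x. \<bar>k x\<bar> \<le> C" using continuous_bounded_support_bounded[OF k] by blast
  have [measurable]: "f \<in> borel_measurable borel" "k \<in> borel_measurable borel"
    using f k by (auto simp: locally_integrable_def borel_measurable_continuous_onI)
  show ?thesis
  proof (rule Bochner_Integration.integrable_bound)
    show "integrable lborel (\<lambda>x. C * (indicator (cball 0 R) x * f x))"
      using f unfolding locally_integrable_def by auto
    show "AE x in lborel. norm (f x * k x) \<le> norm (C * (indicator (cball 0 R) x * f x))"
    proof (rule AE_I2)
      fix x
      show "norm (f x * k x) \<le> norm (C * (indicator (cball 0 R) x * f x))"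
      proof (cases "norm x \<le> R")
        case True
        have "\<bar>f x\<bar> * \<bar>k x\<bar> \<le> \<bar>f x\<bar> * C" by (intro mult_left_mono C) simp
        then show ?thesis using True C(1) by (simp add: abs_mult ac_simps)
      next
        case False
        then show ?thesis using R by simp
      qed
    qed
  qed simp
qed

lemma integrable_continuous_bounded_support:
  fixes k :: "'a::euclidean_space \<Rightarrow> real"
  assumes "continuous_on UNIV k" "bounded_support k"
  shows "integrable lborel k"
  using integrable_locally_integrable_mult[OF locally_integrable_const[of 1] assms] by simp

section \<open>Reflections, translations and integration by parts\<close>

lemma lborel_distr_reflect: "distr lborel borel (\<lambda>y. x - y) = (lborel :: 'a::euclidean_space measure)"
  by (subst (2) lborel_affine[of "-1" x]) (auto simp: density_1)

lemma lborel_integral_reflect: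
  fixes g :: "'a::euclidean_space \<Rightarrow> real"
  assumes "g \<in> borel_measurable borel"
  shows "(LINT y|lborel. g (x - y)) = (LINT y|lborel. g y)"
    and "integrable lborel (\<lambda>y. g (x - y)) \<longleftrightarrow> integrable lborel g"
    and "(\<integral>\<^sup>+y. ennreal (g (x - y)) \<partial>lborel) = (\<integral>\<^sup>+y. ennreal (g y) \<partial>lborel)"
  using assms
  by (subst (2) lborel_distr_reflect[of x, symmetric],
      simp add: integral_distr integrable_distr_eq nn_integral_distr)+

lemma lborel_integral_translate:
  fixes g :: "'a::euclidean_space \<Rightarrow> real"
  assumes "g \<in> borel_measurable borel"
  shows "(LINT y|lborel. g (y + a)) = (LINT y|lborel. g y)"
    and "integrable lborel (\<lambda>y. g (y + a)) \<longleftrightarrow> integrable lborel g"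
  using assms by (subst (2) lborel_distr_plus[of a, symmetric],
      simp add: integral_distr integrable_distr_eq add.commute)+

lemma C_1_mean_value:
  fixes f :: "real ^ 'n::finite \<Rightarrow> real"
  assumes "C_k 1 f"
  obtains s where "0 < s" "s < 1" "f (x + h) - f x = (\<Sum>j\<in>UNIV. h $ j * partial j f (x + s *\<^sub>R h))"
proof -
  have "((\<lambda>s. f (x + s *\<^sub>R h)) has_real_derivative (\<Sum>j\<in>UNIV. h $ j * partial j f (x + s *\<^sub>R h))) (at s)" for s
  proof -
    have d: "f differentiable (at (x + s *\<^sub>R h))" using assms by simp
    have "((\<lambda>s. f (x + s *\<^sub>R h)) has_derivative
        (\<lambda>t. \<Sum>j\<in>UNIV. (t *\<^sub>R h) $ j * partial j f (x + s *\<^sub>R h))) (at s)"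
      by (rule has_derivative_compose[where f = "\<lambda>s. x + s *\<^sub>R h", OF _ has_derivative_partial[OF d]])
         (auto intro!: derivative_eq_intros)
    moreover have "(\<lambda>t. \<Sum>j\<in>UNIV. (t *\<^sub>R h) $ j * partial j f (x + s *\<^sub>R h))
        = (*) (\<Sum>j\<in>UNIV. h $ j * partial j f (x + s *\<^sub>R h))"
      by (simp add: fun_eq_iff sum_distrib_left sum_distrib_right ac_simps)
    ultimately show ?thesis by (simp add: has_field_derivative_def)
  qed
  then have "\<exists>s>0. s < 1 \<and> f (x + 1 *\<^sub>R h) - f (x + 0 *\<^sub>R h) = (1 - 0) * (\<Sum>j\<in>UNIV. h $ j * partial j f (x + s *\<^sub>R h))"
    by (intro MVT2) auto
  with that show ?thesis by auto
qed

text \<open>By the mean value theorem the Taylor remainder is controlled by the oscillation of the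
  partial derivatives, which are uniformly continuous. The radius \<open>d\<close> does not depend
  on \<open>x\<close>, so the remainder estimate can be integrated.\<close>

lemma uniform_differentiability:
  fixes f :: "real ^ 'n::finite \<Rightarrow> real"
  assumes f: "C_k 1 f" "bounded_support f" and e: "0 < e"
  obtains d where "0 < d"
    "\<And>x h. norm h < d \<Longrightarrow> \<bar>f (x + h) - f x - (\<Sum>j\<in>UNIV. h $ j * partial j f x)\<bar> \<le> e * norm h"
proof -
  \<comment> \<open>Each of the CARD('n) directions may contribute at most e' times the norm of
    h.\<close>
  define e' where "e' = e / CARD('n)"
  have e': "0 < e'" using e by (simp add: e'_def)
  have "\<exists>d>0. \<forall>x y. dist x y < d \<longrightarrow> \<bar>partial j f x - partial j f y\<bar> < e'" for j
    by (rule continuous_bounded_support_uniformly_continuous[OF _ bounded_support_partial[OF f(2)] e', of j])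
       (use f in auto)
  then obtain d where d: "\<And>j. 0 < d j" "\<And>j x y. dist x y < d j \<Longrightarrow> \<bar>partial j f x - partial j f y\<bar> < e'"
    by metis
  define D where "D = Min (range d)"
  have D: "0 < D" "\<And>j. D \<le> d j" unfolding D_def using d(1) by auto
  show ?thesis
  proof (rule that[OF D(1)])
    fix x h :: "real ^ 'n" assume h: "norm h < D"
    obtain s where s: "0 < s" "s < 1" "f (x + h) - f x = (\<Sum>j\<in>UNIV. h $ j * partial j f (x + s *\<^sub>R h))"
      using C_1_mean_value[OF f(1)] by blast
    have "dist (x + s *\<^sub>R h) x < d j" for j
    proof -
      have "dist (x + s *\<^sub>R h) x = s * norm h" using s by (simp add: dist_norm)
      also have "\<dots> \<le> norm h" using s by (simp add: mult_left_le_one_le)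
      finally show ?thesis using h D(2)[of j] by linarith
    qed
    then have b: "\<bar>partial j f (x + s *\<^sub>R h) - partial j f x\<bar> \<le> e'" for j
      using d(2) less_imp_le by blast
    have "f (x + h) - f x - (\<Sum>j\<in>UNIV. h $ j * partial j f x)
        = (\<Sum>j\<in>UNIV. h $ j * (partial j f (x + s *\<^sub>R h) - partial j f x))"
      by (simp add: s(3) sum_subtractf right_diff_distrib)
    also have "\<bar>\<dots>\<bar> \<le> (\<Sum>j\<in>UNIV. \<bar>h $ j * (partial j f (x + s *\<^sub>R h) - partial j f x)\<bar>)"
      by (rule sum_abs)
    also have "\<dots> \<le> (\<Sum>j\<in>(UNIV :: 'n set). norm h * e')"
      unfolding abs_mult by (intro sum_mono mult_mono b component_le_norm_cart) auto
    also have "\<dots> = e * norm h" by (simp add: e'_def)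
    finally show "\<bar>f (x + h) - f x - (\<Sum>j\<in>UNIV. h $ j * partial j f x)\<bar> \<le> e * norm h" .
  qed
qed

text \<open>A non-integrable \<open>f\<close> has Bochner integral 0 by convention, and the bound
  then holds because \<open>w\<close> dominates an absolute value and so is nonnegative.\<close>

lemma abs_integral_le_integral:
  fixes f :: "'a::euclidean_space \<Rightarrow> real"
  assumes "integrable lborel w" "\<And>x. \<bar>f x\<bar> \<le> w x"
  shows "\<bar>LINT x|lborel. f x\<bar> \<le> (LINT x|lborel. w x)"
proof (cases "integrable lborel f")
  case True
  have "\<bar>LINT x|lborel. f x\<bar> \<le> (LINT x|lborel. \<bar>f x\<bar>)"
    by (rule integral_abs_bound)
  also have "\<dots> \<le> (LINT x|lborel. w x)"
    by (intro integral_mono assms integrable_abs True)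
  finally show ?thesis .
next
  case False
  have "0 \<le> (LINT x|lborel. w x)"
    by (intro integral_nonneg_AE AE_I2) (use assms(2) abs_ge_zero order_trans in blast)
  then show ?thesis using False by (simp add: not_integrable_integral_eq)
qed

lemma C_1_continuous_partial: "C_k 1 f \<Longrightarrow> continuous_on UNIV (partial j f)"
  by simp

text \<open>Translation invariance makes the integral of f(x + h) - f(x) vanish. With h = t e_j, the
  integral of t times the derivative is therefore minus the integrated Taylor remainder, which is at
  most e t on a fixed ball. Dividing by t and letting e tend to 0 leaves 0.\<close>

lemma integral_partial_eq_0:
  fixes f :: "real ^ 'n::finite \<Rightarrow> real"
  assumes f: "C_k 1 f" "bounded_support f"
  shows "(LINT x|lborel. partial j f x) = 0"
proof -
  obtain R where R: "\<And>x. R < norm x \<Longrightarrow> f x = 0" using f(2) unfolding bounded_support_def by auto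
  define M where "M = (LINT x|lborel. indicator (cball (0 :: real ^ 'n) (R + 1)) x :: real)"
  have M: "0 \<le> M" unfolding M_def by (intro integral_nonneg_AE) auto
  have cf: "continuous_on UNIV f" using f(1) by (rule C_k_imp_continuous)
  have bf: "f \<in> borel_measurable borel" by (rule borel_measurable_continuous_onI[OF cf])
  have If: "integrable lborel f" by (rule integrable_continuous_bounded_support[OF cf f(2)])
  have Ip: "integrable lborel (partial j f)"
    by (intro integrable_continuous_bounded_support C_1_continuous_partial bounded_support_partial f)
  have "\<bar>LINT x|lborel. partial j f x\<bar> \<le> e * M" if e: "0 < e" for e
  proof -
    obtain d where d: "0 < d"
      "\<And>x h. norm h < d \<Longrightarrow> \<bar>f (x + h) - f x - (\<Sum>j\<in>UNIV. h $ j * partial j f x)\<bar> \<le> e * norm h"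
      using uniform_differentiability[OF f e] by blast
    \<comment> \<open>The bound t < d is needed for the Taylor estimate; t <= 1 confines the support
      of the translated function to the ball of radius R + 1.\<close>
    define t where "t = min (d / 2) 1"
    have t: "0 < t" "t < d" "t \<le> 1" using d(1) by (auto simp: t_def)
    define h :: "real ^ 'n" where "h = t *\<^sub>R axis j 1"
    have nh: "norm h = t" using t by (simp add: h_def)
    have sh: "(\<Sum>i\<in>UNIV. h $ i * partial i f x) = t * partial j f x" for x
    proof -
      have "(\<Sum>i\<in>UNIV. h $ i * partial i f x) = (\<Sum>i\<in>UNIV. if i = j then t * partial j f x else 0)"
        by (intro sum.cong) (auto simp: h_def axis_def)
      then show ?thesis by simp
    qed
    have Ih: "integrable lborel (\<lambda>x. f (x + h))" using lborel_integral_translate(2)[OF bf] If by simp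
    have "\<bar>LINT x|lborel. f (x + h) - f x - t * partial j f x\<bar>
        \<le> (LINT x|lborel. e * t * indicator (cball (0 :: real ^ 'n) (R + 1)) x)"
    proof (rule abs_integral_le_integral)
      show "integrable lborel (\<lambda>x. e * t * indicator (cball (0 :: real ^ 'n) (R + 1)) x)"
        using integrable_indicator_cball by auto
      fix x
      show "\<bar>f (x + h) - f x - t * partial j f x\<bar> \<le> e * t * indicator (cball (0 :: real ^ 'n) (R + 1)) x"
      proof (cases "norm x \<le> R + 1")
        case True
        then show ?thesis using d(2)[of h x] t by (simp add: nh sh)
      next
        case False
        have "norm x \<le> norm (x + h) + norm h" using norm_triangle_ineq4[of "x + h" h] by simp
        then have "R < norm (x + h)" using False nh t by simp
        then show ?thesis using R[of "x + h"] R[of x] partial_zero_outside[of R f x j] R False by simp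
      qed
    qed
    also have "\<dots> = e * t * M" by (simp add: M_def)
    also have "(LINT x|lborel. f (x + h) - f x - t * partial j f x) = - (t * (LINT x|lborel. partial j f x))"
      using Ih If Ip lborel_integral_translate(1)[OF bf] by simp
    finally have "t * \<bar>LINT x|lborel. partial j f x\<bar> \<le> t * (e * M)"
      using t by (simp add: abs_mult ac_simps)
    then show ?thesis using t by simp
  qed
  note * = this
  have "\<bar>LINT x|lborel. partial j f x\<bar> \<le> 0"
  proof (rule field_le_epsilon)
    fix e :: real assume "0 < e"
    then have "\<bar>LINT x|lborel. partial j f x\<bar> \<le> e / (M + 1) * M" using M by (intro *) simp
    also have "\<dots> \<le> e" using M \<open>0 < e\<close> by (simp add: field_simps)
    finally show "\<bar>LINT x|lborel. partial j f x\<bar> \<le> 0 + e" by simp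
  qed
  then show ?thesis by simp
qed

subsection \<open>Convolution\<close>

text \<open>The integration variable sits in \<open>f\<close>, so all derivatives fall on
  \<open>k\<close> and no regularity of \<open>f\<close> is involved.\<close>

definition conv :: "('a::euclidean_space \<Rightarrow> real) \<Rightarrow> ('a \<Rightarrow> real) \<Rightarrow> 'a \<Rightarrow> real" where
  "conv f k x = (LINT y|lborel. f y * k (x - y))"

lemma continuous_bounded_support_reflect:
  fixes k :: "'a::euclidean_space \<Rightarrow> real"
  assumes "continuous_on UNIV k" "bounded_support k"
  shows "continuous_on UNIV (\<lambda>y. k (x - y))" "bounded_support (\<lambda>y. k (x - y))"
proof -
  show "continuous_on UNIV (\<lambda>y. k (x - y))"
    by (auto intro!: continuous_intros continuous_on_compose2[OF assms(1)])
  show "bounded_support (\<lambda>y. k (x - y))"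
    using bounded_support_affine[OF assms(2), of "-1" x] by simp
qed

lemma integrable_conv:
  assumes "locally_integrable f" "continuous_on UNIV k" "bounded_support k"
  shows "integrable lborel (\<lambda>y. f y * k (x - y))"
  by (intro integrable_locally_integrable_mult assms continuous_bounded_support_reflect)

text \<open>The Taylor remainder of \<open>k\<close> is uniformly small, so integrating it against
  |f| over a fixed ball gives an error of order e times the norm of h.\<close>

lemma conv_has_derivative:
  fixes k :: "real ^ 'n::finite \<Rightarrow> real"
  assumes f: "locally_integrable f" and k: "C_k 1 k" "bounded_support k"
  shows "(conv f k has_derivative (\<lambda>h. \<Sum>j\<in>UNIV. h $ j * conv f (partial j k) x)) (at x)"
  unfolding has_derivative_at_alt
proof (intro conjI allI impI)
  show "bounded_linear (\<lambda>h. \<Sum>j\<in>UNIV. h $ j * conv f (partial j k) x)"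
    by (intro bounded_linear_sum bounded_linear_mult_const bounded_linear_vec_nth)
  fix e :: real assume e: "0 < e"
  obtain R where R: "\<And>x. R < norm x \<Longrightarrow> k x = 0" using k(2) unfolding bounded_support_def by auto
  \<comment> \<open>For y outside this ball and increments of norm below 1, both x - y and x + h - y
    lie outside the support of \<open>k\<close>.\<close>
  define B where "B = cball (0 :: real ^ 'n) (norm x + (R + 1))"
  define M where "M = (LINT y|lborel. indicator B y * \<bar>f y\<bar>)"
  have IB: "integrable lborel (\<lambda>y. indicator B y * \<bar>f y\<bar>)"
  proof -
    have "integrable lborel (\<lambda>y. \<bar>indicator B y * f y\<bar>)"
      unfolding B_def using f unfolding locally_integrable_def by (intro integrable_abs) blast
    then show ?thesis by (simp add: abs_mult)
  qed
  have M: "0 \<le> M" unfolding M_def by (intro integral_nonneg_AE) auto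
  define e' where "e' = e / (M + 1)"
  have e': "0 < e'" "e' * M \<le> e" using e M by (auto simp: e'_def field_simps)
  obtain d where d: "0 < d"
    "\<And>x h. norm h < d \<Longrightarrow> \<bar>k (x + h) - k x - (\<Sum>j\<in>UNIV. h $ j * partial j k x)\<bar> \<le> e' * norm h"
    using uniform_differentiability[OF k e'(1)] by blast
  have ck: "continuous_on UNIV k" using k(1) by (rule C_k_imp_continuous)
  note Ik = integrable_conv[OF f ck k(2)]
  have Ip: "integrable lborel (\<lambda>y. f y * partial j k (z - y))" for j z
    by (intro integrable_conv f C_1_continuous_partial bounded_support_partial k)
  show "\<exists>d>0. \<forall>y. norm (y - x) < d \<longrightarrow>
      norm (conv f k y - conv f k x - (\<Sum>j\<in>UNIV. (y - x) $ j * conv f (partial j k) x)) \<le> e * norm (y - x)"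
  proof (intro exI[of _ "min d 1"] conjI allI impI)
    show "0 < min d 1" using d by simp
    fix z assume z: "norm (z - x) < min d 1"
    define h where "h = z - x"
    have zx: "z = x + h" by (simp add: h_def)
    have eq: "conv f k z - conv f k x - (\<Sum>j\<in>UNIV. h $ j * conv f (partial j k) x)
       = (LINT y|lborel. f y * (k (x - y + h) - k (x - y) - (\<Sum>j\<in>UNIV. h $ j * partial j k (x - y))))"
    proof -
      have "(LINT y|lborel. f y * (k (x - y + h) - k (x - y) - (\<Sum>j\<in>UNIV. h $ j * partial j k (x - y))))
        = (LINT y|lborel. f y * k (z - y) - f y * k (x - y) - (\<Sum>j\<in>UNIV. h $ j * (f y * partial j k (x - y))))"
        by (intro Bochner_Integration.integral_cong) (auto simp: zx algebra_simps sum_distrib_left)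
      also have "\<dots> = (LINT y|lborel. f y * k (z - y)) - (LINT y|lborel. f y * k (x - y))
          - (\<Sum>j\<in>UNIV. h $ j * (LINT y|lborel. f y * partial j k (x - y)))"
        using Ik Ip by simp
      finally show ?thesis by (simp add: conv_def)
    qed
    have "\<bar>conv f k z - conv f k x - (\<Sum>j\<in>UNIV. h $ j * conv f (partial j k) x)\<bar>
       \<le> (LINT y|lborel. e' * norm h * (indicator B y * \<bar>f y\<bar>))"
      unfolding eq
    proof (rule abs_integral_le_integral)
      show "integrable lborel (\<lambda>y. e' * norm h * (indicator B y * \<bar>f y\<bar>))" using IB by simp
      fix y
      let ?r = "k (x - y + h) - k (x - y) - (\<Sum>j\<in>UNIV. h $ j * partial j k (x - y))"
      show "\<bar>f y * ?r\<bar> \<le> e' * norm h * (indicator B y * \<bar>f y\<bar>)"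
      proof (cases "y \<in> B")
        case True
        have "\<bar>?r\<bar> \<le> e' * norm h" using d(2)[of h "x - y"] z by (simp add: h_def)
        then have "\<bar>f y\<bar> * \<bar>?r\<bar> \<le> \<bar>f y\<bar> * (e' * norm h)" by (rule mult_left_mono) simp
        then show ?thesis using True by (simp add: abs_mult ac_simps)
      next
        case False
        have "norm y \<le> norm (x - y) + norm x" using norm_triangle_ineq4[of x "x - y"] by simp
        then have 1: "R + 1 < norm (x - y)" using False by (simp add: B_def)
        have "norm (x - y) \<le> norm (x - y + h) + norm h" using norm_triangle_ineq4[of "x - y + h" h] by simp
        then have 2: "R < norm (x - y + h)" using 1 z by (simp add: h_def)
        have "partial j k (x - y) = 0" for j by (rule partial_zero_outside[of R]) (use R 1 in auto)
        then have "?r = 0" using R[OF 2] R[of "x - y"] 1 by simp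
        then show ?thesis using False by simp
      qed
    qed
    also have "\<dots> = (e' * M) * norm h" by (simp add: M_def)
    also have "\<dots> \<le> e * norm h" by (intro mult_right_mono e') simp
    finally show "norm (conv f k z - conv f k x - (\<Sum>j\<in>UNIV. (z - x) $ j * conv f (partial j k) x)) \<le> e * norm (z - x)"
      by (simp add: h_def)
  qed
qed

lemma partial_conv:
  fixes k :: "real ^ 'n::finite \<Rightarrow> real"
  assumes "locally_integrable f" "C_k 1 k" "bounded_support k"
  shows "partial j (conv f k) = conv f (partial j k)"
proof
  fix x
  have "partial j (conv f k) x = (\<Sum>i\<in>UNIV. if i = j then conv f (partial j k) x else 0)"
    by (subst partial_eqI[OF conv_has_derivative[OF assms]], intro sum.cong) (auto simp: axis_def)
  then show "partial j (conv f k) x = conv f (partial j k) x" by simp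
qed

lemma differentiable_conv:
  fixes k :: "real ^ 'n::finite \<Rightarrow> real"
  assumes "locally_integrable f" "C_k 1 k" "bounded_support k"
  shows "\<forall>x. conv f k differentiable (at x)"
  using conv_has_derivative[OF assms] unfolding differentiable_def by blast

lemma test_function_C_1: "test_function k \<Longrightarrow> C_k 1 k \<and> bounded_support k"
  by (auto simp: test_function_iff intro: smooth_C_k simp del: C_k.simps One_nat_def)

lemma smooth_conv:
  fixes k :: "real ^ 'n::finite \<Rightarrow> real"
  assumes f: "locally_integrable f" and "test_function k"
  shows "smooth (conv f k)"
proof -
  have "C_k m (conv f k)" for m
    using assms(2)
  proof (induction m arbitrary: k)
    case 0
    then show ?case
      using differentiable_conv[OF f, of k] test_function_C_1[of k]
      by (simp add: continuous_at_imp_continuous_on differentiable_imp_continuous_within del: One_nat_def)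
  next
    case (Suc m)
    then show ?case
      using differentiable_conv[OF f, of k] partial_conv[OF f, of k] test_function_C_1[of k]
        Suc.IH[OF test_function_partial[OF Suc.prems]]
      by (simp del: One_nat_def)
  qed
  then show ?thesis by (simp add: smooth_def)
qed

lemma test_function_continuous: "test_function k \<Longrightarrow> continuous_on UNIV k"
  by (simp add: test_function_iff smooth_continuous)

lemma test_function_bounded_support: "test_function k \<Longrightarrow> bounded_support k"
  by (simp add: test_function_iff)

lemma partial_conv_test_function:
  fixes k :: "real ^ 'n::finite \<Rightarrow> real"
  assumes "locally_integrable f" "test_function k"
  shows "partial j (conv f k) = conv f (partial j k)"
  using partial_conv[OF assms(1)] test_function_C_1[OF assms(2)] by blast

lemma laplacian_conv:
  fixes k :: "real ^ 'n::finite \<Rightarrow> real"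
  assumes f: "locally_integrable f" and k: "test_function k"
  shows "laplacian (conv f k) = conv f (laplacian k)"
proof
  fix x
  have p: "partial j (partial j (conv f k)) = conv f (partial j (partial j k))" for j
    by (simp add: partial_conv_test_function f k test_function_partial)
  have I: "integrable lborel (\<lambda>y. f y * partial j (partial j k) (x - y))" for j
    by (intro integrable_conv f test_function_continuous test_function_bounded_support test_function_partial k)
  have "laplacian (conv f k) x = (\<Sum>j\<in>UNIV. LINT y|lborel. f y * partial j (partial j k) (x - y))"
    by (simp add: laplacian_def p conv_def)
  also have "\<dots> = conv f (laplacian k) x"
    using I by (simp add: conv_def laplacian_def sum_distrib_left)
  finally show "laplacian (conv f k) x = conv f (laplacian k) x" .
qed

lemma test_function_laplacian: "test_function k \<Longrightarrow> test_function (laplacian k)"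
  unfolding laplacian_def[abs_def] by (intro test_function_sum test_function_partial)

lemma partial_reflect:
  fixes k :: "real ^ 'n::finite \<Rightarrow> real"
  assumes "smooth k"
  shows "partial j (\<lambda>y. k (x - y)) = (\<lambda>y. - partial j k (x - y))"
  using partial_affine(1)[OF smooth_differentiable[OF assms], of j "-1" x] by simp

lemma test_function_reflect: "test_function k \<Longrightarrow> test_function (\<lambda>y. k (x - y))"
  using test_function_affine[of k "-1" x] by simp

lemma laplacian_reflect:
  fixes k :: "real ^ 'n::finite \<Rightarrow> real"
  assumes "smooth k"
  shows "laplacian (\<lambda>y. k (x - y)) = (\<lambda>y. laplacian k (x - y))"
proof -
  have s: "smooth (\<lambda>y. k (x - y))" "smooth (\<lambda>y. partial j k (x - y))" for j
    using smooth_intros(7)[OF assms, of "-1" x] smooth_intros(7)[OF smooth_partial[OF assms], of j "-1" x] by simp_all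
  have "partial j (partial j (\<lambda>y. k (x - y))) = (\<lambda>y. partial j (partial j k) (x - y))" for j
    using s by (simp add: partial_reflect assms smooth_partial partial_uminus[OF smooth_differentiable])
  then show ?thesis by (simp add: laplacian_def fun_eq_iff)
qed

subsection \<open>Square-integrable functions\<close>

definition square_integrable :: "('a::euclidean_space \<Rightarrow> real) \<Rightarrow> bool" where
  "square_integrable f \<longleftrightarrow> f \<in> borel_measurable borel \<and> integrable lborel (\<lambda>x. (f x)\<^sup>2)"

lemma square_integrable_measurable: "square_integrable f \<Longrightarrow> f \<in> borel_measurable borel"
  by (simp add: square_integrable_def)

lemma square_integrable_integrable: "square_integrable f \<Longrightarrow> integrable lborel (\<lambda>x. (f x)\<^sup>2)"
  by (simp add: square_integrable_def)

lemma square_integrable_bound: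
  assumes "square_integrable g" "f \<in> borel_measurable borel" "\<And>x. \<bar>f x\<bar> \<le> C * \<bar>g x\<bar>"
  shows "square_integrable f"
  unfolding square_integrable_def
proof (intro conjI assms(2), rule Bochner_Integration.integrable_bound)
  show "integrable lborel (\<lambda>x. C\<^sup>2 * (g x)\<^sup>2)" using assms(1) by (simp add: square_integrable_def)
  show "(\<lambda>x. (f x)\<^sup>2) \<in> borel_measurable lborel" using assms(2) by measurable
  show "AE x in lborel. norm ((f x)\<^sup>2) \<le> norm (C\<^sup>2 * (g x)\<^sup>2)"
  proof (rule AE_I2)
    fix x
    have "\<bar>f x\<bar>\<^sup>2 \<le> (C * \<bar>g x\<bar>)\<^sup>2" using assms(3) by (intro power_mono) auto
    then show "norm ((f x)\<^sup>2) \<le> norm (C\<^sup>2 * (g x)\<^sup>2)" by (simp add: power_mult_distrib)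
  qed
qed

lemma square_integrable_mult_integrable:
  assumes "square_integrable f" "square_integrable g"
  shows "integrable lborel (\<lambda>x. f x * g x)"
proof (rule Bochner_Integration.integrable_bound)
  show "integrable lborel (\<lambda>x. (f x)\<^sup>2 + (g x)\<^sup>2)" using assms by (simp add: square_integrable_def)
  show "(\<lambda>x. f x * g x) \<in> borel_measurable lborel"
    using assms[THEN square_integrable_measurable] by measurable
  show "AE x in lborel. norm (f x * g x) \<le> norm ((f x)\<^sup>2 + (g x)\<^sup>2)"
  proof (rule AE_I2)
    fix x
    have "2 * (\<bar>f x\<bar> * \<bar>g x\<bar>) \<le> (f x)\<^sup>2 + (g x)\<^sup>2"
      using sum_squares_bound[of "\<bar>f x\<bar>" "\<bar>g x\<bar>"] by simp
    moreover have "0 \<le> \<bar>f x\<bar> * \<bar>g x\<bar>" by simp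
    ultimately have "\<bar>f x\<bar> * \<bar>g x\<bar> \<le> (f x)\<^sup>2 + (g x)\<^sup>2" by linarith
    then show "norm (f x * g x) \<le> norm ((f x)\<^sup>2 + (g x)\<^sup>2)" by (simp add: abs_mult)
  qed
qed

lemma square_integrable_diff:
  assumes "square_integrable f" "square_integrable g"
  shows "square_integrable (\<lambda>x. f x - g x)"
  using assms square_integrable_mult_integrable[OF assms]
  by (auto simp: square_integrable_def power2_diff mult.assoc)

lemma square_integrable_indicator_cball:
  "square_integrable (indicator (cball a R) :: 'a::euclidean_space \<Rightarrow> real)"
  using integrable_indicator_cball[of a R] by (simp add: square_integrable_def power2_eq_square flip: indicator_inter_arith)

lemma square_integrable_locally_integrable:
  assumes "square_integrable f"
  shows "locally_integrable f"
  unfolding locally_integrable_def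
  using assms square_integrable_mult_integrable[OF square_integrable_indicator_cball assms]
  by (simp add: square_integrable_measurable)

lemma square_integrable_continuous:
  fixes k :: "'a::euclidean_space \<Rightarrow> real"
  assumes k: "continuous_on UNIV k" "bounded_support k"
  shows "square_integrable k"
  unfolding square_integrable_def power2_eq_square
  by (auto intro!: integrable_continuous_bounded_support continuous_intros k bounded_support_mult1
      borel_measurable_continuous_onI)

section \<open>Strong L2 convergence, products and density\<close>

lemma Cauchy_Schwarz_integral:
  assumes f: "square_integrable f" and g: "square_integrable g"
  shows "(LINT x|lborel. \<bar>f x * g x\<bar>) \<le> sqrt (LINT x|lborel. (f x)\<^sup>2) * sqrt (LINT x|lborel. (g x)\<^sup>2)"
proof -
  have [measurable]: "f \<in> borel_measurable borel" "g \<in> borel_measurable borel"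
    using f g by (auto simp: square_integrable_def)
  have I: "integrable lborel (\<lambda>x. \<bar>f x * g x\<bar>)" "integrable lborel (\<lambda>x. (f x)\<^sup>2)" "integrable lborel (\<lambda>x. (g x)\<^sup>2)"
    using square_integrable_mult_integrable[OF f g] f g by (auto simp: square_integrable_def)
  have n: "(\<integral>\<^sup>+x. ennreal \<bar>f x\<bar> * ennreal \<bar>g x\<bar> \<partial>lborel) = ennreal (LINT x|lborel. \<bar>f x * g x\<bar>)"
    using I(1) by (subst nn_integral_eq_integral[symmetric]) (auto simp: abs_mult ennreal_mult)
  have s: "(\<integral>\<^sup>+x. (ennreal \<bar>h x\<bar>)\<^sup>2 \<partial>lborel) = ennreal (LINT x|lborel. (h x)\<^sup>2)"
    if "integrable lborel (\<lambda>x. (h x)\<^sup>2)" for h :: "'a \<Rightarrow> real"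
    using that by (subst nn_integral_eq_integral[symmetric]) (auto simp: ennreal_power)
  have "(\<integral>\<^sup>+x. ennreal \<bar>f x\<bar> * ennreal \<bar>g x\<bar> \<partial>lborel)\<^sup>2
      \<le> (\<integral>\<^sup>+x. (ennreal \<bar>f x\<bar>)\<^sup>2 \<partial>lborel) * (\<integral>\<^sup>+x. (ennreal \<bar>g x\<bar>)\<^sup>2 \<partial>lborel)"
    by (intro Cauchy_Schwarz_nn_integral) auto
  then have "ennreal ((LINT x|lborel. \<bar>f x * g x\<bar>)\<^sup>2) \<le> ennreal ((LINT x|lborel. (f x)\<^sup>2) * (LINT x|lborel. (g x)\<^sup>2))"
    unfolding n s[OF I(2)] s[OF I(3)] by (simp add: ennreal_power ennreal_mult)
  then have "(LINT x|lborel. \<bar>f x * g x\<bar>)\<^sup>2 \<le> (LINT x|lborel. (f x)\<^sup>2) * (LINT x|lborel. (g x)\<^sup>2)"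
    by (subst (asm) ennreal_le_iff) auto
  then have "(LINT x|lborel. \<bar>f x * g x\<bar>) \<le> sqrt ((LINT x|lborel. (f x)\<^sup>2) * (LINT x|lborel. (g x)\<^sup>2))"
    by (rule real_le_rsqrt)
  then show ?thesis by (simp add: real_sqrt_mult)
qed

text \<open>Square integrability of every term and of the limit is part of the notion, so the
  integrals of squared differences are never the default value 0.\<close>

definition tendsto_L2 :: "(nat \<Rightarrow> 'a::euclidean_space \<Rightarrow> real) \<Rightarrow> ('a \<Rightarrow> real) \<Rightarrow> bool" where
  "tendsto_L2 a b \<longleftrightarrow> square_integrable b \<and> (\<forall>n. square_integrable (a n)) \<and>
     (\<lambda>n. LINT x|lborel. (a n x - b x)\<^sup>2) \<longlonglongrightarrow> 0"

text \<open>Expanding about the limits, ab - a'b' = (a - a')(b - b') + a'(b - b') + (a - a')b', and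
  Cauchy-Schwarz bounds each term by a product containing a vanishing factor.\<close>

lemma tendsto_L2_mult:
  assumes a: "tendsto_L2 a a'" and b: "tendsto_L2 b b'"
    and \<phi>: "\<phi> \<in> borel_measurable borel" "\<And>x. \<bar>\<phi> x\<bar> \<le> C"
  shows "(\<lambda>n. LINT x|lborel. a n x * b n x * \<phi> x) \<longlonglongrightarrow> (LINT x|lborel. a' x * b' x * \<phi> x)"
proof -
  have C: "0 \<le> C" using \<phi>(2)[of 0] by simp
  note S = a[unfolded tendsto_L2_def] b[unfolded tendsto_L2_def]
  have sa: "square_integrable a'" "\<And>n. square_integrable (a n)"
    and sb: "square_integrable b'" "\<And>n. square_integrable (b n)" using S by auto
  note da = square_integrable_diff[OF sa(2) sa(1)] and db = square_integrable_diff[OF sb(2) sb(1)]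
  have I: "integrable lborel (\<lambda>x. f x * g x * \<phi> x)" if "square_integrable f" "square_integrable g" for f g
  proof (rule Bochner_Integration.integrable_bound)
    show "integrable lborel (\<lambda>x. C * (f x * g x))"
      using square_integrable_mult_integrable[OF that] by simp
    show "(\<lambda>x. f x * g x * \<phi> x) \<in> borel_measurable lborel"
      using that[THEN square_integrable_measurable] \<phi>(1) by measurable
    show "AE x in lborel. norm (f x * g x * \<phi> x) \<le> norm (C * (f x * g x))"
      using C \<phi>(2) by (auto intro!: AE_I2 mult_mono simp: abs_mult mult.commute)
  qed
  define A where "A n = sqrt (LINT x|lborel. (a n x - a' x)\<^sup>2)" for n
  define B where "B n = sqrt (LINT x|lborel. (b n x - b' x)\<^sup>2)" for n
  define A' where "A' = sqrt (LINT x|lborel. (a' x)\<^sup>2)"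
  define B' where "B' = sqrt (LINT x|lborel. (b' x)\<^sup>2)"
  have lim: "A \<longlonglongrightarrow> 0" "B \<longlonglongrightarrow> 0"
    unfolding A_def B_def using S tendsto_real_sqrt[of _ 0 sequentially] by fastforce+
  have "\<bar>(LINT x|lborel. a n x * b n x * \<phi> x) - (LINT x|lborel. a' x * b' x * \<phi> x)\<bar>
      \<le> C * (A n * B n + A' * B n + A n * B')" for n
  proof -
    let ?p = "\<lambda>x. (a n x - a' x) * (b n x - b' x)" and ?q = "\<lambda>x. a' x * (b n x - b' x)"
      and ?r = "\<lambda>x. (a n x - a' x) * b' x"
    have J: "integrable lborel (\<lambda>x. abs (?p x))"
       "integrable lborel (\<lambda>x. abs (?q x))" "integrable lborel (\<lambda>x. abs (?r x))"
      by (intro integrable_abs square_integrable_mult_integrable da db sa sb)+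
    have "(LINT x|lborel. a n x * b n x * \<phi> x) - (LINT x|lborel. a' x * b' x * \<phi> x)
        = (LINT x|lborel. a n x * b n x * \<phi> x - a' x * b' x * \<phi> x)"
      using I sa sb by simp
    also have "\<bar>\<dots>\<bar> \<le> (LINT x|lborel. C * (abs (?p x) + abs (?q x) + abs (?r x)))"
    proof (rule abs_integral_le_integral)
      show "integrable lborel (\<lambda>x. C * (abs (?p x) + abs (?q x) + abs (?r x)))"
        using J by simp
      fix x
      have "a n x * b n x * \<phi> x - a' x * b' x * \<phi> x
          = \<phi> x * ((a n x - a' x) * (b n x - b' x) + a' x * (b n x - b' x) + (a n x - a' x) * b' x)"
        by (simp add: algebra_simps)
      also have "\<bar>\<dots>\<bar> \<le> C * (abs (?p x) + abs (?q x) + abs (?r x))"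
        unfolding abs_mult[of "\<phi> x"] by (intro mult_mono \<phi>(2) C) auto
      finally show "\<bar>a n x * b n x * \<phi> x - a' x * b' x * \<phi> x\<bar>
        \<le> C * (abs (?p x) + abs (?q x) + abs (?r x))" .
    qed
    also have "\<dots> = C * ((LINT x|lborel. abs (?p x))
       + (LINT x|lborel. abs (?q x)) + (LINT x|lborel. abs (?r x)))"
      by (simp only: integral_mult_right_zero Bochner_Integration.integral_add[OF Bochner_Integration.integrable_add[OF J(1,2)] J(3)]
          Bochner_Integration.integral_add[OF J(1,2)])
    also have "\<dots> \<le> C * (A n * B n + A' * B n + A n * B')"
      unfolding A_def B_def A'_def B'_def
      by (intro mult_left_mono add_mono Cauchy_Schwarz_integral da db sa sb C)
    finally show ?thesis .
  qed
  note bound = this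
  have "(\<lambda>n. C * (A n * B n + A' * B n + A n * B')) \<longlonglongrightarrow> C * (0 * 0 + A' * 0 + 0 * B')"
    by (intro tendsto_intros lim)
  then have "(\<lambda>n. C * (A n * B n + A' * B n + A n * B')) \<longlonglongrightarrow> 0" by simp
  then have "(\<lambda>n. (LINT x|lborel. a n x * b n x * \<phi> x) - (LINT x|lborel. a' x * b' x * \<phi> x)) \<longlonglongrightarrow> 0"
    by (rule Lim_null_comparison[rotated, where g = "\<lambda>n. C * (A n * B n + A' * B n + A n * B')"])
       (simp_all add: bound)
  then show ?thesis by (simp add: LIM_zero_iff)
qed

lemma integral_tendsto_zero_mono:
  fixes f :: "nat \<Rightarrow> 'a::euclidean_space \<Rightarrow> real"
  assumes "(\<lambda>n. LINT x|lborel. g n x) \<longlonglongrightarrow> 0" "\<And>n. integrable lborel (g n)"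
    "\<And>n x. 0 \<le> f n x" "\<And>n x. f n x \<le> g n x" "\<And>n. f n \<in> borel_measurable borel"
  shows "(\<lambda>n. LINT x|lborel. f n x) \<longlonglongrightarrow> 0"
proof (rule tendsto_sandwich[OF _ _ tendsto_const assms(1)])
  have g: "integrable lborel (f n)" for n
    by (rule Bochner_Integration.integrable_bound[OF assms(2)[of n]])
       (use assms(3-5) in \<open>auto intro!: AE_I2 order_trans[OF assms(4)]\<close>)
  show "\<forall>\<^sub>F n in sequentially. 0 \<le> (LINT x|lborel. f n x)"
    by (intro always_eventually allI integral_nonneg_AE AE_I2 assms(3))
  show "\<forall>\<^sub>F n in sequentially. (LINT x|lborel. f n x) \<le> (LINT x|lborel. g n x)"
    by (intro always_eventually allI integral_mono g assms)
qed

text \<open>First \<open>f\<close> is truncated in value and in space, with convergence dominated by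
  a multiple of f^2. Then the truncation is approximated by continuous functions that are truncated
  in the same way, which supplies both the bounded support and a dominating function.\<close>

lemma square_integrable_approx:
  fixes f :: "'a::euclidean_space \<Rightarrow> real"
  assumes f: "square_integrable f" and e: "0 < e"
  obtains g where "continuous_on UNIV g" "bounded_support g" "(LINT x|lborel. (g x - f x)\<^sup>2) < e"
proof -
  have [measurable]: "f \<in> borel_measurable borel" using f by (rule square_integrable_measurable)
  define clip :: "nat \<Rightarrow> real \<Rightarrow> real" where "clip m t = max (- real m) (min (real m) t)" for m t
  define cut :: "nat \<Rightarrow> 'a \<Rightarrow> real" where "cut m x = max 0 (1 - norm x / real (Suc m))" for m x
  have clip: "\<bar>clip m t\<bar> \<le> m" "\<bar>clip m t\<bar> \<le> \<bar>t\<bar>" for m t by (auto simp: clip_def)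
  have cut: "0 \<le> cut m x" "cut m x \<le> 1" for m x by (auto simp: cut_def)
  have ccut: "continuous_on UNIV (cut m)" for m unfolding cut_def by (intro continuous_intros) simp
  have bcut: "bounded_support (cut m)" for m
    unfolding bounded_support_def cut_def by (intro exI[of _ "real (Suc m)"]) (auto simp: field_simps)
  have cclip: "continuous_on UNIV (clip m)" for m unfolding clip_def by (intro continuous_intros)
  have [measurable]: "clip m \<in> borel_measurable borel" "cut m \<in> borel_measurable borel" for m
    by (intro borel_measurable_continuous_onI cclip ccut)+
  define h where "h m x = clip m (f x) * cut m x" for m x
  have hm [measurable]: "h m \<in> borel_measurable borel" for m unfolding h_def by measurable
  have hf: "\<bar>h m x\<bar> \<le> \<bar>f x\<bar>" for m x
  proof -
    have "\<bar>clip m (f x)\<bar> * \<bar>cut m x\<bar> \<le> \<bar>f x\<bar> * 1"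
      by (intro mult_mono clip) (use cut[of m x] in auto)
    then show ?thesis by (simp add: h_def abs_mult)
  qed
  have hlim: "(\<lambda>m. h m x) \<longlonglongrightarrow> f x" for x
  proof -
    have "\<forall>\<^sub>F m in sequentially. \<bar>f x\<bar> \<le> real m"
      using eventually_ge_at_top[of "nat \<lceil>\<bar>f x\<bar>\<rceil>"] by eventually_elim linarith
    then have "\<forall>\<^sub>F m in sequentially. f x = clip m (f x)"
      by eventually_elim (auto simp: clip_def)
    then have 1: "(\<lambda>m. clip m (f x)) \<longlonglongrightarrow> f x" by (rule Lim_transform_eventually[OF tendsto_const])
    have "(\<lambda>m. max 0 (1 - norm x * inverse (real (Suc m)))) \<longlonglongrightarrow> max 0 (1 - norm x * 0)"
      by (intro tendsto_intros LIMSEQ_inverse_real_of_nat)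
    then have 2: "(\<lambda>m. cut m x) \<longlonglongrightarrow> 1" by (simp add: cut_def divide_inverse)
    from tendsto_mult[OF 1 2] show ?thesis by (simp add: h_def)
  qed
  have "(\<lambda>m. LINT x|lborel. (h m x - f x)\<^sup>2) \<longlonglongrightarrow> (LINT x|(lborel :: 'a measure). 0)"
  proof (rule integral_dominated_convergence)
    show "integrable lborel (\<lambda>x. 4 * (f x)\<^sup>2)" using f by (simp add: square_integrable_def)
    show "AE x in lborel. (\<lambda>m. (h m x - f x)\<^sup>2) \<longlonglongrightarrow> 0"
      using hlim by (intro AE_I2 tendsto_null_power) (auto simp: LIM_zero_iff)
    fix m
    show "AE x in lborel. norm ((h m x - f x)\<^sup>2) \<le> 4 * (f x)\<^sup>2"
    proof (rule AE_I2)
      fix x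
      have "\<bar>h m x - f x\<bar> \<le> 2 * \<bar>f x\<bar>" using hf[of m x] by linarith
      then have "\<bar>h m x - f x\<bar>\<^sup>2 \<le> (2 * \<bar>f x\<bar>)\<^sup>2" by (intro power_mono) auto
      then show "norm ((h m x - f x)\<^sup>2) \<le> 4 * (f x)\<^sup>2" by (simp add: power_mult_distrib)
    qed
  qed measurable
  \<comment> \<open>Two errors of e / 4 suffice because (a + b)^2 <= 2 a^2 + 2 b^2.\<close>
  then have "\<forall>\<^sub>F m in sequentially. (LINT x|lborel. (h m x - f x)\<^sup>2) < e / 4"
    using e by (intro order_tendstoD) auto
  then obtain m where m: "(LINT x|lborel. (h m x - f x)\<^sup>2) < e / 4"
    by (auto simp: eventually_sequentially)
  \<comment> \<open>Measurability is traded for an almost everywhere limit of continuous functions;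
    nothing is known about their size or support yet.\<close>
  have "f \<in> borel_measurable (lebesgue_on UNIV)"
    by (simp add: lebesgue_on_UNIV_eq measurable_completion)
  then have "f measurable_on UNIV" by (simp add: measurable_on_iff_borel_measurable)
  then obtain N g where N: "negligible N" and g: "\<And>n. continuous_on UNIV (g n)"
    "\<And>x. x \<notin> N \<Longrightarrow> (\<lambda>n. g n x) \<longlonglongrightarrow> f x"
    unfolding measurable_on_def by auto
  \<comment> \<open>Clipping at level m leaves differences of at most 2 m times the cutoff, a
    square-integrable majorant uniform in n.\<close>
  define G where "G n x = clip m (g n x) * cut m x" for n x
  have Gc: "continuous_on UNIV (G n)" for n
    unfolding G_def by (intro continuous_intros ccut continuous_on_compose2[OF cclip g(1)]) auto
  have Gb: "bounded_support (G n)" for n unfolding G_def by (intro bounded_support_mult2 bcut)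
  have [measurable]: "G n \<in> borel_measurable borel" for n by (rule borel_measurable_continuous_onI[OF Gc])
  have "(\<lambda>n. LINT x|lborel. (G n x - h m x)\<^sup>2) \<longlonglongrightarrow> (LINT x|(lborel :: 'a measure). 0)"
  proof (rule integral_dominated_convergence)
    show "integrable lborel (\<lambda>x. (2 * real m)\<^sup>2 * (cut m x)\<^sup>2)"
      using square_integrable_continuous[OF ccut bcut, of m] by (simp add: square_integrable_def)
    have "AE x in lebesgue. (\<lambda>n. (G n x - h m x)\<^sup>2) \<longlonglongrightarrow> 0"
    proof (rule AE_I')
      show "N \<in> null_sets lebesgue" using N by (simp add: negligible_iff_null_sets)
      have "(\<lambda>n. (G n x - h m x)\<^sup>2) \<longlonglongrightarrow> 0" if "x \<notin> N" for x
      proof -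
        have "(\<lambda>n. clip m (g n x)) \<longlonglongrightarrow> clip m (f x)"
          by (rule continuous_on_tendsto_compose[OF cclip g(2)[OF that]]) auto
        then have "(\<lambda>n. (G n x - h m x)\<^sup>2) \<longlonglongrightarrow> (clip m (f x) * cut m x - h m x)\<^sup>2"
          unfolding G_def by (intro tendsto_intros)
        then show ?thesis by (simp add: h_def)
      qed
      then show "{x \<in> space lebesgue. \<not> (\<lambda>n. (G n x - h m x)\<^sup>2) \<longlonglongrightarrow> 0} \<subseteq> N" by auto
    qed
    then show "AE x in lborel. (\<lambda>n. (G n x - h m x)\<^sup>2) \<longlonglongrightarrow> 0"
      by (simp add: AE_completion_iff)
    fix n
    show "AE x in lborel. norm ((G n x - h m x)\<^sup>2) \<le> (2 * real m)\<^sup>2 * (cut m x)\<^sup>2"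
    proof (rule AE_I2)
      fix x
      have "G n x - h m x = (clip m (g n x) - clip m (f x)) * cut m x"
        by (simp add: G_def h_def algebra_simps)
      moreover have "\<bar>clip m (g n x) - clip m (f x)\<bar> \<le> 2 * real m"
        using clip(1)[of m "g n x"] clip(1)[of m "f x"] by linarith
      ultimately have "\<bar>G n x - h m x\<bar> \<le> 2 * real m * cut m x"
        using cut[of m x] by (simp add: abs_mult mult_right_mono)
      then have "\<bar>G n x - h m x\<bar>\<^sup>2 \<le> (2 * real m * cut m x)\<^sup>2" by (intro power_mono) auto
      then show "norm ((G n x - h m x)\<^sup>2) \<le> (2 * real m)\<^sup>2 * (cut m x)\<^sup>2" by (simp add: power_mult_distrib)
    qed
  qed measurable
  then have "\<forall>\<^sub>F n in sequentially. (LINT x|lborel. (G n x - h m x)\<^sup>2) < e / 4"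
    using e by (intro order_tendstoD) auto
  then obtain n where n: "(LINT x|lborel. (G n x - h m x)\<^sup>2) < e / 4"
    by (auto simp: eventually_sequentially)
  have sh: "square_integrable (h m)"
    by (rule square_integrable_bound[OF f, of _ 1]) (use hf in auto)
  have sG: "square_integrable (G n)" by (rule square_integrable_continuous[OF Gc Gb])
  note sd = square_integrable_diff[OF sG sh] square_integrable_diff[OF sh f] square_integrable_diff[OF sG f]
  have "(LINT x|lborel. (G n x - f x)\<^sup>2) \<le> (LINT x|lborel. 2 * (G n x - h m x)\<^sup>2 + 2 * (h m x - f x)\<^sup>2)"
  proof (rule integral_mono)
    fix x
    have "0 \<le> ((G n x - h m x) - (h m x - f x))\<^sup>2" by simp
    then show "(G n x - f x)\<^sup>2 \<le> 2 * (G n x - h m x)\<^sup>2 + 2 * (h m x - f x)\<^sup>2"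
      by (simp add: power2_eq_square algebra_simps)
  qed (use sd in \<open>simp_all add: square_integrable_def\<close>)
  also have "\<dots> = 2 * (LINT x|lborel. (G n x - h m x)\<^sup>2) + 2 * (LINT x|lborel. (h m x - f x)\<^sup>2)"
    using sd by (simp add: square_integrable_def)
  also have "\<dots> < e" using m n by simp
  finally show ?thesis using that Gc Gb by blast
qed

subsection \<open>Mollification\<close>

text \<open>A probability density supported in the ball of radius 1 / (n + 1). This radius never
  exceeds 1, which is why local statements below pass from radius R to R + 1.\<close>

definition mollifier :: "nat \<Rightarrow> real ^ 'n::finite \<Rightarrow> real" where
  "mollifier n z = bump (real (Suc n) *\<^sub>R z) / (LINT y|lborel. bump (real (Suc n) *\<^sub>R (y :: real ^ 'n)))"

lemma test_function_scaled_bump: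
  fixes r :: real
  shows "r \<noteq> 0 \<Longrightarrow> test_function (\<lambda>x. bump (r *\<^sub>R x))"
  using test_function_affine[OF test_function_bump, of r 0] by simp

text \<open>A vanishing integral would make the nonnegative bump zero almost everywhere. Its zero
  set is closed, so it would contain every point, including the origin, where the bump equals
  1.\<close>

lemma scaled_bump_integral_pos: "0 < (LINT y|lborel. bump (real (Suc n) *\<^sub>R (y :: real ^ 'n::finite)))"
proof -
  let ?k = "\<lambda>y :: real ^ 'n. bump (real (Suc n) *\<^sub>R y)"
  have t: "test_function ?k" by (rule test_function_scaled_bump) simp
  have I: "integrable lborel ?k"
    by (intro integrable_continuous_bounded_support test_function_continuous test_function_bounded_support t)
  have "(LINT y|lborel. ?k y) \<noteq> 0"
  proof
    assume "(LINT y|lborel. ?k y) = 0"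
    then have "AE y in lborel. ?k y = 0"
      using integral_nonneg_eq_0_iff_AE[OF I] by (simp add: bump_nonneg)
    then have "AE y in lebesgue. y \<in> {y. ?k y = 0}" by (simp add: AE_completion_iff)
    moreover have "closed {y. ?k y = 0}"
      by (intro closed_Collect_eq test_function_continuous t continuous_on_const)
    ultimately have "0 \<in> {y. ?k y = 0}" by (intro mem_closed_if_AE_lebesgue)
    then show False by (simp add: bump_0)
  qed
  moreover have "0 \<le> (LINT y|lborel. ?k y)" by (intro integral_nonneg_AE AE_I2 bump_nonneg)
  ultimately show ?thesis by linarith
qed

lemma test_function_mollifier: "test_function (mollifier n)"
  unfolding mollifier_def[abs_def] divide_inverse
  by (intro test_function_mult1 test_function_scaled_bump smooth_intros(1)) simp

lemma mollifier_nonneg: "0 \<le> mollifier n z"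
  unfolding mollifier_def by (intro divide_nonneg_nonneg bump_nonneg less_imp_le scaled_bump_integral_pos)

lemma integral_mollifier: "(LINT z|lborel. mollifier n (z :: real ^ 'n::finite)) = 1"
  using scaled_bump_integral_pos[where ?'n = 'n, of n] unfolding mollifier_def by simp

lemma mollifier_eq_0: "inverse (real (Suc n)) \<le> norm z \<Longrightarrow> mollifier n z = 0"
  unfolding mollifier_def by (subst bump_eq_0) (auto simp: field_simps simp del: of_nat_Suc)

lemma mollifier_eq_0': "1 \<le> norm z \<Longrightarrow> mollifier n z = 0"
  by (rule mollifier_eq_0) (use inverse_le_1_iff[of "real (Suc n)"] in linarith)

lemma continuous_mollifier: "continuous_on UNIV (mollifier n)"
  and bounded_support_mollifier: "bounded_support (mollifier n)"
  by (intro test_function_continuous test_function_bounded_support test_function_mollifier)+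

lemma measurable_mollifier [measurable]: "mollifier n \<in> borel_measurable borel"
  by (rule borel_measurable_continuous_onI[OF continuous_mollifier])

lemma integrable_mollifier: "integrable lborel (mollifier n)"
  by (intro integrable_continuous_bounded_support continuous_mollifier bounded_support_mollifier)

lemma mollifier_reflect:
  "integrable lborel (\<lambda>y. mollifier n (x - y))" "(LINT y|lborel. mollifier n (x - y)) = 1"
  using integrable_mollifier[of n] integral_mollifier[of n] by (simp_all add: lborel_integral_reflect)

abbreviation mollify :: "nat \<Rightarrow> (real ^ 'n::finite \<Rightarrow> real) \<Rightarrow> real ^ 'n \<Rightarrow> real" where
  "mollify n f \<equiv> conv f (mollifier n)"

lemma integrable_mollify: "locally_integrable f \<Longrightarrow> integrable lborel (\<lambda>y. f y * mollifier n (x - y))"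
  by (intro integrable_conv continuous_mollifier bounded_support_mollifier)

lemma smooth_mollify: "locally_integrable f \<Longrightarrow> smooth (mollify n f)"
  by (intro smooth_conv test_function_mollifier)

lemma measurable_mollify: "locally_integrable f \<Longrightarrow> mollify n f \<in> borel_measurable borel"
  by (intro borel_measurable_continuous_onI smooth_continuous smooth_mollify)

lemma mollify_diff:
  "locally_integrable f \<Longrightarrow> locally_integrable g \<Longrightarrow>
    mollify n (\<lambda>x. f x - g x) x = mollify n f x - mollify n g x"
  using integrable_mollify[of f n x] integrable_mollify[of g n x]
  by (simp add: conv_def left_diff_distrib)

text \<open>Jensen's inequality for the square: the variance of \<open>f\<close> about its mean
  \<open>m\<close>, with respect to the density \<open>mollifier n (x - y)\<close>, is
  nonnegative.\<close>

lemma square_mollify_le: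
  assumes f: "square_integrable f"
  shows "(mollify n f x)\<^sup>2 \<le> (LINT y|lborel. (f y)\<^sup>2 * mollifier n (x - y))"
    and "integrable lborel (\<lambda>y. (f y)\<^sup>2 * mollifier n (x - y))"
proof -
  define m where "m = mollify n f x"
  have I1: "integrable lborel (\<lambda>y. f y * mollifier n (x - y))"
    by (rule integrable_mollify[OF square_integrable_locally_integrable[OF f]])
  have "locally_integrable (\<lambda>y. (f y)\<^sup>2)"
    using f integrable_real_mult_indicator[of "cball 0 _" lborel "\<lambda>x. (f x)\<^sup>2"]
    unfolding locally_integrable_def square_integrable_def by (auto simp: mult.commute)
  then show I2: "integrable lborel (\<lambda>y. (f y)\<^sup>2 * mollifier n (x - y))"
    by (rule integrable_mollify)
  have "0 \<le> (LINT y|lborel. (f y - m)\<^sup>2 * mollifier n (x - y))"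
    by (intro integral_nonneg_AE AE_I2 mult_nonneg_nonneg mollifier_nonneg) simp
  also have "\<dots> = (LINT y|lborel. (f y)\<^sup>2 * mollifier n (x - y) - 2 * m * (f y * mollifier n (x - y)) + m\<^sup>2 * mollifier n (x - y))"
    by (intro Bochner_Integration.integral_cong) (auto simp: power2_eq_square algebra_simps)
  also have "\<dots> = (LINT y|lborel. (f y)\<^sup>2 * mollifier n (x - y)) - 2 * m * (LINT y|lborel. f y * mollifier n (x - y)) + m\<^sup>2"
    using I1 I2 mollifier_reflect[of n x] by simp
  also have "(LINT y|lborel. f y * mollifier n (x - y)) = m" by (simp add: m_def conv_def)
  finally show "(mollify n f x)\<^sup>2 \<le> (LINT y|lborel. (f y)\<^sup>2 * mollifier n (x - y))"
    by (simp add: m_def power2_eq_square)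
qed

text \<open>The Jensen bound is integrated in x and the order of integration exchanged; the inner
  integral of the mollifier is 1. Working with nonnegative integrals makes integrability a result of
  the computation.\<close>

lemma mollify_contraction:
  assumes f: "square_integrable f"
  shows "square_integrable (mollify n f)" "(LINT x|lborel. (mollify n f x)\<^sup>2) \<le> (LINT x|lborel. (f x)\<^sup>2)"
proof -
  have fm [measurable]: "f \<in> borel_measurable borel" using f by (rule square_integrable_measurable)
  have mm [measurable]: "mollify n f \<in> borel_measurable borel"
    by (rule measurable_mollify[OF square_integrable_locally_integrable[OF f]])
  have "(\<integral>\<^sup>+x. ennreal ((mollify n f x)\<^sup>2) \<partial>lborel) \<le> (\<integral>\<^sup>+x. (\<integral>\<^sup>+y. ennreal ((f y)\<^sup>2 * mollifier n (x - y)) \<partial>lborel) \<partial>lborel)"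
    using square_mollify_le[OF f]
    by (intro nn_integral_mono, subst nn_integral_eq_integral) (auto simp: mollifier_nonneg intro!: ennreal_leI)
  also have "\<dots> = (\<integral>\<^sup>+y. (\<integral>\<^sup>+x. ennreal ((f y)\<^sup>2 * mollifier n (x - y)) \<partial>lborel) \<partial>lborel)"
    by (rule lborel_pair.Fubini'[symmetric]) measurable
  also have "\<dots> = (\<integral>\<^sup>+y. ennreal ((f y)\<^sup>2) \<partial>lborel)"
  proof (intro nn_integral_cong)
    fix y :: "real ^ 'a"
    have i: "integrable lborel (\<lambda>x. mollifier n (x - y))" "(LINT x|lborel. mollifier n (x - y)) = 1"
      using lborel_integral_translate[OF measurable_mollifier, of n "- y"] integrable_mollifier[of n] integral_mollifier[of n]
      by auto
    have "(\<integral>\<^sup>+x. ennreal ((f y)\<^sup>2 * mollifier n (x - y)) \<partial>lborel) = ennreal (LINT x|lborel. (f y)\<^sup>2 * mollifier n (x - y))"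
      using i by (intro nn_integral_eq_integral) (auto simp: mollifier_nonneg)
    then show "(\<integral>\<^sup>+x. ennreal ((f y)\<^sup>2 * mollifier n (x - y)) \<partial>lborel) = ennreal ((f y)\<^sup>2)"
      using i by simp
  qed
  also have "\<dots> = ennreal (LINT y|lborel. (f y)\<^sup>2)"
    using f by (intro nn_integral_eq_integral) (auto simp: square_integrable_def)
  finally have le: "(\<integral>\<^sup>+x. ennreal ((mollify n f x)\<^sup>2) \<partial>lborel) \<le> ennreal (LINT y|lborel. (f y)\<^sup>2)" .
  then have "integrable lborel (\<lambda>x. (mollify n f x)\<^sup>2)"
    by (intro integrableI_bounded) (auto intro: le_less_trans)
  then show "square_integrable (mollify n f)" by (simp add: square_integrable_def mm)
  with le show "(LINT x|lborel. (mollify n f x)\<^sup>2) \<le> (LINT x|lborel. (f x)\<^sup>2)"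
    by (subst (asm) nn_integral_eq_integral) (auto simp: square_integrable_def)
qed

text \<open>Uniform continuity makes the pointwise error at most \<open>e\<close> everywhere, and
  the error lives in a ball of fixed volume \<open>V\<close>.\<close>

lemma mollify_continuous_tendsto_L2:
  fixes g :: "real ^ 'n::finite \<Rightarrow> real"
  assumes g: "continuous_on UNIV g" "bounded_support g"
  shows "(\<lambda>n. LINT x|lborel. (mollify n g x - g x)\<^sup>2) \<longlonglongrightarrow> 0"
proof (rule LIMSEQ_I)
  fix r :: real assume r: "0 < r"
  obtain R where R: "\<And>x. R < norm x \<Longrightarrow> g x = 0" using g(2) unfolding bounded_support_def by auto
  define V where "V = (LINT x|lborel. indicator (cball (0 :: real ^ 'n) (R + 1)) x :: real)"
  have V: "0 \<le> V" unfolding V_def by (intro integral_nonneg_AE) auto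
  \<comment> \<open>Chosen so that e^2 V < r; the summand 1 avoids division by zero and makes the
    inequality strict.\<close>
  define e where "e = sqrt (r / (V + 1))"
  have e: "0 < e" using r V by (simp add: e_def)
  have e2: "e\<^sup>2 * V < r"
  proof -
    have "e\<^sup>2 = r / (V + 1)" using r V by (simp add: e_def)
    then have "e\<^sup>2 * V + e\<^sup>2 = r" using V by (simp add: field_simps)
    moreover have "0 < e\<^sup>2" using e by simp
    ultimately show ?thesis by linarith
  qed
  obtain d where d: "0 < d" "\<And>x y. dist x y < d \<Longrightarrow> \<bar>g x - g y\<bar> < e"
    using continuous_bounded_support_uniformly_continuous[OF g e] by blast
  obtain N where N: "inverse (real (Suc N)) < d" using reals_Archimedean[OF d(1)] by blast
  have lg: "locally_integrable g" by (intro square_integrable_locally_integrable square_integrable_continuous g)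
  show "\<exists>no. \<forall>n\<ge>no. norm ((LINT x|lborel. (mollify n g x - g x)\<^sup>2) - 0) < r"
  proof (intro exI allI impI)
    fix n assume "N \<le> n"
    then have "inverse (real (Suc n)) \<le> inverse (real (Suc N))" by simp
    then have n: "inverse (real (Suc n)) < d" using N by linarith
    have small: "\<bar>mollify n g x - g x\<bar> \<le> e" for x
    proof -
      have "mollify n g x - g x = (LINT y|lborel. g y * mollifier n (x - y)) - (LINT y|lborel. g x * mollifier n (x - y))"
        using mollifier_reflect[of n x] by (simp add: conv_def)
      also have "\<dots> = (LINT y|lborel. g y * mollifier n (x - y) - g x * mollifier n (x - y))"
        using integrable_mollify[OF lg, of n x] mollifier_reflect[of n x] by simp
      also have "\<bar>\<dots>\<bar> \<le> (LINT y|lborel. e * mollifier n (x - y))"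
      proof (rule abs_integral_le_integral)
        show "integrable lborel (\<lambda>y. e * mollifier n (x - y))" using mollifier_reflect[of n x] by simp
        fix y
        show "\<bar>g y * mollifier n (x - y) - g x * mollifier n (x - y)\<bar> \<le> e * mollifier n (x - y)"
        proof (cases "norm (x - y) < inverse (real (Suc n))")
          case True
          then have "\<bar>g y - g x\<bar> \<le> e" using d(2)[of y x] n by (simp add: dist_norm norm_minus_commute)
          then have "\<bar>g y - g x\<bar> * mollifier n (x - y) \<le> e * mollifier n (x - y)"
            by (intro mult_right_mono mollifier_nonneg)
          then show ?thesis
            using mollifier_nonneg[of n "x - y"] by (simp add: left_diff_distrib[symmetric] abs_mult)
        next
          case False
          then show ?thesis by (simp add: mollifier_eq_0)
        qed
      qed
      also have "\<dots> = e" using mollifier_reflect[of n x] by simp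
      finally show ?thesis .
    qed
    have zero: "mollify n g x - g x = 0" if x: "R + 1 < norm x" for x
    proof -
      have "g y * mollifier n (x - y) = 0" for y
      proof (cases "R < norm y")
        case False
        have "norm x \<le> norm (x - y) + norm y" using norm_triangle_ineq[of "x - y" y] by simp
        then show ?thesis using False x by (simp add: mollifier_eq_0')
      qed (simp add: R)
      then have "mollify n g x = 0" unfolding conv_def by (simp only: Bochner_Integration.integral_zero)
      then show ?thesis using R[of x] x by simp
    qed
    have "(LINT x|lborel. (mollify n g x - g x)\<^sup>2) \<le> (LINT x|lborel. e\<^sup>2 * indicator (cball (0 :: real ^ 'n) (R + 1)) x)"
    proof -
      have "\<bar>LINT x|lborel. (mollify n g x - g x)\<^sup>2\<bar> \<le> (LINT x|lborel. e\<^sup>2 * indicator (cball (0 :: real ^ 'n) (R + 1)) x)"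
      proof (rule abs_integral_le_integral)
        show "integrable lborel (\<lambda>x. e\<^sup>2 * indicator (cball (0 :: real ^ 'n) (R + 1)) x)"
          using integrable_indicator_cball[of "0 :: real ^ 'n" "R + 1"] by simp
        fix x
        show "\<bar>(mollify n g x - g x)\<^sup>2\<bar> \<le> e\<^sup>2 * indicator (cball (0 :: real ^ 'n) (R + 1)) x"
          using zero[of x] power_mono[OF small[of x], of 2] by (cases "norm x \<le> R + 1") auto
      qed
      then show ?thesis by simp
    qed
    also have "\<dots> = e\<^sup>2 * V" by (simp add: V_def)
    also have "\<dots> < r" by (rule e2)
    finally have "(LINT x|lborel. (mollify n g x - g x)\<^sup>2) < r" .
    moreover have "0 \<le> (LINT x|lborel. (mollify n g x - g x)\<^sup>2)" by (intro integral_nonneg_AE) auto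
    ultimately show "norm ((LINT x|lborel. (mollify n g x - g x)\<^sup>2) - 0) < r" by simp
  qed
qed

text \<open>Density and contraction: \<open>f\<close> is replaced by a continuous \<open>g\<close>
  of bounded support, and mollifying g - f does not enlarge its L2 norm.\<close>

lemma mollify_tendsto_L2:
  fixes f :: "real ^ 'n::finite \<Rightarrow> real"
  assumes f: "square_integrable f"
  shows "tendsto_L2 (\<lambda>n. mollify n f) f"
  unfolding tendsto_L2_def
proof (intro conjI allI f mollify_contraction(1) LIMSEQ_I)
  fix r :: real assume r: "0 < r"
  \<comment> \<open>The square of a sum of three terms is at most three times the sum of the
    squares, and 3 (r/12 + r/6 + r/12) = r.\<close>
  then have "0 < r / 12" by simp
  from square_integrable_approx[OF f this] obtain g where
    g: "continuous_on UNIV g" "bounded_support g" "(LINT x|lborel. (g x - f x)\<^sup>2) < r / 12" by blast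
  have sg: "square_integrable g" by (intro square_integrable_continuous g)
  have dgf: "square_integrable (\<lambda>x. g x - f x)" by (intro square_integrable_diff sg f)
  from LIMSEQ_D[OF mollify_continuous_tendsto_L2[OF g(1,2)], of "r / 6"] r obtain N where
    N: "\<And>n. N \<le> n \<Longrightarrow> norm ((LINT x|lborel. (mollify n g x - g x)\<^sup>2) - 0) < r / 6" by auto
  show "\<exists>no. \<forall>n\<ge>no. norm ((LINT x|lborel. (mollify n f x - f x)\<^sup>2) - 0) < r"
  proof (intro exI allI impI)
    fix n assume n: "N \<le> n"
    let ?d = "\<lambda>x. mollify n (\<lambda>x. g x - f x) x"
    have sd: "square_integrable ?d" "square_integrable (\<lambda>x. mollify n g x - g x)"
      "square_integrable (\<lambda>x. mollify n f x - f x)"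
      by (intro mollify_contraction dgf square_integrable_diff sg f)+
    have "(LINT x|lborel. (mollify n f x - f x)\<^sup>2)
       \<le> (LINT x|lborel. 3 * (?d x)\<^sup>2 + 3 * (mollify n g x - g x)\<^sup>2 + 3 * (g x - f x)\<^sup>2)"
    proof (rule integral_mono)
      fix x
      have "mollify n f x - f x = (mollify n g x - g x) + (g x - f x) - ?d x"
        using mollify_diff[of g f n x] sg f by (simp add: square_integrable_locally_integrable)
      moreover have "(a + b - c)\<^sup>2 \<le> 3 * c\<^sup>2 + 3 * a\<^sup>2 + 3 * b\<^sup>2" for a b c :: real
      proof -
        have "0 \<le> (a - b)\<^sup>2 + (a + c)\<^sup>2 + (b + c)\<^sup>2" by simp
        then show ?thesis by (simp add: power2_eq_square algebra_simps)
      qed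
      ultimately show "(mollify n f x - f x)\<^sup>2 \<le> 3 * (?d x)\<^sup>2 + 3 * (mollify n g x - g x)\<^sup>2 + 3 * (g x - f x)\<^sup>2"
        by metis
    qed (use sd dgf in \<open>simp_all add: square_integrable_def\<close>)
    also have "\<dots> = 3 * (LINT x|lborel. (?d x)\<^sup>2) + 3 * (LINT x|lborel. (mollify n g x - g x)\<^sup>2) + 3 * (LINT x|lborel. (g x - f x)\<^sup>2)"
      using sd dgf by (simp add: square_integrable_def)
    also have "\<dots> < r" using g(3) N[OF n] mollify_contraction(2)[OF dgf, of n] by simp
    finally have "(LINT x|lborel. (mollify n f x - f x)\<^sup>2) < r" .
    moreover have "0 \<le> (LINT x|lborel. (mollify n f x - f x)\<^sup>2)" by (intro integral_nonneg_AE) auto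
    ultimately show "norm ((LINT x|lborel. (mollify n f x - f x)\<^sup>2) - 0) < r" by simp
  qed
qed

section \<open>Mollification on balls\<close>

lemma tendsto_L2_bounded_mult:
  assumes "tendsto_L2 a b" "\<phi> \<in> borel_measurable borel" "\<And>x. \<bar>\<phi> x\<bar> \<le> C"
  shows "tendsto_L2 (\<lambda>n x. \<phi> x * a n x) (\<lambda>x. \<phi> x * b x)"
proof -
  have s: "square_integrable b" "\<And>n. square_integrable (a n)"
    and l: "(\<lambda>n. LINT x|lborel. (a n x - b x)\<^sup>2) \<longlonglongrightarrow> 0"
    using assms(1) by (auto simp: tendsto_L2_def)
  have [measurable]: "\<phi> \<in> borel_measurable borel" "b \<in> borel_measurable borel" "\<And>n. a n \<in> borel_measurable borel"
    using assms(2) s by (auto intro: square_integrable_measurable)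
  have b: "square_integrable (\<lambda>x. \<phi> x * f x)" if "square_integrable f" for f
    by (rule square_integrable_bound[OF that, of _ C])
       (use assms square_integrable_measurable[OF that] in \<open>auto simp: abs_mult mult_right_mono\<close>)
  have "(\<lambda>n. LINT x|lborel. (\<phi> x * a n x - \<phi> x * b x)\<^sup>2) \<longlonglongrightarrow> 0"
  proof (rule integral_tendsto_zero_mono[where g = "\<lambda>n x. C\<^sup>2 * (a n x - b x)\<^sup>2"])
    show "(\<lambda>n. LINT x|lborel. C\<^sup>2 * (a n x - b x)\<^sup>2) \<longlonglongrightarrow> 0"
      using tendsto_mult[OF tendsto_const[of "C\<^sup>2"] l] by simp
    show "integrable lborel (\<lambda>x. C\<^sup>2 * (a n x - b x)\<^sup>2)" for n
      using square_integrable_diff[OF s(2) s(1), of n] by (simp add: square_integrable_def)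
    show "(\<phi> x * a n x - \<phi> x * b x)\<^sup>2 \<le> C\<^sup>2 * (a n x - b x)\<^sup>2" for n x
    proof -
      have "(\<phi> x)\<^sup>2 \<le> C\<^sup>2" using power_mono[OF assms(3)[of x], of 2] by simp
      then show ?thesis
        by (simp add: right_diff_distrib[symmetric] power_mult_distrib mult_right_mono)
    qed
  qed auto
  then show ?thesis using b s by (simp add: tendsto_L2_def)
qed

definition locally_square_integrable :: "('a::euclidean_space \<Rightarrow> real) \<Rightarrow> bool" where
  "locally_square_integrable f \<longleftrightarrow> f \<in> borel_measurable borel \<and>
     (\<forall>R. square_integrable (\<lambda>x. indicator (cball 0 R) x * f x))"

lemma locally_square_integrable_locally_integrable:
  assumes "locally_square_integrable f"
  shows "locally_integrable f"
  unfolding locally_integrable_def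
proof (intro conjI allI)
  show "f \<in> borel_measurable borel" using assms by (simp add: locally_square_integrable_def)
  fix R
  have "square_integrable (\<lambda>x. indicator (cball 0 R) x * f x)"
    using assms by (simp add: locally_square_integrable_def)
  from square_integrable_mult_integrable[OF square_integrable_indicator_cball[of 0 R] this]
  show "integrable lborel (\<lambda>x. indicator (cball 0 R) x * f x)"
    by (simp add: mult.assoc[symmetric] indicator_inter_arith[symmetric])
qed

text \<open>The mollifier sees only points at distance below 1, so cutting \<open>f\<close> off at
  radius R + 1 is invisible on the ball of radius R. This turns the global L2 theorem into a local
  one.\<close>

lemma mollify_indicator:
  assumes "norm x \<le> R"
  shows "mollify n (\<lambda>y. indicator (cball 0 (R + 1)) y * f y) x = mollify n f x"
  unfolding conv_def
proof (intro Bochner_Integration.integral_cong refl)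
  fix y
  show "indicator (cball 0 (R + 1)) y * f y * mollifier n (x - y) = f y * mollifier n (x - y)"
  proof (cases "norm y \<le> R + 1")
    case False
    have "norm y \<le> norm (x - y) + norm x" using norm_triangle_ineq4[of x "x - y"] by simp
    then have "mollifier n (x - y) = 0" using False assms by (intro mollifier_eq_0') simp
    then show ?thesis by simp
  qed simp
qed

lemma mollify_tendsto_L2_local:
  assumes f: "locally_square_integrable f"
  shows "tendsto_L2 (\<lambda>n x. indicator (cball 0 R) x * mollify n f x) (\<lambda>x. indicator (cball 0 R) x * f x)"
proof -
  let ?f = "\<lambda>x. indicator (cball 0 (R + 1)) x * f x"
  have "square_integrable ?f" using f by (simp add: locally_square_integrable_def)
  then have "tendsto_L2 (\<lambda>n x. indicator (cball 0 R) x * mollify n ?f x) (\<lambda>x. indicator (cball 0 R) x * ?f x)"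
    by (intro tendsto_L2_bounded_mult[where C = 1] mollify_tendsto_L2) (auto simp: indicator_def)
  moreover have "(\<lambda>n x. indicator (cball 0 R) x * mollify n ?f x) = (\<lambda>n x. indicator (cball 0 R) x * mollify n f x)"
    by (auto simp: fun_eq_iff indicator_def[of "cball 0 R"] mollify_indicator)
  moreover have "(\<lambda>x. indicator (cball 0 R) x * ?f x) = (\<lambda>x. indicator (cball 0 R) x * f x)"
    by (auto simp: fun_eq_iff indicator_def)
  ultimately show ?thesis by simp
qed

text \<open>An average cannot exceed an essential bound. The result holds at every point and
  uniformly in n, so all mollifications take values in one fixed compact set.\<close>

lemma mollify_bound:
  assumes f: "locally_integrable f" and C: "AE y in lborel. y \<in> cball 0 (R + 1) \<longrightarrow> \<bar>f y\<bar> \<le> C"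
    and x: "norm x \<le> R"
  shows "\<bar>mollify n f x\<bar> \<le> C"
proof -
  have "\<bar>mollify n f x\<bar> \<le> (LINT y|lborel. \<bar>f y * mollifier n (x - y)\<bar>)"
    unfolding conv_def by (rule integral_abs_bound)
  also have "\<dots> \<le> (LINT y|lborel. C * mollifier n (x - y))"
  proof (rule integral_mono_AE)
    show "integrable lborel (\<lambda>y. \<bar>f y * mollifier n (x - y)\<bar>)"
      by (intro integrable_abs integrable_mollify f)
    show "integrable lborel (\<lambda>y. C * mollifier n (x - y))" using mollifier_reflect[of n x] by simp
    show "AE y in lborel. \<bar>f y * mollifier n (x - y)\<bar> \<le> C * mollifier n (x - y)"
      using C
    proof eventually_elim
      case (elim y)
      show ?case
      proof (cases "norm y \<le> R + 1")
        case True
        then show ?thesis using elim mollifier_nonneg[of n "x - y"] by (simp add: abs_mult mult_right_mono)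
      next
        case False
        have "norm y \<le> norm (x - y) + norm x" using norm_triangle_ineq4[of x "x - y"] by simp
        then have "mollifier n (x - y) = 0" using False x by (intro mollifier_eq_0') simp
        then show ?thesis by simp
      qed
    qed
  qed
  also have "\<dots> = C" using mollifier_reflect[of n x] by simp
  finally show ?thesis .
qed

subsection \<open>The Pohozaev identity for weak solutions\<close>

lemma partial_smooth_simps:
  fixes f g :: "real ^ 'n::finite \<Rightarrow> real"
  assumes "smooth f" "smooth g"
  shows "partial j (\<lambda>x. f x + g x) = (\<lambda>x. partial j f x + partial j g x)"
    "partial j (\<lambda>x. f x - g x) = (\<lambda>x. partial j f x - partial j g x)"
    "partial j (\<lambda>x. f x * g x) = (\<lambda>x. partial j f x * g x + f x * partial j g x)"
    "partial j (\<lambda>x. c * f x) = (\<lambda>x. c * partial j f x)"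
  using smooth_differentiable[OF assms(1)] smooth_differentiable[OF assms(2)]
  by (simp_all add: partial_add partial_diff partial_mult partial_cmult)

lemma partial_sum_smooth:
  assumes "\<And>i. i \<in> I \<Longrightarrow> smooth (h i)"
  shows "partial j (\<lambda>x. \<Sum>i\<in>I. h i x) = (\<lambda>x. \<Sum>i\<in>I. partial j (h i) x)"
  by (rule partial_sum) (rule smooth_C_k[OF assms])

lemma integrable_test_function:
  "test_function \<phi> \<Longrightarrow> integrable lborel \<phi>"
  by (intro integrable_continuous_bounded_support test_function_continuous test_function_bounded_support)

lemma integral_partial_test_function: "test_function \<phi> \<Longrightarrow> (LINT x|lborel. partial j \<phi> x) = 0"
  using integral_partial_eq_0 test_function_C_1 by blast

text \<open>Integral of the divergence of F = (X . grad v) grad v - (1/2) |grad v|^2 X. The second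
  derivatives of \<open>v\<close> along X cancel between the two parts, leaving the terms with
  derivatives of X and the term with the Laplacian.\<close>

lemma pohozaev_smooth:
  fixes v :: "real ^ 'n::finite \<Rightarrow> real" and X :: "'n \<Rightarrow> real ^ 'n \<Rightarrow> real"
  assumes v: "smooth v" and X: "\<And>i. test_function (X i)"
  shows "(\<Sum>i\<in>UNIV. \<Sum>j\<in>UNIV. LINT x|lborel. partial i v x * partial j v x * partial j (X i) x)
     - 1 / 2 * (\<Sum>k\<in>UNIV. \<Sum>i\<in>UNIV. LINT x|lborel. partial k v x * partial k v x * partial i (X i) x)
     = - (\<Sum>i\<in>UNIV. LINT x|lborel. laplacian v x * partial i v x * X i x)"
proof -
  define p where "p i = partial i v" for i
  define P where "P j i = partial j (p i)" for i j
  define Y where "Y j i = partial j (X i)" for i j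
  have sp: "smooth (p i)" "smooth (P j i)" for i j by (simp_all add: p_def P_def v smooth_partial)
  have sX: "smooth (X i)" for i by (rule test_function_smooth[OF X])
  have tY: "test_function (Y j i)" for i j by (simp add: Y_def X test_function_partial)
  have sym: "P i j x = P j i x" for i j x
    unfolding P_def p_def by (rule partial_commute[OF smooth_C_k[OF v]])
  define F where "F j x = (\<Sum>i\<in>UNIV. X i x * p i x) * p j x - 1 / 2 * (X j x * (\<Sum>k\<in>UNIV. p k x * p k x))" for j x
  have sS: "smooth (\<lambda>x. \<Sum>i\<in>UNIV. X i x * p i x)" "smooth (\<lambda>x. \<Sum>k\<in>UNIV. p k x * p k x)"
    by (intro smooth_intros(5,6) sX sp)+
  have tF: "test_function (F j)" for j
  proof -
    have "test_function (\<lambda>x. (\<Sum>i\<in>UNIV. X i x * p i x) * p j x + (- 1 / 2) * (X j x * (\<Sum>k\<in>UNIV. p k x * p k x)))"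
      unfolding test_function_iff
      by (intro conjI smooth_intros(1,3,5) bounded_support_add bounded_support_mult1[OF bounded_support_sum]
          bounded_support_mult2[OF bounded_support_mult1] bounded_support_mult1 sS sp sX test_function_bounded_support[OF X])
    then show ?thesis by (simp add: F_def[abs_def])
  qed
  have dF: "partial j (F j) = (\<lambda>x. (\<Sum>i\<in>UNIV. Y j i x * p i x + X i x * P j i x) * p j x
      + (\<Sum>i\<in>UNIV. X i x * p i x) * P j j x
      - 1 / 2 * (Y j j x * (\<Sum>k\<in>UNIV. p k x * p k x) + X j x * (\<Sum>k\<in>UNIV. P j k x * p k x + p k x * P j k x)))" for j
    unfolding F_def[abs_def]
    by (subst partial_smooth_simps(2) partial_smooth_simps(3) partial_smooth_simps(4) partial_sum_smooth,
        (intro smooth_intros(1,5,6) sX sp sS)+)+ (simp add: Y_def P_def)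
  have eq: "(\<Sum>j\<in>UNIV. partial j (F j) x)
     = (\<Sum>i\<in>UNIV. \<Sum>j\<in>UNIV. p i x * p j x * Y j i x)
       - 1 / 2 * (\<Sum>k\<in>UNIV. \<Sum>i\<in>UNIV. p k x * p k x * Y i i x)
       + (\<Sum>i\<in>UNIV. laplacian v x * p i x * X i x)" for x
  proof -
    have A: "(\<Sum>j\<in>UNIV. (\<Sum>i\<in>UNIV. Y j i x * p i x) * p j x) = (\<Sum>i\<in>UNIV. \<Sum>j\<in>UNIV. p i x * p j x * Y j i x)"
      unfolding sum_distrib_right by (subst sum.swap) (simp add: ac_simps)
    \<comment> \<open>This is the cancellation: symmetry of the Hessian turns the contribution of
      the first part into half the derivative of |grad v|^2 along X.\<close>
    have B: "(\<Sum>j\<in>UNIV. (\<Sum>i\<in>UNIV. X i x * P j i x) * p j x) = (\<Sum>j\<in>UNIV. X j x * (\<Sum>k\<in>UNIV. P j k x * p k x))"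
      unfolding sum_distrib_right sum_distrib_left by (subst sum.swap) (simp add: ac_simps sym)
    have C: "(\<Sum>j\<in>UNIV. (\<Sum>i\<in>UNIV. X i x * p i x) * P j j x) = (\<Sum>i\<in>UNIV. laplacian v x * p i x * X i x)"
      unfolding laplacian_def P_def p_def sum_distrib_right sum_distrib_left by (subst sum.swap) (simp add: ac_simps)
    have D: "(\<Sum>j\<in>UNIV. Y j j x * (\<Sum>k\<in>UNIV. p k x * p k x)) = (\<Sum>k\<in>UNIV. \<Sum>i\<in>UNIV. p k x * p k x * Y i i x)"
      unfolding sum_distrib_left by (subst sum.swap) (simp add: ac_simps)
    have "(\<Sum>j\<in>UNIV. partial j (F j) x) = (\<Sum>j\<in>UNIV. (\<Sum>i\<in>UNIV. Y j i x * p i x) * p j x + (\<Sum>i\<in>UNIV. X i x * P j i x) * p j x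
      + (\<Sum>i\<in>UNIV. X i x * p i x) * P j j x
      - 1 / 2 * (Y j j x * (\<Sum>k\<in>UNIV. p k x * p k x)) - X j x * (\<Sum>k\<in>UNIV. P j k x * p k x))"
    proof (rule sum.cong[OF refl])
      fix j
      have "(\<Sum>k\<in>UNIV. P j k x * p k x + p k x * P j k x) = 2 * (\<Sum>k\<in>UNIV. P j k x * p k x)"
        by (simp add: sum_distrib_left mult.commute)
      then show "partial j (F j) x = (\<Sum>i\<in>UNIV. Y j i x * p i x) * p j x + (\<Sum>i\<in>UNIV. X i x * P j i x) * p j x
      + (\<Sum>i\<in>UNIV. X i x * p i x) * P j j x
      - 1 / 2 * (Y j j x * (\<Sum>k\<in>UNIV. p k x * p k x)) - X j x * (\<Sum>k\<in>UNIV. P j k x * p k x)"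
        unfolding dF by (simp add: sum.distrib algebra_simps)
    qed
    also have "\<dots> = (\<Sum>j\<in>UNIV. (\<Sum>i\<in>UNIV. Y j i x * p i x) * p j x) + (\<Sum>j\<in>UNIV. (\<Sum>i\<in>UNIV. X i x * P j i x) * p j x)
      + (\<Sum>j\<in>UNIV. (\<Sum>i\<in>UNIV. X i x * p i x) * P j j x)
      - 1 / 2 * (\<Sum>j\<in>UNIV. Y j j x * (\<Sum>k\<in>UNIV. p k x * p k x)) - (\<Sum>j\<in>UNIV. X j x * (\<Sum>k\<in>UNIV. P j k x * p k x))"
      by (simp only: sum.distrib sum_subtractf sum_distrib_left[of "1 / 2"])
    also have "\<dots> = (\<Sum>i\<in>UNIV. \<Sum>j\<in>UNIV. p i x * p j x * Y j i x)
       - 1 / 2 * (\<Sum>k\<in>UNIV. \<Sum>i\<in>UNIV. p k x * p k x * Y i i x)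
       + (\<Sum>i\<in>UNIV. laplacian v x * p i x * X i x)"
      unfolding A B C D by simp
    finally show ?thesis .
  qed
  have I1: "integrable lborel (\<lambda>x. p i x * p j x * Y l k x)" for i j k l
    by (intro integrable_test_function test_function_mult2 tY smooth_intros(5) sp)
  have sl: "smooth (laplacian v)" unfolding laplacian_def[abs_def] by (intro smooth_intros(6) smooth_partial v)
  have I2: "integrable lborel (\<lambda>x. laplacian v x * p i x * X i x)" for i
    by (intro integrable_test_function test_function_mult2 X smooth_intros(5) sp sl)
  have "0 = (\<Sum>j\<in>UNIV. LINT x|lborel. partial j (F j) x)"
    using integral_partial_test_function[OF tF] by simp
  also have "\<dots> = (LINT x|lborel. (\<Sum>j\<in>UNIV. partial j (F j) x))"
    by (intro Bochner_Integration.integral_sum[symmetric] integrable_test_function test_function_partial tF)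
  also have "\<dots> = (LINT x|lborel. (\<Sum>i\<in>UNIV. \<Sum>j\<in>UNIV. p i x * p j x * Y j i x)
       - 1 / 2 * (\<Sum>k\<in>UNIV. \<Sum>i\<in>UNIV. p k x * p k x * Y i i x)
       + (\<Sum>i\<in>UNIV. laplacian v x * p i x * X i x))"
    by (simp only: eq)
  also have "\<dots> = (\<Sum>i\<in>UNIV. \<Sum>j\<in>UNIV. LINT x|lborel. p i x * p j x * Y j i x)
       - 1 / 2 * (\<Sum>k\<in>UNIV. \<Sum>i\<in>UNIV. LINT x|lborel. p k x * p k x * Y i i x)
       + (\<Sum>i\<in>UNIV. LINT x|lborel. laplacian v x * p i x * X i x)"
    using I1 I2 by simp
  finally show ?thesis by (simp add: p_def Y_def)
qed

text \<open>The weak identity is tested with the reflected mollifier centred at x. The sign from the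
  reflection cancels the one in the definition of the weak derivative, and the result is a pointwise
  identity of smooth functions.\<close>

lemma mollify_weak_partial:
  assumes f: "locally_integrable f"
    and w: "\<And>\<phi>. test_function \<phi> \<Longrightarrow> (LINT x|lborel. f x * partial j \<phi> x) = - (LINT x|lborel. g x * \<phi> x)"
  shows "partial j (mollify n f) = mollify n g"
proof
  fix x
  have t: "test_function (mollifier n)" by (rule test_function_mollifier)
  have "(LINT y|lborel. f y * - partial j (mollifier n) (x - y)) = - (LINT y|lborel. g y * mollifier n (x - y))"
    using w[OF test_function_reflect[OF t, of x]] by (simp add: partial_reflect test_function_smooth t)
  then show "partial j (mollify n f) x = mollify n g x"
    unfolding partial_conv_test_function[OF f t] by (simp add: conv_def)
qed

lemma mollify_weak_laplacian:
  assumes f: "locally_integrable f"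
    and w: "\<And>\<phi>. test_function \<phi> \<Longrightarrow> (LINT x|lborel. f x * laplacian \<phi> x) = (LINT x|lborel. g x * \<phi> x)"
  shows "laplacian (mollify n f) = mollify n g"
proof
  fix x
  have t: "test_function (mollifier n)" by (rule test_function_mollifier)
  have "(LINT y|lborel. f y * laplacian (mollifier n) (x - y)) = (LINT y|lborel. g y * mollifier n (x - y))"
    using w[OF test_function_reflect[OF t, of x]] by (simp add: laplacian_reflect test_function_smooth t)
  then show "laplacian (mollify n f) x = mollify n g x"
    unfolding laplacian_conv[OF f t] by (simp add: conv_def)
qed

lemma test_function_bounded:
  assumes "test_function \<phi>"
  obtains C where "0 < C" "\<And>x. \<bar>\<phi> x\<bar> \<le> C"
  using continuous_bounded_support_bounded test_function_continuous test_function_bounded_support assms by blast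

lemma test_function_measurable: "test_function \<phi> \<Longrightarrow> \<phi> \<in> borel_measurable borel"
  by (intro borel_measurable_continuous_onI test_function_continuous)

text \<open>The smooth identity holds for each mollification of \<open>f\<close>, whose gradient and
  Laplacian are the mollifications of \<open>Df\<close> and \<open>h\<close>. Every term is a
  product of two strongly convergent factors and a bounded weight.\<close>

lemma pohozaev_weak:
  fixes f :: "real ^ 'n::finite \<Rightarrow> real" and X :: "'n \<Rightarrow> real ^ 'n \<Rightarrow> real"
  assumes f: "locally_integrable f" and Df: "\<And>j. square_integrable (Df j)" and h: "locally_square_integrable h"
    and wp: "\<And>j \<phi>. test_function \<phi> \<Longrightarrow> (LINT x|lborel. f x * partial j \<phi> x) = - (LINT x|lborel. Df j x * \<phi> x)"
    and wl: "\<And>\<phi>. test_function \<phi> \<Longrightarrow> (LINT x|lborel. f x * laplacian \<phi> x) = (LINT x|lborel. h x * \<phi> x)"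
    and X: "\<And>i. test_function (X i)"
  shows "(\<Sum>i\<in>UNIV. \<Sum>j\<in>UNIV. LINT x|lborel. Df i x * Df j x * partial j (X i) x)
     - 1 / 2 * (\<Sum>k\<in>UNIV. \<Sum>i\<in>UNIV. LINT x|lborel. Df k x * Df k x * partial i (X i) x)
     = - (\<Sum>i\<in>UNIV. LINT x|lborel. h x * Df i x * X i x)"
proof -
  have eq: "(\<Sum>i\<in>UNIV. \<Sum>j\<in>UNIV. LINT x|lborel. mollify n (Df i) x * mollify n (Df j) x * partial j (X i) x)
     - 1 / 2 * (\<Sum>k\<in>UNIV. \<Sum>i\<in>UNIV. LINT x|lborel. mollify n (Df k) x * mollify n (Df k) x * partial i (X i) x)
     = - (\<Sum>i\<in>UNIV. LINT x|lborel. mollify n h x * mollify n (Df i) x * X i x)" for n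
    using pohozaev_smooth[OF smooth_mollify[OF f] X, of n]
    by (simp only: mollify_weak_partial[OF f wp] mollify_weak_laplacian[OF f wl])
  have l1: "(\<lambda>n. LINT x|lborel. mollify n (Df i) x * mollify n (Df j) x * partial k (X l) x)
      \<longlonglongrightarrow> (LINT x|lborel. Df i x * Df j x * partial k (X l) x)" for i j k l
  proof -
    obtain C where C: "\<And>x. \<bar>partial k (X l) x\<bar> \<le> C"
      using test_function_bounded[OF test_function_partial[OF X]] by blast
    show ?thesis
      by (rule tendsto_L2_mult[OF mollify_tendsto_L2 mollify_tendsto_L2 _ C])
         (auto intro!: Df test_function_measurable test_function_partial X)
  qed
  have l2: "(\<lambda>n. LINT x|lborel. mollify n h x * mollify n (Df i) x * X i x)
      \<longlonglongrightarrow> (LINT x|lborel. h x * Df i x * X i x)" for i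
  proof -
    obtain C where C: "\<And>x. \<bar>X i x\<bar> \<le> C"
      using test_function_bounded[OF X] by blast
    obtain R where R: "\<And>x. R < norm x \<Longrightarrow> X i x = 0"
      using test_function_bounded_support[OF X] unfolding bounded_support_def by blast
    \<comment> \<open>Since \<open>h\<close> is only locally square integrable, an indicator of a
      ball containing the support of X is inserted; it does not change the product.\<close>
    have e: "indicator (cball 0 R) x * a * b * X i x = a * b * X i x" for a b x
      using R[of x] by (cases "norm x \<le> R") auto
    have "(\<lambda>n. LINT x|lborel. (indicator (cball 0 R) x * mollify n h x) * mollify n (Df i) x * X i x)
       \<longlonglongrightarrow> (LINT x|lborel. (indicator (cball 0 R) x * h x) * Df i x * X i x)"
      by (rule tendsto_L2_mult[OF mollify_tendsto_L2_local[OF h] mollify_tendsto_L2 _ C])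
         (auto intro!: Df test_function_measurable X)
    then show ?thesis by (simp only: e)
  qed
  have "(\<lambda>n. (\<Sum>i\<in>UNIV. \<Sum>j\<in>UNIV. LINT x|lborel. mollify n (Df i) x * mollify n (Df j) x * partial j (X i) x)
     - 1 / 2 * (\<Sum>k\<in>UNIV. \<Sum>i\<in>UNIV. LINT x|lborel. mollify n (Df k) x * mollify n (Df k) x * partial i (X i) x))
    \<longlonglongrightarrow> (\<Sum>i\<in>UNIV. \<Sum>j\<in>UNIV. LINT x|lborel. Df i x * Df j x * partial j (X i) x)
     - 1 / 2 * (\<Sum>k\<in>UNIV. \<Sum>i\<in>UNIV. LINT x|lborel. Df k x * Df k x * partial i (X i) x)"
    by (intro tendsto_diff tendsto_mult tendsto_const tendsto_sum l1)
  moreover have "(\<lambda>n. - (\<Sum>i\<in>UNIV. LINT x|lborel. mollify n h x * mollify n (Df i) x * X i x))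
     \<longlonglongrightarrow> - (\<Sum>i\<in>UNIV. LINT x|lborel. h x * Df i x * X i x)"
    by (intro tendsto_minus tendsto_sum l2)
  ultimately show ?thesis unfolding eq by (rule LIMSEQ_unique)
qed

section \<open>The nonlinear term\<close>

lemma C_1_lipschitz_cball:
  fixes G :: "real ^ 'm::finite \<Rightarrow> real"
  assumes "C_k 1 G"
  obtains L where "0 \<le> L" "\<And>y z. norm y \<le> K \<Longrightarrow> norm z \<le> K \<Longrightarrow> \<bar>G y - G z\<bar> \<le> L * norm (y - z)"
proof -
  have "\<exists>B\<ge>0. \<forall>x\<in>cball 0 K. \<bar>partial j G x\<bar> \<le> B" for j
  proof -
    have "compact (partial j G ` cball 0 K)"
      by (intro compact_continuous_image continuous_on_subset[OF C_1_continuous_partial[OF assms]]) auto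
    then have "bounded (partial j G ` cball 0 K)" by (rule compact_imp_bounded)
    then show ?thesis unfolding bounded_pos by (metis image_eqI less_imp_le real_norm_def)
  qed
  then obtain B where B: "\<And>j. 0 \<le> B j" "\<And>j x. x \<in> cball 0 K \<Longrightarrow> \<bar>partial j G x\<bar> \<le> B j" by metis
  show ?thesis
  proof (rule that[of "\<Sum>j\<in>UNIV. B j"])
    show "0 \<le> (\<Sum>j\<in>UNIV. B j)" using B by (simp add: sum_nonneg)
    fix y z :: "real ^ 'm" assume yz: "norm y \<le> K" "norm z \<le> K"
    obtain s where s: "0 < s" "s < 1" "G (z + (y - z)) - G z = (\<Sum>j\<in>UNIV. (y - z) $ j * partial j G (z + s *\<^sub>R (y - z)))"
      using C_1_mean_value[OF assms] by blast
    have "(1 - s) *\<^sub>R z + s *\<^sub>R y \<in> cball 0 K"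
      using yz s by (intro convexD[OF convex_cball]) auto
    then have m: "z + s *\<^sub>R (y - z) \<in> cball 0 K" by (simp add: algebra_simps)
    have "\<bar>G y - G z\<bar> = \<bar>\<Sum>j\<in>UNIV. (y - z) $ j * partial j G (z + s *\<^sub>R (y - z))\<bar>" using s(3) by simp
    also have "\<dots> \<le> (\<Sum>j\<in>UNIV. \<bar>(y - z) $ j * partial j G (z + s *\<^sub>R (y - z))\<bar>)" by (rule sum_abs)
    also have "\<dots> \<le> (\<Sum>j\<in>UNIV. norm (y - z) * B j)"
      unfolding abs_mult by (intro sum_mono mult_mono B m component_le_norm_cart) auto
    finally show "\<bar>G y - G z\<bar> \<le> (\<Sum>j\<in>UNIV. B j) * norm (y - z)"
      by (simp add: sum_distrib_right mult.commute)
  qed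
qed

lemma square_integrable_AE_bound:
  fixes f :: "'a::euclidean_space \<Rightarrow> real"
  assumes "f \<in> borel_measurable borel" "AE x in lborel. \<bar>f x\<bar> \<le> C * indicator (cball 0 R) x"
  shows "square_integrable f"
  unfolding square_integrable_def
proof (intro conjI assms(1), rule Bochner_Integration.integrable_bound)
  show "integrable lborel (\<lambda>x. C\<^sup>2 * indicator (cball (0 :: 'a) R) x :: real)"
    using integrable_indicator_cball[of "0 :: 'a" R] by simp
  show "(\<lambda>x. (f x)\<^sup>2) \<in> borel_measurable lborel" using assms(1) by measurable
  show "AE x in lborel. norm ((f x)\<^sup>2) \<le> norm (C\<^sup>2 * indicator (cball 0 R) x :: real)"
    using assms(2)
  proof eventually_elim
    case (elim x)
    have "\<bar>f x\<bar>\<^sup>2 \<le> (C * indicator (cball 0 R) x)\<^sup>2" using elim by (intro power_mono) auto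
    then show ?case by (cases "norm x \<le> R") (auto simp: power_mult_distrib)
  qed
qed

text \<open>All values lie in the ball of radius \<open>K\<close>, on which \<open>G\<close> is
  Lipschitz, so the squared distance of the compositions is at most L^2 times the sum of the squared
  componentwise distances.\<close>

lemma tendsto_L2_compose:
  fixes G :: "real ^ 'm::finite \<Rightarrow> real" and U :: "real ^ 'n::finite \<Rightarrow> real ^ 'm"
  assumes G: "C_k 1 G"
    and lim: "\<And>b. tendsto_L2 (\<lambda>n x. indicator (cball 0 R) x * V n x $ b) (\<lambda>x. indicator (cball 0 R) x * U x $ b)"
    and meas: "U \<in> borel_measurable borel" "\<And>n. V n \<in> borel_measurable borel"
    and V: "\<And>n x. norm x \<le> R \<Longrightarrow> norm (V n x) \<le> K"
    and U: "AE x in lborel. norm x \<le> R \<longrightarrow> norm (U x) \<le> K"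
  shows "tendsto_L2 (\<lambda>n x. indicator (cball 0 R) x * G (V n x)) (\<lambda>x. indicator (cball 0 R) x * G (U x))"
proof -
  have cG: "continuous_on UNIV G" by (rule C_k_imp_continuous[OF G])
  note gm = borel_measurable_continuous_onI[OF cG]
  obtain L where L: "0 \<le> L" "\<And>y z. norm y \<le> K \<Longrightarrow> norm z \<le> K \<Longrightarrow> \<bar>G y - G z\<bar> \<le> L * norm (y - z)"
    using C_1_lipschitz_cball[OF G] by blast
  have "compact (G ` cball 0 K)" by (intro compact_continuous_image continuous_on_subset[OF cG]) auto
  then have "bounded (G ` cball 0 K)" by (rule compact_imp_bounded)
  then obtain B where "\<forall>y\<in>cball 0 K. \<bar>G y\<bar> \<le> B" unfolding bounded_iff by auto
  then have B: "\<bar>G y\<bar> \<le> B" if "norm y \<le> K" for y using that by simp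
  have sU: "square_integrable (\<lambda>x. indicator (cball 0 R) x * G (U x))"
  proof (rule square_integrable_AE_bound[of _ B R])
    show "AE x in lborel. \<bar>indicator (cball 0 R) x * G (U x)\<bar> \<le> B * indicator (cball 0 R) x"
      using U by eventually_elim (auto simp: indicator_def B)
  qed (auto intro!: borel_measurable_times borel_measurable_indicator measurable_compose[OF meas(1) gm])
  have sV: "square_integrable (\<lambda>x. indicator (cball 0 R) x * G (V n x))" for n
  proof (rule square_integrable_AE_bound[of _ B R])
    show "AE x in lborel. \<bar>indicator (cball 0 R) x * G (V n x)\<bar> \<le> B * indicator (cball 0 R) x"
      using V[of _ n] B by (auto simp: indicator_def)
  qed (auto intro!: borel_measurable_times borel_measurable_indicator measurable_compose[OF meas(2) gm])
  let ?d = "\<lambda>n b x. (indicator (cball 0 R) x * V n x $ b - indicator (cball 0 R) x * U x $ b)\<^sup>2"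
  have Id: "integrable lborel (?d n b)" for n b
    using lim[of b] square_integrable_diff square_integrable_integrable unfolding tendsto_L2_def by blast
  have z: "(\<lambda>n. L\<^sup>2 * (\<Sum>b\<in>UNIV. LINT x|lborel. ?d n b x)) \<longlonglongrightarrow> 0"
  proof -
    have "(\<lambda>n. L\<^sup>2 * (\<Sum>b\<in>UNIV. LINT x|lborel. ?d n b x)) \<longlonglongrightarrow> L\<^sup>2 * (\<Sum>b\<in>(UNIV :: 'm set). 0)"
      using lim unfolding tendsto_L2_def by (intro tendsto_mult tendsto_const tendsto_sum) blast
    then show ?thesis by simp
  qed
  have "(\<lambda>n. LINT x|lborel. (indicator (cball 0 R) x * G (V n x) - indicator (cball 0 R) x * G (U x))\<^sup>2) \<longlonglongrightarrow> 0"
  proof (rule tendsto_sandwich[OF _ _ tendsto_const z])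
    show "\<forall>\<^sub>F n in sequentially. 0 \<le> (LINT x|lborel. (indicator (cball 0 R) x * G (V n x) - indicator (cball 0 R) x * G (U x))\<^sup>2)"
      by (intro always_eventually allI integral_nonneg_AE AE_I2) simp
    show "\<forall>\<^sub>F n in sequentially. (LINT x|lborel. (indicator (cball 0 R) x * G (V n x) - indicator (cball 0 R) x * G (U x))\<^sup>2)
       \<le> L\<^sup>2 * (\<Sum>b\<in>UNIV. LINT x|lborel. ?d n b x)"
    proof (intro always_eventually allI)
      fix n
      have "(LINT x|lborel. (indicator (cball 0 R) x * G (V n x) - indicator (cball 0 R) x * G (U x))\<^sup>2)
         \<le> (LINT x|lborel. L\<^sup>2 * (\<Sum>b\<in>UNIV. ?d n b x))"
      proof (rule integral_mono_AE)
        show "integrable lborel (\<lambda>x. (indicator (cball 0 R) x * G (V n x) - indicator (cball 0 R) x * G (U x))\<^sup>2)"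
          by (intro square_integrable_integrable square_integrable_diff sU sV)
        show "integrable lborel (\<lambda>x. L\<^sup>2 * (\<Sum>b\<in>UNIV. ?d n b x))"
          by (intro integrable_mult_right Bochner_Integration.integrable_sum Id)
        show "AE x in lborel. (indicator (cball 0 R) x * G (V n x) - indicator (cball 0 R) x * G (U x))\<^sup>2
            \<le> L\<^sup>2 * (\<Sum>b\<in>UNIV. ?d n b x)"
          using U
        proof eventually_elim
          case (elim x)
          show ?case
          proof (cases "norm x \<le> R")
            case True
            have "\<bar>G (V n x) - G (U x)\<bar>\<^sup>2 \<le> (L * norm (V n x - U x))\<^sup>2"
              using True elim V by (intro power_mono L) auto
            also have "\<dots> = L\<^sup>2 * (\<Sum>b\<in>UNIV. (V n x $ b - U x $ b)\<^sup>2)"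
              by (simp add: power_mult_distrib norm_vec_def L2_set_def sum_nonneg)
            finally show ?thesis using True by simp
          qed simp
        qed
      qed
      also have "\<dots> = L\<^sup>2 * (\<Sum>b\<in>UNIV. LINT x|lborel. ?d n b x)"
        using Id by simp
      finally show "(LINT x|lborel. (indicator (cball 0 R) x * G (V n x) - indicator (cball 0 R) x * G (U x))\<^sup>2)
       \<le> L\<^sup>2 * (\<Sum>b\<in>UNIV. LINT x|lborel. ?d n b x)" .
    qed
  qed
  then show ?thesis using sU sV by (simp add: tendsto_L2_def)
qed

lemma C_1_compose:
  fixes W :: "real ^ 'm::finite \<Rightarrow> real" and v :: "'m \<Rightarrow> real ^ 'n::finite \<Rightarrow> real"
  assumes W: "C_k 1 W" and v: "\<And>a. smooth (v a)"
  shows "partial i (\<lambda>x. W (\<chi> a. v a x)) = (\<lambda>x. \<Sum>a\<in>UNIV. partial a W (\<chi> a. v a x) * partial i (v a) x)"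
    and "C_k 1 (\<lambda>x. W (\<chi> a. v a x))"
proof -
  have V: "((\<lambda>x. \<chi> a. v a x) has_derivative (\<lambda>h. \<chi> a. \<Sum>j\<in>UNIV. h $ j * partial j (v a) x)) (at x)" for x
    unfolding has_derivative_componentwise_within
      [of "\<lambda>x. \<chi> a. v a x" "\<lambda>h. \<chi> a. \<Sum>j\<in>UNIV. h $ j * partial j (v a) x"]
    using v smooth_differentiable by (auto simp: Basis_vec_def inner_axis intro!: has_derivative_partial)
  have d: "((\<lambda>x. W (\<chi> a. v a x)) has_derivative
      (\<lambda>h. \<Sum>b\<in>UNIV. (\<chi> a. \<Sum>j\<in>UNIV. h $ j * partial j (v a) x) $ b * partial b W (\<chi> a. v a x))) (at x)" for x
    by (rule has_derivative_compose[OF V has_derivative_partial]) (use W in auto)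
  have "partial i (\<lambda>x. W (\<chi> a. v a x)) = (\<lambda>x. \<Sum>a\<in>UNIV. partial a W (\<chi> a. v a x) * partial i (v a) x)" for i
  proof (rule ext, subst partial_eqI[OF d], intro sum.cong refl)
    fix x a
    have "(\<Sum>j\<in>UNIV. (axis i 1 :: real ^ 'n) $ j * partial j (v a) x) = (\<Sum>j\<in>UNIV. if j = i then partial i (v a) x else 0)"
      by (intro sum.cong) (auto simp: axis_def)
    then show "(\<chi> a. \<Sum>j\<in>UNIV. axis i 1 $ j * partial j (v a) x) $ a * partial a W (\<chi> a. v a x)
       = partial a W (\<chi> a. v a x) * partial i (v a) x" by simp
  qed
  note p = this
  show "partial i (\<lambda>x. W (\<chi> a. v a x)) = (\<lambda>x. \<Sum>a\<in>UNIV. partial a W (\<chi> a. v a x) * partial i (v a) x)" by (rule p)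
  have cV: "continuous_on UNIV (\<lambda>x. \<chi> a. v a x)"
    by (intro continuous_on_vec_lambda smooth_continuous v)
  have "continuous_on UNIV (partial i (\<lambda>x. W (\<chi> a. v a x)))" for i
    unfolding p
    by (intro continuous_on_sum continuous_on_mult smooth_continuous smooth_partial v
        continuous_on_compose2[OF C_1_continuous_partial[OF W] cV]) auto
  then show "C_k 1 (\<lambda>x. W (\<chi> a. v a x))" using d by (auto simp: differentiable_def)
qed

lemma borel_measurable_vec_lambda:
  fixes f :: "'m::finite \<Rightarrow> 'a \<Rightarrow> real"
  assumes "\<And>a. f a \<in> borel_measurable M"
  shows "(\<lambda>x. \<chi> a. f a x) \<in> borel_measurable M"
  by (subst borel_measurable_euclidean_space) (auto simp: Basis_vec_def inner_axis assms)

text \<open>For mollified u, the product of W(u) and the test function is C^1 with bounded support,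
  so its derivative integrates to 0. Both resulting terms converge: W and its first derivatives are
  C^1, which allows \<open>tendsto_L2_compose\<close> for each of them.\<close>

lemma weak_chain_rule:
  fixes W :: "real ^ 'm::finite \<Rightarrow> real" and u :: "'m \<Rightarrow> real ^ 'n::finite \<Rightarrow> real"
  assumes W: "C_k 2 W"
    and u: "\<And>a. locally_square_integrable (u a)"
    and bd: "\<And>R. \<exists>C. \<forall>a. AE x in lborel. norm x \<le> R \<longrightarrow> \<bar>u a x\<bar> \<le> C"
    and Du: "\<And>a. square_integrable (Du a)"
    and wp: "\<And>a \<phi>. test_function \<phi> \<Longrightarrow> (LINT x|lborel. u a x * partial i \<phi> x) = - (LINT x|lborel. Du a x * \<phi> x)"
    and \<psi>: "test_function \<psi>"
  shows "(\<Sum>a\<in>UNIV. LINT x|lborel. partial a W (\<chi> b. u b x) * Du a x * \<psi> x)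
     = - (LINT x|lborel. W (\<chi> b. u b x) * partial i \<psi> x)"
proof -
  have W1: "C_k 1 W" "\<And>a. C_k 1 (partial a W)" using W C_k_mono[OF W, of 1] by (simp_all add: numeral_2_eq_2)
  have lu: "locally_integrable (u a)" for a by (rule locally_square_integrable_locally_integrable[OF u])
  have um: "u a \<in> borel_measurable borel" for a by (rule locally_integrable_measurable[OF lu])
  obtain R where R: "\<And>x. R < norm x \<Longrightarrow> \<psi> x = 0"
    using test_function_bounded_support[OF \<psi>] unfolding bounded_support_def by blast
  \<comment> \<open>Radius R + 1, because a mollification on the ball of radius R averages over
    points of the larger ball.\<close>
  obtain C where C: "\<And>a. AE x in lborel. norm x \<le> R + 1 \<longrightarrow> \<bar>u a x\<bar> \<le> C" using bd by blast
  define V where "V n x = (\<chi> b. mollify n (u b) x)" for n x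
  define U where "U x = (\<chi> b. u b x)" for x
  define K where "K = real CARD('m) * C"
  have norm_le: "norm (\<chi> b. w b) \<le> K" if "\<And>b. \<bar>w b\<bar> \<le> C" for w :: "'m \<Rightarrow> real"
  proof -
    have "norm (\<chi> b. w b) \<le> (\<Sum>b\<in>UNIV. \<bar>(\<chi> b. w b) $ b\<bar>)" by (rule norm_le_l1_cart)
    also have "\<dots> \<le> (\<Sum>b\<in>(UNIV :: 'm set). C)" by (intro sum_mono) (simp add: that)
    finally show ?thesis by (simp add: K_def)
  qed
  have VK: "norm (V n x) \<le> K" if "norm x \<le> R" for n x
    unfolding V_def by (intro norm_le mollify_bound[OF lu _ that]) (use C in simp)
  have "AE x in lborel. \<forall>a. norm x \<le> R + 1 \<longrightarrow> \<bar>u a x\<bar> \<le> C"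
    using C by (rule eventually_all_finite)
  then have UK: "AE x in lborel. norm x \<le> R \<longrightarrow> norm (U x) \<le> K"
    by eventually_elim (auto simp: U_def intro!: norm_le)
  have Um: "U \<in> borel_measurable borel" and Vm: "V n \<in> borel_measurable borel" for n
    unfolding U_def V_def by (intro borel_measurable_vec_lambda um measurable_mollify lu)+
  have lim: "tendsto_L2 (\<lambda>n x. indicator (cball 0 R) x * V n x $ b) (\<lambda>x. indicator (cball 0 R) x * U x $ b)" for b
    using mollify_tendsto_L2_local[OF u, of R b] by (simp add: V_def U_def)
  note comp = tendsto_L2_compose[OF _ lim Um Vm VK UK]
  \<comment> \<open>The indicators are harmless on the support of the test function. They bring each
    integrand into the form of two L2-convergent factors and a bounded weight; on the right the
    second factor is the constant sequence \<open>const\<close>.\<close>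
  have eq: "(\<Sum>a\<in>UNIV. LINT x|lborel. (indicator (cball 0 R) x * partial a W (V n x)) * mollify n (Du a) x * \<psi> x)
     = - (LINT x|lborel. (indicator (cball 0 R) x * W (V n x)) * indicator (cball 0 R) x * partial i \<psi> x)" for n
  proof -
    have s: "smooth (mollify n (u a))" for a by (rule smooth_mollify[OF lu])
    note c = C_1_compose[OF W1(1) s]
    have p: "partial i (mollify n (u a)) = mollify n (Du a)" for a
      by (rule mollify_weak_partial[OF lu wp])
    have cW: "C_k 1 (\<lambda>x. W (V n x))" using c(2) by (simp only: V_def)
    have pW: "partial i (\<lambda>x. W (V n x)) = (\<lambda>x. \<Sum>a\<in>UNIV. partial a W (V n x) * mollify n (Du a) x)"
      using c(1) by (simp only: V_def p)
    have "C_k 1 (\<lambda>x. W (V n x) * \<psi> x)" "bounded_support (\<lambda>x. W (V n x) * \<psi> x)"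
      using test_function_C_1[OF \<psi>] by (auto intro!: C_k_mult cW bounded_support_mult2 simp del: C_k.simps One_nat_def)
    then have "(LINT x|lborel. partial i (\<lambda>x. W (V n x) * \<psi> x) x) = 0" by (rule integral_partial_eq_0)
    also have "partial i (\<lambda>x. W (V n x) * \<psi> x)
       = (\<lambda>x. (\<Sum>a\<in>UNIV. partial a W (V n x) * mollify n (Du a) x * \<psi> x) + W (V n x) * partial i \<psi> x)"
      using C_1_differentiable[OF cW] smooth_differentiable[OF test_function_smooth[OF \<psi>]]
      by (subst partial_mult) (auto simp: pW sum_distrib_right)
    finally have z: "(LINT x|lborel. (\<Sum>a\<in>UNIV. partial a W (V n x) * mollify n (Du a) x * \<psi> x) + W (V n x) * partial i \<psi> x) = 0" .
    have cV: "continuous_on UNIV (V n)"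
      unfolding V_def by (intro continuous_on_vec_lambda smooth_continuous s)
    have I: "integrable lborel (\<lambda>x. partial a W (V n x) * mollify n (Du a) x * \<psi> x)" for a
      by (intro integrable_continuous_bounded_support continuous_on_mult bounded_support_mult2
          test_function_continuous test_function_bounded_support \<psi> smooth_continuous smooth_mollify
          square_integrable_locally_integrable Du
          continuous_on_compose2[OF C_1_continuous_partial[OF W1(1)] cV]) auto
    have J: "integrable lborel (\<lambda>x. W (V n x) * partial i \<psi> x)"
      by (intro integrable_continuous_bounded_support continuous_on_mult bounded_support_mult2
          test_function_continuous test_function_bounded_support test_function_partial \<psi>
          C_k_imp_continuous[OF cW])
    have e1: "(indicator (cball 0 R) x * a) * b * \<psi> x = a * b * \<psi> x" for a b x
      using R[of x] by (cases "norm x \<le> R") auto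
    have e2: "(indicator (cball 0 R) x * a) * indicator (cball 0 R) x * partial i \<psi> x = a * partial i \<psi> x" for a x
      using partial_zero_outside[of R \<psi> x i] R by (cases "norm x \<le> R") auto
    show ?thesis unfolding e1 e2 using z I J by simp
  qed
  obtain C1 C2 where C12: "\<And>x. \<bar>\<psi> x\<bar> \<le> C1" "\<And>x. \<bar>partial i \<psi> x\<bar> \<le> C2"
    using test_function_bounded[OF \<psi>] test_function_bounded[OF test_function_partial[OF \<psi>]] by metis
  have const: "tendsto_L2 (\<lambda>n. indicator (cball 0 R)) (indicator (cball 0 R) :: real ^ 'n \<Rightarrow> real)"
    by (simp add: tendsto_L2_def square_integrable_indicator_cball)
  have "(\<lambda>n. \<Sum>a\<in>UNIV. LINT x|lborel. (indicator (cball 0 R) x * partial a W (V n x)) * mollify n (Du a) x * \<psi> x)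
     \<longlonglongrightarrow> (\<Sum>a\<in>UNIV. LINT x|lborel. (indicator (cball 0 R) x * partial a W (U x)) * Du a x * \<psi> x)"
    by (intro tendsto_sum tendsto_L2_mult[OF comp[OF W1(2)] mollify_tendsto_L2[OF Du] _ C12(1)] test_function_measurable \<psi>)
  moreover have "(\<lambda>n. - (LINT x|lborel. (indicator (cball 0 R) x * W (V n x)) * indicator (cball 0 R) x * partial i \<psi> x))
     \<longlonglongrightarrow> - (LINT x|lborel. (indicator (cball 0 R) x * W (U x)) * indicator (cball 0 R) x * partial i \<psi> x)"
    by (intro tendsto_minus tendsto_L2_mult[OF comp[OF W1(1)] const _ C12(2)] test_function_measurable test_function_partial \<psi>)
  ultimately have "(\<Sum>a\<in>UNIV. LINT x|lborel. (indicator (cball 0 R) x * partial a W (U x)) * Du a x * \<psi> x)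
     = - (LINT x|lborel. (indicator (cball 0 R) x * W (U x)) * indicator (cball 0 R) x * partial i \<psi> x)"
    unfolding eq by (rule LIMSEQ_unique)
  moreover have "(indicator (cball 0 R) x * a) * b * \<psi> x = a * b * \<psi> x" for a b x
    using R[of x] by (cases "norm x \<le> R") auto
  moreover have "(indicator (cball 0 R) x * a) * indicator (cball 0 R) x * partial i \<psi> x = a * partial i \<psi> x" for a x
    using partial_zero_outside[of R \<psi> x i] R by (cases "norm x \<le> R") auto
  ultimately show ?thesis by (simp only: U_def)
qed

section \<open>Dilated vector fields and vanishing potential energy\<close>

lemma dilation_limit:
  fixes F :: "real ^ 'n::finite \<Rightarrow> real"
  assumes F: "integrable lborel F" and k: "test_function k"
  shows "(\<lambda>m. LINT x|lborel. F x * k (inverse (real (Suc m)) *\<^sub>R x)) \<longlonglongrightarrow> (LINT x|lborel. F x) * k 0"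
proof -
  have ck: "continuous_on UNIV k" by (rule test_function_continuous[OF k])
  obtain C where C: "0 < C" "\<And>x. \<bar>k x\<bar> \<le> C" using test_function_bounded[OF k] by blast
  note [measurable] = borel_measurable_integrable[OF F] test_function_measurable[OF k]
  have "(\<lambda>m. LINT x|lborel. F x * k (inverse (real (Suc m)) *\<^sub>R x)) \<longlonglongrightarrow> (LINT x|lborel. F x * k 0)"
  proof (rule integral_dominated_convergence)
    show "integrable lborel (\<lambda>x. C * \<bar>F x\<bar>)" using F by simp
    show "AE x in lborel. (\<lambda>m. F x * k (inverse (real (Suc m)) *\<^sub>R x)) \<longlonglongrightarrow> F x * k 0"
    proof (rule AE_I2)
      fix x :: "real ^ 'n"
      have "(\<lambda>m. inverse (real (Suc m)) *\<^sub>R x) \<longlonglongrightarrow> 0 *\<^sub>R x"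
        by (intro tendsto_scaleR LIMSEQ_inverse_real_of_nat tendsto_const)
      then have "(\<lambda>m. inverse (real (Suc m)) *\<^sub>R x) \<longlonglongrightarrow> 0" by simp
      then have "(\<lambda>m. k (inverse (real (Suc m)) *\<^sub>R x)) \<longlonglongrightarrow> k 0"
        by (rule continuous_on_tendsto_compose[OF ck]) auto
      then show "(\<lambda>m. F x * k (inverse (real (Suc m)) *\<^sub>R x)) \<longlonglongrightarrow> F x * k 0"
        by (intro tendsto_mult tendsto_const)
    qed
    show "AE x in lborel. norm (F x * k (inverse (real (Suc m)) *\<^sub>R x)) \<le> C * \<bar>F x\<bar>" for m
      using C by (intro AE_I2) (simp add: abs_mult mult.commute[of C] mult_left_mono)
  qed measurable
  then show ?thesis by simp
qed

text \<open>The scalar identities are summed before the limit is taken, since only the sum over the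
  components is a derivative of W(u). The dimension of the domain enters as the trace of the
  identity, the limit of the Jacobian of the vector field.\<close>

lemma pohozaev_potential_integral_eq_0:
  fixes W :: "real ^ 'm::finite \<Rightarrow> real" and u :: "'m \<Rightarrow> real ^ 'n::finite \<Rightarrow> real"
  assumes n: "2 \<le> CARD('n)" and W: "C_k 2 W" and W0: "\<And>y. 0 \<le> W y"
    and u: "\<And>a. locally_square_integrable (u a)"
    and bd: "\<And>R. \<exists>C. \<forall>a. AE x in lborel. norm x \<le> R \<longrightarrow> \<bar>u a x\<bar> \<le> C"
    and Du: "\<And>a i. square_integrable (Du a i)"
    and h: "\<And>a. locally_square_integrable (\<lambda>x. partial a W (\<chi> b. u b x))"
    and Wi: "integrable lborel (\<lambda>x. W (\<chi> b. u b x))"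
    and wp: "\<And>a i \<phi>. test_function \<phi> \<Longrightarrow> (LINT x|lborel. u a x * partial i \<phi> x) = - (LINT x|lborel. Du a i x * \<phi> x)"
    and wl: "\<And>a \<phi>. test_function \<phi> \<Longrightarrow> (LINT x|lborel. u a x * laplacian \<phi> x)
        = (LINT x|lborel. partial a W (\<chi> b. u b x) * \<phi> x)"
  shows "(LINT x|lborel. W (\<chi> b. u b x)) = 0"
proof -
  let ?U = "\<lambda>x. \<chi> b. u b x"
  have lu: "locally_integrable (u a)" for a by (rule locally_square_integrable_locally_integrable[OF u])
  have eq: "(\<Sum>a\<in>UNIV. (\<Sum>i\<in>UNIV. \<Sum>j\<in>UNIV. LINT x|lborel. Du a i x * Du a j x * partial j (X i) x)
     - 1 / 2 * (\<Sum>k\<in>UNIV. \<Sum>i\<in>UNIV. LINT x|lborel. Du a k x * Du a k x * partial i (X i) x))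
     = (\<Sum>i\<in>UNIV. LINT x|lborel. W (?U x) * partial i (X i) x)"
    if X: "\<And>i. test_function (X i)" for X
  proof -
    have "(\<Sum>a\<in>UNIV. (\<Sum>i\<in>UNIV. \<Sum>j\<in>UNIV. LINT x|lborel. Du a i x * Du a j x * partial j (X i) x)
       - 1 / 2 * (\<Sum>k\<in>UNIV. \<Sum>i\<in>UNIV. LINT x|lborel. Du a k x * Du a k x * partial i (X i) x))
       = (\<Sum>a\<in>UNIV. - (\<Sum>i\<in>UNIV. LINT x|lborel. partial a W (?U x) * Du a i x * X i x))"
      by (intro sum.cong refl pohozaev_weak[OF lu Du h wp wl X])
    \<comment> \<open>Exchanging the sums isolates, for each direction i, exactly the left-hand side
      of \<open>weak_chain_rule\<close>.\<close>
    also have "\<dots> = - (\<Sum>i\<in>UNIV. \<Sum>a\<in>UNIV. LINT x|lborel. partial a W (?U x) * Du a i x * X i x)"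
      unfolding sum_negf by (subst sum.swap) (rule refl)
    also have "\<dots> = - (\<Sum>i\<in>UNIV. - (LINT x|lborel. W (?U x) * partial i (X i) x))"
      by (subst weak_chain_rule[OF W u bd Du wp X]) auto
    finally show ?thesis by (simp add: sum_negf)
  qed
  define Y :: "'n \<Rightarrow> real ^ 'n \<Rightarrow> real" where "Y i z = z $ i * bump z" for i z
  have tY: "test_function (Y i)" for i
    unfolding Y_def[abs_def] by (intro test_function_mult2 test_function_bump smooth_intros(2))
  have pY: "partial j (Y i) 0 = (if i = j then 1 else 0)" for i j
  proof -
    have "partial j (Y i) = (\<lambda>z. (if i = j then 1 else 0) * bump z + z $ i * partial j bump z)"
      unfolding Y_def[abs_def]
      by (subst partial_smooth_simps(3)[OF smooth_intros(2) test_function_smooth[OF test_function_bump]])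
         (simp add: partial_component)
    then show ?thesis by (simp add: bump_0)
  qed
  \<comment> \<open>The prefactor compensates the dilation: X m i x = x_i bump(x / (m + 1)), and its
    partial derivatives are those of \<open>Y i\<close> at x / (m + 1), hence bounded independently
    of m.\<close>
  define X where "X m i x = real (Suc m) * Y i (inverse (real (Suc m)) *\<^sub>R x)" for m i x
  have tYs: "test_function (\<lambda>x. Y i (inverse (real (Suc m)) *\<^sub>R x))" for i m
    using test_function_affine[OF tY, of "inverse (real (Suc m))" i 0] by simp
  have tX: "test_function (X m i)" for m i
    unfolding X_def[abs_def] by (intro test_function_mult2 tYs smooth_intros(1))
  have pX: "partial j (X m i) = (\<lambda>x. partial j (Y i) (inverse (real (Suc m)) *\<^sub>R x))" for m i j
  proof -
    have "partial j (X m i) = (\<lambda>x. real (Suc m) * partial j (\<lambda>x. Y i (inverse (real (Suc m)) *\<^sub>R x)) x)"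
      unfolding X_def[abs_def] by (rule partial_cmult[OF smooth_differentiable[OF test_function_smooth[OF tYs]]])
    also have "partial j (\<lambda>x. Y i (inverse (real (Suc m)) *\<^sub>R x))
        = (\<lambda>x. inverse (real (Suc m)) * partial j (Y i) (inverse (real (Suc m)) *\<^sub>R x))"
      using partial_affine(1)[OF smooth_differentiable[OF test_function_smooth[OF tY]], of j i "inverse (real (Suc m))" 0]
      by simp
    finally show ?thesis by (simp add: fun_eq_iff)
  qed
  have lim: "(\<lambda>m. LINT x|lborel. F x * partial j (X m i) x) \<longlonglongrightarrow> (LINT x|lborel. F x) * (if i = j then 1 else 0)"
    if "integrable lborel F" for F i j
    unfolding pX pY[symmetric] by (rule dilation_limit[OF that test_function_partial[OF tY]])
  note iD = square_integrable_mult_integrable[OF Du Du]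
  have "(\<lambda>m. \<Sum>a\<in>UNIV. (\<Sum>i\<in>UNIV. \<Sum>j\<in>UNIV. LINT x|lborel. Du a i x * Du a j x * partial j (X m i) x)
     - 1 / 2 * (\<Sum>k\<in>UNIV. \<Sum>i\<in>UNIV. LINT x|lborel. Du a k x * Du a k x * partial i (X m i) x))
   \<longlonglongrightarrow> (\<Sum>a\<in>UNIV. (\<Sum>i\<in>UNIV. \<Sum>j\<in>UNIV. (LINT x|lborel. Du a i x * Du a j x) * (if i = j then 1 else 0))
     - 1 / 2 * (\<Sum>k\<in>UNIV. \<Sum>i\<in>(UNIV :: 'n set). (LINT x|lborel. Du a k x * Du a k x) * (if i = i then 1 else 0)))"
    by (intro tendsto_sum tendsto_diff tendsto_mult tendsto_const lim iD)
  moreover have "(\<lambda>m. \<Sum>i\<in>UNIV. LINT x|lborel. W (?U x) * partial i (X m i) x)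
     \<longlonglongrightarrow> (\<Sum>i\<in>(UNIV :: 'n set). (LINT x|lborel. W (?U x)) * (if i = i then 1 else 0))"
    by (intro tendsto_sum lim Wi)
  ultimately have "(\<Sum>a\<in>UNIV. (\<Sum>i\<in>UNIV. \<Sum>j\<in>UNIV. (LINT x|lborel. Du a i x * Du a j x) * (if i = j then 1 else 0))
     - 1 / 2 * (\<Sum>k\<in>UNIV. \<Sum>i\<in>(UNIV :: 'n set). (LINT x|lborel. Du a k x * Du a k x) * (if i = i then 1 else 0)))
     = (\<Sum>i\<in>(UNIV :: 'n set). (LINT x|lborel. W (?U x)) * (if i = i then 1 else 0))"
    unfolding eq[OF tX] by (rule LIMSEQ_unique)
  moreover define E where "E = (\<Sum>a\<in>UNIV. \<Sum>i\<in>UNIV. LINT x|lborel. Du a i x * Du a i x)"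
  moreover have "(\<Sum>j\<in>UNIV. (LINT x|lborel. Du a i x * Du a j x) * (if i = j then 1 else 0)) = (LINT x|lborel. Du a i x * Du a i x)" for a i
  proof -
    have "(\<Sum>j\<in>UNIV. (LINT x|lborel. Du a i x * Du a j x) * (if i = j then 1 else 0))
      = (\<Sum>j\<in>UNIV. if j = i then (LINT x|lborel. Du a i x * Du a i x) else 0)"
      by (intro sum.cong) auto
    then show ?thesis by simp
  qed
  ultimately have "E - 1 / 2 * (real CARD('n) * E) = real CARD('n) * (LINT x|lborel. W (?U x))"
    by (simp add: sum_subtractf sum_distrib_left sum_divide_distrib)
  moreover have "0 \<le> E" unfolding E_def by (intro sum_nonneg integral_nonneg_AE AE_I2) simp
  \<comment> \<open>As E >= 0 and the dimension is at least 2, the left-hand side E - n E / 2 of the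
    limit identity is at most 0, so n times the integral of W(u) is too.\<close>
  then have "2 * E \<le> real CARD('n) * E" using n by (intro mult_right_mono) auto
  ultimately have "real CARD('n) * (LINT x|lborel. W (?U x)) \<le> 0" by linarith
  then have "(LINT x|lborel. W (?U x)) \<le> 0" using n by (simp add: mult_le_0_iff)
  moreover have "0 \<le> (LINT x|lborel. W (?U x))" by (intro integral_nonneg_AE AE_I2 W0)
  ultimately show ?thesis by linarith
qed

subsection \<open>A Liouville theorem\<close>

text \<open>Hence the dilated cutoffs increase with their scale, which makes the localised energies
  in the Liouville argument nondecreasing.\<close>

lemma bump_antimono:
  fixes x y :: "real ^ 'n::finite"
  shows "norm x \<le> norm y \<Longrightarrow> bump y \<le> bump x"
proof (cases "norm y < 1")
  case True
  assume le: "norm x \<le> norm y"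
  have y: "(norm y)\<^sup>2 < 1" using True abs_square_less_1[of "norm y"] by simp
  have "(norm x)\<^sup>2 \<le> (norm y)\<^sup>2" using le by (intro power_mono) auto
  then have "1 / (1 - (norm x)\<^sup>2) \<le> 1 / (1 - (norm y)\<^sup>2)"
    using y by (intro divide_left_mono mult_pos_pos) linarith+
  moreover have "flat 1 (1 - (norm z)\<^sup>2) = exp (- (1 / (1 - (norm z)\<^sup>2)))" if "(norm z)\<^sup>2 < 1" for z :: "real ^ 'n"
    unfolding flat_def using that by (subst if_P, linarith, simp)
  moreover have "(norm x)\<^sup>2 < 1" using y \<open>(norm x)\<^sup>2 \<le> (norm y)\<^sup>2\<close> by linarith
  ultimately show ?thesis using y by (simp only: bump_def mult_le_cancel_left_pos exp_gt_zero exp_le_cancel_iff neg_le_iff_le)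
next
  case False
  then show ?thesis by (simp add: bump_eq_0 bump_nonneg)
qed

lemma partial_eq_0_constant:
  fixes g :: "real ^ 'n::finite \<Rightarrow> real"
  assumes "smooth g" "\<And>j x. partial j g x = 0"
  shows "g x = g 0"
proof -
  have "(g has_derivative (\<lambda>h. 0)) (at x)" for x
    using has_derivative_partial[of g x] smooth_differentiable[OF assms(1)] assms(2) by simp
  then have "\<exists>c. \<forall>x\<in>UNIV. g x = c" by (intro has_derivative_zero_constant) auto
  then show ?thesis by auto
qed

text \<open>The divergence of eta^2 g grad g integrates to 0, and harmonicity removes its
  second-order term. Absorbing half of the main term leaves A / 2 <= 2 B, hence the constant
  4.\<close>

lemma caccioppoli:
  fixes g :: "real ^ 'n::finite \<Rightarrow> real"
  assumes g: "smooth g" and harm: "\<And>x. laplacian g x = 0" and \<eta>: "test_function \<eta>"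
  shows "(LINT x|lborel. (\<Sum>j\<in>UNIV. (\<eta> x * partial j g x)\<^sup>2)) \<le> 4 * (LINT x|lborel. (\<Sum>j\<in>UNIV. (g x * partial j \<eta> x)\<^sup>2))"
proof -
  have s\<eta>: "smooth \<eta>" by (rule test_function_smooth[OF \<eta>])
  define F where "F j x = \<eta> x * \<eta> x * (g x * partial j g x)" for j x
  have sp: "smooth (partial j g)" for j by (rule smooth_partial[OF g])
  have tF: "test_function (F j)" for j
    unfolding F_def[abs_def] by (intro test_function_mult1 \<eta> smooth_intros(5) s\<eta> g sp)
  have dF: "partial j (F j) x = 2 * (\<eta> x * partial j g x * (g x * partial j \<eta> x)) + (\<eta> x * partial j g x)\<^sup>2
      + \<eta> x * \<eta> x * g x * partial j (partial j g) x" for j x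
    unfolding F_def[abs_def]
    by (simp add: partial_smooth_simps(3) smooth_intros(5) s\<eta> g sp power2_eq_square algebra_simps)
  have sum0: "(\<Sum>j\<in>UNIV. \<eta> x * \<eta> x * g x * partial j (partial j g) x) = 0" for x
    using harm[of x] by (simp add: laplacian_def sum_distrib_left[symmetric])
  have t1: "test_function (\<lambda>x. (\<eta> x * partial j g x)\<^sup>2)" "test_function (\<lambda>x. (g x * partial j \<eta> x)\<^sup>2)" for j
    unfolding power2_eq_square
    by (intro test_function_mult1 test_function_mult2 test_function_partial smooth_intros(5) smooth_partial \<eta> s\<eta> g sp)+
  have i1: "integrable lborel (\<lambda>x. (\<Sum>j\<in>UNIV. (\<eta> x * partial j g x)\<^sup>2))"
    "integrable lborel (\<lambda>x. (\<Sum>j\<in>UNIV. (g x * partial j \<eta> x)\<^sup>2))"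
    by (intro integrable_test_function test_function_sum t1)+
  have iF: "integrable lborel (\<lambda>x. partial j (F j) x)" for j
    by (intro integrable_test_function test_function_partial tF)
  have z: "(LINT x|lborel. (\<Sum>j\<in>UNIV. partial j (F j) x)) = 0"
    using iF integral_partial_test_function[OF tF] by simp
  have "(LINT x|lborel. 1 / 2 * (\<Sum>j\<in>UNIV. (\<eta> x * partial j g x)\<^sup>2) - 2 * (\<Sum>j\<in>UNIV. (g x * partial j \<eta> x)\<^sup>2))
     \<le> (LINT x|lborel. (\<Sum>j\<in>UNIV. partial j (F j) x))"
  proof (rule integral_mono)
    show "integrable lborel (\<lambda>x. 1 / 2 * (\<Sum>j\<in>UNIV. (\<eta> x * partial j g x)\<^sup>2) - 2 * (\<Sum>j\<in>UNIV. (g x * partial j \<eta> x)\<^sup>2))"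
      using i1 by (intro Bochner_Integration.integrable_diff integrable_mult_right)
    show "integrable lborel (\<lambda>x. \<Sum>j\<in>UNIV. partial j (F j) x)" using iF by (intro Bochner_Integration.integrable_sum)
    fix x
    have "(\<Sum>j\<in>UNIV. partial j (F j) x)
       = (\<Sum>j\<in>UNIV. 2 * (\<eta> x * partial j g x * (g x * partial j \<eta> x)) + (\<eta> x * partial j g x)\<^sup>2)"
      by (simp only: dF sum.distrib sum0 add_0_right)
    also have "\<dots> \<ge> (\<Sum>j\<in>UNIV. 1 / 2 * (\<eta> x * partial j g x)\<^sup>2 - 2 * (g x * partial j \<eta> x)\<^sup>2)"
    proof (rule sum_mono)
      fix j
      \<comment> \<open>This is one half of (a + 2 b)^2 >= 0.\<close>
      have "1 / 2 * a\<^sup>2 - 2 * b\<^sup>2 \<le> 2 * (a * b) + a\<^sup>2" for a b :: real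
      proof -
        have "0 \<le> (a + 2 * b)\<^sup>2" by simp
        then show ?thesis by (simp add: power2_eq_square algebra_simps)
      qed
      then show "1 / 2 * (\<eta> x * partial j g x)\<^sup>2 - 2 * (g x * partial j \<eta> x)\<^sup>2
        \<le> 2 * (\<eta> x * partial j g x * (g x * partial j \<eta> x)) + (\<eta> x * partial j g x)\<^sup>2"
        .
    qed
    finally show "1 / 2 * (\<Sum>j\<in>UNIV. (\<eta> x * partial j g x)\<^sup>2) - 2 * (\<Sum>j\<in>UNIV. (g x * partial j \<eta> x)\<^sup>2)
      \<le> (\<Sum>j\<in>UNIV. partial j (F j) x)"
      by (simp only: sum_subtractf sum_distrib_left)
  qed
  then show ?thesis
    unfolding z Bochner_Integration.integral_diff[OF integrable_mult_right[OF i1(1)] integrable_mult_right[OF i1(2)]]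
      integral_mult_right_zero by linarith
qed

lemma square_integrable_const_iff: "square_integrable (\<lambda>x :: 'a::euclidean_space. c) \<longleftrightarrow> c = 0"
proof
  assume "square_integrable (\<lambda>x :: 'a. c)"
  then have "(\<integral>\<^sup>+x. ennreal (norm (c\<^sup>2)) \<partial>(lborel :: 'a measure)) < \<infinity>"
    unfolding square_integrable_def integrable_iff_bounded by blast
  then show "c = 0" by (cases "c = 0") (auto simp: ennreal_mult_eq_top_iff)
qed (simp add: square_integrable_def)

text \<open>The gradient of the cutoff at scale m + 1 is of order 1 / (m + 1), so Caccioppoli bounds
  the localised energy \<open>I m\<close> by M / (m + 1)^2. These energies do not decrease in m, so
  all vanish; then \<open>g\<close> is constant, and a square-integrable constant on the whole space
  is 0.\<close>

lemma liouville_L2: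
  fixes g :: "real ^ 'n::finite \<Rightarrow> real"
  assumes g: "smooth g" and harm: "\<And>x. laplacian g x = 0" and L2: "square_integrable g"
  shows "g x = 0"
proof -
  obtain C where C: "\<And>j x. \<bar>partial j bump (x :: real ^ 'n)\<bar> \<le> C j"
    using test_function_bounded[OF test_function_partial[OF test_function_bump]] by metis
  define M where "M = 4 * (\<Sum>j\<in>UNIV. (C j)\<^sup>2) * (LINT x|lborel. (g x)\<^sup>2)"
  define \<eta> where "\<eta> m x = bump (inverse (real (Suc m)) *\<^sub>R x)" for m and x :: "real ^ 'n"
  have t\<eta>: "test_function (\<eta> m)" for m unfolding \<eta>_def[abs_def] by (rule test_function_scaled_bump) simp
  have p\<eta>: "partial j (\<eta> m) = (\<lambda>x. inverse (real (Suc m)) * partial j bump (inverse (real (Suc m)) *\<^sub>R x))" for j m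
    using partial_affine(1)[OF smooth_differentiable[OF test_function_smooth[OF test_function_bump]], of j "inverse (real (Suc m))" 0]
    by (simp add: \<eta>_def[abs_def])
  define I where "I m = (LINT x|lborel. (\<Sum>j\<in>UNIV. (\<eta> m x * partial j g x)\<^sup>2))" for m
  have t: "test_function (\<lambda>x. \<Sum>j\<in>UNIV. (\<eta> m x * partial j g x)\<^sup>2)"
    "test_function (\<lambda>x. \<Sum>j\<in>UNIV. (g x * partial j (\<eta> m) x)\<^sup>2)" for m
    unfolding power2_eq_square
    by (intro test_function_sum test_function_mult1 test_function_mult2 test_function_partial smooth_intros(5) smooth_partial
        t\<eta> test_function_smooth[OF t\<eta>] g)+
  have Ile: "I m \<le> (inverse (real (Suc m)))\<^sup>2 * M" for m
  proof -
    have "I m \<le> 4 * (LINT x|lborel. (\<Sum>j\<in>UNIV. (g x * partial j (\<eta> m) x)\<^sup>2))"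
      unfolding I_def by (rule caccioppoli[OF g harm t\<eta>])
    also have "\<dots> \<le> 4 * (LINT x|lborel. (inverse (real (Suc m)))\<^sup>2 * (\<Sum>j\<in>UNIV. (C j)\<^sup>2) * (g x)\<^sup>2)"
    proof (intro mult_left_mono integral_mono)
      show "integrable lborel (\<lambda>x. \<Sum>j\<in>UNIV. (g x * partial j (\<eta> m) x)\<^sup>2)"
        by (rule integrable_test_function[OF t(2)])
      show "integrable lborel (\<lambda>x. (inverse (real (Suc m)))\<^sup>2 * (\<Sum>j\<in>UNIV. (C j)\<^sup>2) * (g x)\<^sup>2)"
        by (intro integrable_mult_right square_integrable_integrable L2)
      fix x
      have "(g x * partial j (\<eta> m) x)\<^sup>2 \<le> (inverse (real (Suc m)))\<^sup>2 * (g x)\<^sup>2 * (C j)\<^sup>2" for j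
      proof -
        have "(partial j bump (inverse (real (Suc m)) *\<^sub>R x))\<^sup>2 \<le> (C j)\<^sup>2"
          using power_mono[OF C[of j "inverse (real (Suc m)) *\<^sub>R x"], of 2] by simp
        then have "(inverse (real (Suc m)))\<^sup>2 * (g x)\<^sup>2 * (partial j bump (inverse (real (Suc m)) *\<^sub>R x))\<^sup>2
          \<le> (inverse (real (Suc m)))\<^sup>2 * (g x)\<^sup>2 * (C j)\<^sup>2" by (intro mult_left_mono) auto
        then show ?thesis by (simp add: p\<eta> power_mult_distrib ac_simps del: of_nat_Suc)
      qed
      then have "(\<Sum>j\<in>UNIV. (g x * partial j (\<eta> m) x)\<^sup>2) \<le> (\<Sum>j\<in>UNIV. (inverse (real (Suc m)))\<^sup>2 * (g x)\<^sup>2 * (C j)\<^sup>2)"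
        by (rule sum_mono)
      also have "\<dots> = (inverse (real (Suc m)))\<^sup>2 * (\<Sum>j\<in>UNIV. (C j)\<^sup>2) * (g x)\<^sup>2"
        by (simp add: sum_distrib_left sum_distrib_right ac_simps del: of_nat_Suc)
      finally show "(\<Sum>j\<in>UNIV. (g x * partial j (\<eta> m) x)\<^sup>2) \<le> (inverse (real (Suc m)))\<^sup>2 * (\<Sum>j\<in>UNIV. (C j)\<^sup>2) * (g x)\<^sup>2" .
    qed simp
    also have "\<dots> = (inverse (real (Suc m)))\<^sup>2 * M" by (simp add: M_def)
    finally show ?thesis .
  qed
  have "(\<lambda>m. (inverse (real (Suc m)))\<^sup>2 * M) \<longlonglongrightarrow> 0\<^sup>2 * M"
    by (intro tendsto_intros LIMSEQ_inverse_real_of_nat)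
  then have lim: "(\<lambda>m. (inverse (real (Suc m)))\<^sup>2 * M) \<longlonglongrightarrow> 0" by simp
  have mono: "I m \<le> I k" if "m \<le> k" for m k
    unfolding I_def
  proof (intro integral_mono integrable_test_function t sum_mono)
    fix x :: "real ^ 'n" and j
    have "inverse (real (Suc k)) * norm x \<le> inverse (real (Suc m)) * norm x"
      using that by (intro mult_right_mono) auto
    then have "\<eta> m x \<le> \<eta> k x"
      unfolding \<eta>_def by (intro bump_antimono) simp
    then have "(\<eta> m x)\<^sup>2 \<le> (\<eta> k x)\<^sup>2" by (intro power_mono) (simp_all add: \<eta>_def bump_nonneg)
    then show "(\<eta> m x * partial j g x)\<^sup>2 \<le> (\<eta> k x * partial j g x)\<^sup>2"
      by (simp add: power_mult_distrib mult_right_mono)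
  qed
  have I0: "I m = 0" for m
  proof -
    \<comment> \<open>For every k >= m, I m <= I k <= M / (k + 1)^2, and the right-hand side tends
      to 0 with m fixed.\<close>
    have "I m \<le> 0"
    proof (rule LIMSEQ_le_const[OF lim], intro exI allI impI)
      fix k assume "m \<le> k"
      then show "I m \<le> (inverse (real (Suc k)))\<^sup>2 * M" using mono Ile order_trans by blast
    qed
    moreover have "0 \<le> I m" unfolding I_def by (intro integral_nonneg_AE AE_I2 sum_nonneg) simp
    ultimately show ?thesis by simp
  qed
  have "partial j g x = 0" for j x
  proof -
    \<comment> \<open>The scale is chosen so that x lies where the cutoff is positive. The integrand
      is continuous, so vanishing almost everywhere means vanishing at x.\<close>
    obtain m where m: "norm x < real m" using reals_Archimedean2 by blast
    have "AE x in lborel. (\<Sum>j\<in>UNIV. (\<eta> m x * partial j g x)\<^sup>2) = 0"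
      using I0[of m] unfolding I_def
      by (subst (asm) integral_nonneg_eq_0_iff_AE[OF integrable_test_function[OF t(1)]]) (auto simp: sum_nonneg)
    then have "AE x in lebesgue. x \<in> {x. (\<Sum>j\<in>UNIV. (\<eta> m x * partial j g x)\<^sup>2) = 0}"
      by (simp add: AE_completion_iff)
    then have "x \<in> {x. (\<Sum>j\<in>UNIV. (\<eta> m x * partial j g x)\<^sup>2) = 0}"
      by (rule mem_closed_if_AE_lebesgue[rotated]) (intro closed_Collect_eq test_function_continuous t continuous_on_const)
    then have "\<eta> m x * partial j g x = 0" by (auto simp: sum_nonneg_eq_0_iff)
    moreover have "0 < \<eta> m x" using m unfolding \<eta>_def by (simp add: bump_pos_iff field_simps)
    ultimately show ?thesis by simp
  qed
  then have c: "g x = g 0" for x by (rule partial_eq_0_constant[OF g])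
  then have "g = (\<lambda>x. g 0)" by auto
  with L2 have "square_integrable (\<lambda>x :: real ^ 'n. g 0)" by simp
  then have "g 0 = 0" by (simp add: square_integrable_const_iff)
  with c show ?thesis by simp
qed

text \<open>Derivatives of the mollifications are mollifications of \<open>Df\<close>, thus square
  integrable, and they are harmonic; so each mollification is a constant \<open>c n\<close>. The
  constants are bounded, and a convergent subsequence identifies \<open>f\<close> through local L2
  convergence.\<close>

lemma weakly_harmonic_finite_energy_constant:
  fixes f :: "real ^ 'n::finite \<Rightarrow> real"
  assumes f: "locally_square_integrable f"
    and bd: "\<exists>C. AE x in lborel. norm x \<le> 1 \<longrightarrow> \<bar>f x\<bar> \<le> C"
    and Df: "\<And>j. square_integrable (Df j)"
    and wp: "\<And>j \<phi>. test_function \<phi> \<Longrightarrow> (LINT x|lborel. f x * partial j \<phi> x) = - (LINT x|lborel. Df j x * \<phi> x)"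
    and wl: "\<And>\<phi>. test_function \<phi> \<Longrightarrow> (LINT x|lborel. f x * laplacian \<phi> x) = 0"
  shows "\<exists>c. AE x in lborel. f x = c"
proof -
  have lf: "locally_integrable f" by (rule locally_square_integrable_locally_integrable[OF f])
  have s: "smooth (mollify n f)" for n by (rule smooth_mollify[OF lf])
  have lap: "laplacian (mollify n f) = (\<lambda>x. 0)" for n
    using mollify_weak_laplacian[OF lf, of "\<lambda>x. 0" n] wl by (simp add: conv_def[abs_def])
  have p: "partial j (mollify n f) = mollify n (Df j)" for n j by (rule mollify_weak_partial[OF lf wp])
  have "partial j (mollify n f) x = 0" for j n x
  proof (rule liouville_L2)
    show "smooth (partial j (mollify n f))" by (rule smooth_partial[OF s])
    show "square_integrable (partial j (mollify n f))" unfolding p by (rule mollify_contraction[OF Df])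
    show "laplacian (partial j (mollify n f)) x = 0" for x
      by (simp add: laplacian_commute[OF s] lap)
  qed
  then have const: "mollify n f x = mollify n f 0" for n x by (rule partial_eq_0_constant[OF s])
  define c where "c n = mollify n f 0" for n
  have c: "mollify n f x = c n" for n x unfolding c_def by (rule const)
  obtain C where "AE x in lborel. norm x \<le> 1 \<longrightarrow> \<bar>f x\<bar> \<le> C" using bd by blast
  \<comment> \<open>Evaluating at the origin alone is enough: \<open>mollify_bound\<close> with
    radius 0 uses the bound for \<open>f\<close> on the unit ball.\<close>
  then have "\<bar>c n\<bar> \<le> C" for n unfolding c_def by (intro mollify_bound[OF lf, of 0]) auto
  then have "bounded (range c)" unfolding bounded_iff by auto
  then obtain l r where r: "strict_mono (r :: nat \<Rightarrow> nat)" "(c \<circ> r) \<longlonglongrightarrow> l"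
    using bounded_imp_convergent_subsequence by blast
  have AE: "AE x in lborel. norm x \<le> R \<longrightarrow> f x = l" for R
  proof -
    let ?i = "indicator (cball 0 R) :: real ^ 'n \<Rightarrow> real"
    have t: "tendsto_L2 (\<lambda>n x. ?i x * mollify n f x) (\<lambda>x. ?i x * f x)" by (rule mollify_tendsto_L2_local[OF f])
    have si: "square_integrable (\<lambda>x. ?i x * b)" for b
      by (rule square_integrable_bound[OF square_integrable_indicator_cball[of 0 R], of _ "\<bar>b\<bar>"])
         (auto simp: abs_mult intro!: borel_measurable_times borel_measurable_indicator)
    have sf: "square_integrable (\<lambda>x. ?i x * f x)" using t unfolding tendsto_L2_def by blast
    have d: "square_integrable (\<lambda>x. ?i x * c n - ?i x * f x)" for n by (intro square_integrable_diff si sf)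
    define J where "J = (LINT x|lborel. (?i x * l - ?i x * f x)\<^sup>2)"
    define V where "V = (LINT x|lborel. (?i x)\<^sup>2)"
    have lim: "(\<lambda>n. LINT x|lborel. (?i x * c n - ?i x * f x)\<^sup>2) \<longlonglongrightarrow> 0"
      using t unfolding tendsto_L2_def c by blast
    have lim2: "(\<lambda>k. 2 * (LINT x|lborel. (?i x * c (r k) - ?i x * f x)\<^sup>2) + 2 * ((c (r k) - l)\<^sup>2 * V)) \<longlonglongrightarrow> 2 * 0 + 2 * ((l - l)\<^sup>2 * V)"
      by (intro tendsto_intros LIMSEQ_subseq_LIMSEQ[OF lim r(1), unfolded o_def] r(2)[unfolded o_def])
    \<comment> \<open>\<open>J\<close> is the squared L2 distance from \<open>f\<close> to
      \<open>l\<close> on the ball. It is compared through \<open>c n\<close>; along the subsequence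
      both parts of the bound tend to 0.\<close>
    have Jle: "J \<le> 2 * (LINT x|lborel. (?i x * c n - ?i x * f x)\<^sup>2) + 2 * ((c n - l)\<^sup>2 * V)" for n
    proof -
      have i: "integrable lborel (\<lambda>x. (?i x * c n - ?i x * f x)\<^sup>2)" "integrable lborel (\<lambda>x. (?i x)\<^sup>2)"
        by (intro square_integrable_integrable d square_integrable_indicator_cball)+
      have "J \<le> (LINT x|lborel. 2 * (?i x * c n - ?i x * f x)\<^sup>2 + 2 * ((c n - l)\<^sup>2 * (?i x)\<^sup>2))"
        unfolding J_def
      proof (rule integral_mono)
        show "integrable lborel (\<lambda>x. (?i x * l - ?i x * f x)\<^sup>2)"
          by (intro square_integrable_integrable square_integrable_diff si sf)
        show "integrable lborel (\<lambda>x. 2 * (?i x * c n - ?i x * f x)\<^sup>2 + 2 * ((c n - l)\<^sup>2 * (?i x)\<^sup>2))"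
          using i by simp
        fix x
        have "(a - b)\<^sup>2 \<le> 2 * a\<^sup>2 + 2 * b\<^sup>2" for a b :: real
        proof -
          have "0 \<le> (a + b)\<^sup>2" by simp
          then show ?thesis by (simp add: power2_eq_square algebra_simps)
        qed
        from this[of "?i x * c n - ?i x * f x" "(c n - l) * ?i x"]
        have "((?i x * c n - ?i x * f x) - (c n - l) * ?i x)\<^sup>2 \<le> 2 * (?i x * c n - ?i x * f x)\<^sup>2 + 2 * ((c n - l)\<^sup>2 * (?i x)\<^sup>2)"
          by (simp only: power_mult_distrib)
        moreover have "(?i x * c n - ?i x * f x) - (c n - l) * ?i x = ?i x * l - ?i x * f x"
          by (simp add: algebra_simps)
        ultimately show "(?i x * l - ?i x * f x)\<^sup>2 \<le> 2 * (?i x * c n - ?i x * f x)\<^sup>2 + 2 * ((c n - l)\<^sup>2 * (?i x)\<^sup>2)"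
          by (simp only:)
      qed
      also have "\<dots> = 2 * (LINT x|lborel. (?i x * c n - ?i x * f x)\<^sup>2) + 2 * ((c n - l)\<^sup>2 * V)"
        using i by (simp add: V_def)
      finally show ?thesis .
    qed
    have "J \<le> 0" using LIMSEQ_le_const[OF lim2, of J] Jle by auto
    moreover have "0 \<le> J" unfolding J_def by (intro integral_nonneg_AE AE_I2) simp
    ultimately have "J = 0" by simp
    then have "AE x in lborel. (?i x * l - ?i x * f x)\<^sup>2 = 0"
      unfolding J_def
      by (subst (asm) integral_nonneg_eq_0_iff_AE[OF square_integrable_integrable[OF square_integrable_diff[OF si sf]]]) auto
    then show ?thesis by eventually_elim auto
  qed
  have "AE x in lborel. \<forall>R :: nat. norm x \<le> real R \<longrightarrow> f x = l"
    unfolding AE_all_countable using AE by blast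
  then have "AE x in lborel. f x = l"
    by eventually_elim (use real_arch_simple in blast)
  then show ?thesis by blast
qed

lemma partial_eq_0_at_minimum:
  assumes "W differentiable (at y)" "\<And>z. W y \<le> W z"
  shows "partial a W y = 0"
proof -
  have "(W has_derivative frechet_derivative W (at y)) (at y)"
    using assms(1) by (simp add: frechet_derivative_works[symmetric])
  from differential_zero_maxmin[OF UNIV_I open_UNIV this] assms(2)
  show ?thesis by (auto simp: partial_def)
qed

subsection \<open>From Lebesgue to Borel measurable representatives\<close>

text \<open>Changing \<open>f\<close> on a null set does not affect the integral, and completing the
  measure does not change integrals of Borel functions. This carries the weak identities over to
  Borel representatives.\<close>

lemma lebesgue_integral_eq_lborel:
  fixes f f' k :: "'a::euclidean_space \<Rightarrow> real"
  assumes f: "f \<in> borel_measurable lebesgue" and f': "f' \<in> borel_measurable borel"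
    and eq: "AE x in lborel. f x = f' x" and k: "continuous_on UNIV k"
  shows "(LINT x|lebesgue. f x * k x) = (LINT x|lborel. f' x * k x)"
proof -
  have k': "k \<in> borel_measurable borel" by (rule borel_measurable_continuous_onI[OF k])
  have m: "f' \<in> borel_measurable lebesgue" "k \<in> borel_measurable lebesgue"
    using f' k' by (auto intro: measurable_completion)
  have "(LINT x|lebesgue. f x * k x) = (LINT x|lebesgue. f' x * k x)"
    by (rule integral_cong_AE) (use f m eq in \<open>auto simp: AE_completion_iff intro!: borel_measurable_times\<close>)
  also have "\<dots> = (LINT x|lborel. f' x * k x)"
    using f' k' by (intro integral_completion) auto
  finally show ?thesis .
qed

lemma locally_square_integrable_AE_bound:
  fixes f :: "'a::euclidean_space \<Rightarrow> real"
  assumes "f \<in> borel_measurable borel" "\<And>R. \<exists>C. AE x in lborel. norm x \<le> R \<longrightarrow> \<bar>f x\<bar> \<le> C"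
  shows "locally_square_integrable f"
  unfolding locally_square_integrable_def
proof (intro conjI allI assms(1))
  fix R
  obtain C where "AE x in lborel. norm x \<le> R \<longrightarrow> \<bar>f x\<bar> \<le> C" using assms(2) by blast
  then have "AE x in lborel. \<bar>indicator (cball 0 R) x * f x\<bar> \<le> C * indicator (cball 0 R) x"
    by eventually_elim (auto simp: indicator_def)
  then show "square_integrable (\<lambda>x. indicator (cball 0 R) x * f x)"
    by (rule square_integrable_AE_bound[rotated])
       (auto intro!: borel_measurable_times borel_measurable_indicator assms(1))
qed

section \<open>Passage to Borel representatives and conclusion\<close>

theorem theorem3p1:
  fixes W :: "real ^ 'n \<Rightarrow> real"
    and u :: "real ^ 'n \<Rightarrow> real ^ 'n"
    and Du :: "real ^ 'n \<Rightarrow> real ^ 'n ^ 'n"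
  assumes "CARD('n) \<ge> 2"
    and "C_k 2 W"
    and "\<And>v. W v \<ge> 0"
    and "u \<in> W12_loc \<inter> Linf_loc"
    and "has_weak_jacobian u Du"
    and "weak_solution W u"
    and "(\<integral>\<^sup>+ x. ennreal (1 / 2 * (norm (Du x))\<^sup>2 + W (u x)) \<partial>lebesgue) < \<infinity>"
  shows "\<exists>c. AE x in lebesgue. u x = c"
proof -
  have wj: "has_weak_partial j (\<lambda>x. u x $ i) (\<lambda>x. Du x $ i $ j)" for i j
    using assms(5) by (simp add: has_weak_jacobian_def)
  have ws: "has_weak_laplacian (\<lambda>x. u x $ i) (\<lambda>x. partial i W (u x))" for i
    using assms(6) by (simp add: weak_solution_def gradient_def)
  have mu: "(\<lambda>x. u x $ i) \<in> borel_measurable lebesgue"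
    and mDu: "(\<lambda>x. Du x $ i $ j) \<in> borel_measurable lebesgue"
    and mW: "(\<lambda>x. partial i W (u x)) \<in> borel_measurable lebesgue" for i j
    using wj[of j i] ws[of i] by (auto simp: has_weak_partial_def has_weak_laplacian_def Lp_loc_def)
  \<comment> \<open>Representatives are chosen for each component separately; as there are finitely
    many indices, the exceptional null sets can be united.\<close>
  have "\<exists>u'. \<forall>i. u' i \<in> borel_measurable borel \<and> (AE x in lborel. u x $ i = u' i x)"
    using completion_ex_borel_measurable_real[OF mu] by (intro choice) auto
  then obtain u' where u': "\<And>i. u' i \<in> borel_measurable borel" "\<And>i. AE x in lborel. u x $ i = u' i x" by blast
  have "\<exists>D. \<forall>i. \<forall>j. D i j \<in> borel_measurable borel \<and> (AE x in lborel. Du x $ i $ j = D i j x)"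
    using completion_ex_borel_measurable_real[OF mDu] by (intro choice allI) auto
  then obtain D where D: "\<And>i j. D i j \<in> borel_measurable borel" "\<And>i j. AE x in lborel. Du x $ i $ j = D i j x" by blast
  define U where "U x = (\<chi> b. u' b x)" for x
  have uU: "AE x in lborel. u x = U x"
  proof -
    have "AE x in lborel. \<forall>i. u x $ i = u' i x" using u'(2) by (rule eventually_all_finite)
    then show ?thesis by eventually_elim (simp add: U_def vec_eq_iff)
  qed
  have Um: "U \<in> borel_measurable borel" unfolding U_def by (intro borel_measurable_vec_lambda u')
  have W1: "C_k 1 W" using C_k_mono[OF assms(2), of 1] by simp
  have Wm: "(\<lambda>x. W (U x)) \<in> borel_measurable borel"
    by (rule measurable_compose[OF Um borel_measurable_continuous_onI[OF C_k_imp_continuous[OF W1]]])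
  have cpW: "continuous_on UNIV (partial a W)" for a by (rule C_1_continuous_partial[OF W1])
  have pWm: "(\<lambda>x. partial a W (U x)) \<in> borel_measurable borel" for a
    by (rule measurable_compose[OF Um borel_measurable_continuous_onI[OF cpW]])
  have bU: "\<exists>C. AE x in lborel. norm x \<le> R \<longrightarrow> norm (U x) \<le> C" for R
  proof -
    have "compact (cball (0 :: real ^ 'n) R)" by simp
    then obtain C where "AE x in lebesgue. x \<in> cball 0 R \<longrightarrow> norm (u x) \<le> C"
      using assms(4) unfolding Linf_loc_def by blast
    then have "AE x in lborel. norm x \<le> R \<longrightarrow> norm (u x) \<le> C" by (simp add: AE_completion_iff)
    with uU have "AE x in lborel. norm x \<le> R \<longrightarrow> norm (U x) \<le> C" by eventually_elim simp
    then show ?thesis by blast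
  qed
  have bd: "\<exists>C. \<forall>a. AE x in lborel. norm x \<le> R \<longrightarrow> \<bar>u' a x\<bar> \<le> C" for R
  proof -
    obtain C where C: "AE x in lborel. norm x \<le> R \<longrightarrow> norm (U x) \<le> C" using bU by blast
    have "AE x in lborel. norm x \<le> R \<longrightarrow> \<bar>u' a x\<bar> \<le> C" for a
      using C
    proof eventually_elim
      case (elim x)
      then show ?case using component_le_norm_cart[of "U x" a] by (auto simp: U_def)
    qed
    then show ?thesis by blast
  qed
  have lu: "locally_square_integrable (u' a)" for a
    by (rule locally_square_integrable_AE_bound[OF u'(1)]) (use bd in blast)
  have lh: "locally_square_integrable (\<lambda>x. partial a W (U x))" for a
  proof (rule locally_square_integrable_AE_bound[OF pWm])
    fix R
    obtain K where K: "AE x in lborel. norm x \<le> R \<longrightarrow> norm (U x) \<le> K" using bU by blast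
    have "compact (partial a W ` cball 0 K)" by (intro compact_continuous_image continuous_on_subset[OF cpW]) auto
    then have "bounded (partial a W ` cball 0 K)" by (rule compact_imp_bounded)
    then obtain B where B: "\<forall>y\<in>cball 0 K. \<bar>partial a W y\<bar> \<le> B" unfolding bounded_iff by auto
    have "AE x in lborel. norm x \<le> R \<longrightarrow> \<bar>partial a W (U x)\<bar> \<le> B"
      using K by eventually_elim (use B in auto)
    then show "\<exists>C. AE x in lborel. norm x \<le> R \<longrightarrow> \<bar>partial a W (U x)\<bar> \<le> C" by blast
  qed
  have sD: "square_integrable (D i j)" for i j
  proof -
    \<comment> \<open>Since W >= 0, half the square of a single entry is at most the energy density,
      so finite energy makes every entry of the Jacobian square integrable on the whole
      space.\<close>
    have "(\<integral>\<^sup>+x. ennreal (norm (1 / 2 * (D i j x)\<^sup>2)) \<partial>lborel) = (\<integral>\<^sup>+x. ennreal (norm (1 / 2 * (D i j x)\<^sup>2)) \<partial>lebesgue)"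
      by (simp only: nn_integral_completion)
    also have "\<dots> \<le> (\<integral>\<^sup>+ x. ennreal (1 / 2 * (norm (Du x))\<^sup>2 + W (u x)) \<partial>lebesgue)"
    proof (rule nn_integral_mono_AE)
      have "AE x in lebesgue. Du x $ i $ j = D i j x" using D(2) by (simp add: AE_completion_iff)
      then show "AE x in lebesgue. ennreal (norm (1 / 2 * (D i j x)\<^sup>2)) \<le> ennreal (1 / 2 * (norm (Du x))\<^sup>2 + W (u x))"
      proof eventually_elim
        case (elim x)
        have "\<bar>Du x $ i $ j\<bar> \<le> norm (Du x $ i)" by (rule component_le_norm_cart)
        also have "\<dots> \<le> norm (Du x)" by (rule Finite_Cartesian_Product.norm_nth_le)
        finally have "\<bar>Du x $ i $ j\<bar>\<^sup>2 \<le> (norm (Du x))\<^sup>2" by (intro power_mono) auto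
        then show ?case using assms(3)[of "u x"] elim by (intro ennreal_leI) simp
      qed
    qed
    finally have "integrable lborel (\<lambda>x. 1 / 2 * (D i j x)\<^sup>2)"
      using assms(7) D(1)[of i j] by (intro integrableI_bounded) (auto intro: le_less_trans)
    then have "integrable lborel (\<lambda>x. 2 * (1 / 2 * (D i j x)\<^sup>2))" by (rule integrable_mult_right)
    then show ?thesis using D(1)[of i j] by (simp add: square_integrable_def)
  qed
  have Wi: "integrable lborel (\<lambda>x. W (U x))"
  proof (rule integrableI_bounded)
    have "(\<integral>\<^sup>+x. ennreal (norm (W (U x))) \<partial>lborel) = (\<integral>\<^sup>+x. ennreal (norm (W (U x))) \<partial>lebesgue)"
      by (simp only: nn_integral_completion)
    also have "\<dots> \<le> (\<integral>\<^sup>+ x. ennreal (1 / 2 * (norm (Du x))\<^sup>2 + W (u x)) \<partial>lebesgue)"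
    proof (rule nn_integral_mono_AE)
      have "AE x in lebesgue. u x = U x" using uU by (simp add: AE_completion_iff)
      then show "AE x in lebesgue. ennreal (norm (W (U x))) \<le> ennreal (1 / 2 * (norm (Du x))\<^sup>2 + W (u x))"
        by eventually_elim (use assms(3) in \<open>auto intro!: ennreal_leI\<close>)
    qed
    finally show "(\<integral>\<^sup>+x. ennreal (norm (W (U x))) \<partial>lborel) < \<infinity>" using assms(7) by (rule le_less_trans)
  qed (use Wm in simp)
  have wp: "(LINT x|lborel. u' a x * partial i \<phi> x) = - (LINT x|lborel. D a i x * \<phi> x)"
    if \<phi>: "test_function \<phi>" for a i \<phi>
  proof -
    have "(LINT x|lebesgue. u x $ a * partial i \<phi> x) = - (LINT x|lebesgue. Du x $ a $ i * \<phi> x)"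
      using wj[of i a] \<phi> unfolding has_weak_partial_def by blast
    then show ?thesis
      by (simp only: lebesgue_integral_eq_lborel[OF mu u' test_function_continuous[OF test_function_partial[OF \<phi>]]]
          lebesgue_integral_eq_lborel[OF mDu D test_function_continuous[OF \<phi>]])
  qed
  have eW: "AE x in lborel. partial a W (u x) = partial a W (U x)" for a
    using uU by eventually_elim simp
  have wl: "(LINT x|lborel. u' a x * laplacian \<phi> x) = (LINT x|lborel. partial a W (U x) * \<phi> x)"
    if \<phi>: "test_function \<phi>" for a \<phi>
  proof -
    have "(LINT x|lebesgue. u x $ a * laplacian \<phi> x) = (LINT x|lebesgue. partial a W (u x) * \<phi> x)"
      using ws[of a] \<phi> unfolding has_weak_laplacian_def by blast
    then show ?thesis
      by (simp only: lebesgue_integral_eq_lborel[OF mu u' test_function_continuous[OF test_function_laplacian[OF \<phi>]]]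
          lebesgue_integral_eq_lborel[OF mW pWm eW test_function_continuous[OF \<phi>]])
  qed
  have "(LINT x|lborel. W (U x)) = 0"
    unfolding U_def
    by (rule pohozaev_potential_integral_eq_0[OF assms(1,2,3) lu bd sD lh[unfolded U_def] Wi[unfolded U_def] wp wl[unfolded U_def]])
  then have "AE x in lborel. W (U x) = 0"
    using integral_nonneg_eq_0_iff_AE[OF Wi] assms(3) by simp
  \<comment> \<open>Where W(u) = 0, the value of u is a global minimum point of the nonnegative
    function W.\<close>
  then have grad0: "AE x in lborel. partial a W (U x) = 0" for a
  proof eventually_elim
    case (elim x)
    then show ?case using C_1_differentiable[OF W1] assms(3) by (intro partial_eq_0_at_minimum) auto
  qed
  have "\<exists>c. AE x in lborel. u' a x = c" for a
  proof (rule weakly_harmonic_finite_energy_constant[OF lu _ sD wp])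
    show "\<exists>C. AE x in lborel. norm x \<le> 1 \<longrightarrow> \<bar>u' a x\<bar> \<le> C" using bd by blast
    fix \<phi> :: "real ^ 'n \<Rightarrow> real" assume \<phi>: "test_function \<phi>"
    \<comment> \<open>The right-hand side of the system vanishes almost everywhere, so each
      component is weakly harmonic.\<close>
    have "(LINT x|lborel. partial a W (U x) * \<phi> x) = 0"
      by (rule integral_eq_zero_AE) (use grad0[of a] in \<open>eventually_elim, simp\<close>)
    then show "(LINT x|lborel. u' a x * laplacian \<phi> x) = 0" using wl[OF \<phi>] by simp
  qed
  then obtain c where "\<And>a. AE x in lborel. u' a x = c a" by metis
  then have "AE x in lborel. \<forall>a. u' a x = c a" by (rule eventually_all_finite)
  with uU have "AE x in lborel. u x = (\<chi> a. c a)" by eventually_elim (simp add: U_def vec_eq_iff)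
  then have "AE x in lebesgue. u x = (\<chi> a. c a)" by (simp add: AE_completion_iff)
  then show ?thesis by blast
qed

end
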